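(* Let $d\ge1$ be an integer constant. There is an algorithm which, given an instance $\mathcal I$ of a CSP of arity $d$ on $n$ variables ($n$ even) and a parameter $t$, runs in time $O(n^{3d})$ and either finds a kernel of $\mathcal I$ on at most $C_d t^2$ variables or certifies that $OPT\ge AVG+t$, under the bisection constraint $\sum_{i=1}^n x_i=0$, where $$C_d=24\,d^{2}\cdot 7^d\cdot 9^d\cdot 2^{2d}\cdot\big(d!\,(d-1)!\cdots 2!\big)^2 .$$
   Context: A CSP instance $\mathcal I$ of arity $d$ consists of variables $x_1,\dots,x_n\in\{\pm1\}$ and constraints $C_1,\dots,C_m$, where $C_i$ consists of $d$ variables $x_{i_1},\dots,x_{i_d}$ and a predicate $P_i\subseteq\{-1,1\}^d$; an assignment satisfies $C_i$ iff $(x_{i_1},\dots,x_{i_d})\in P_i$. Let $\mathrm{val}_{\mathcal I}(\alpha)$ be the number of constraints satisfied by $\alpha\in\{\pm1\}^n$. It is given by the multilinear polynomial $f_{\mathcal I}$ of degree at most $d$ obtained from $\sum_{i=1}^m\sum_{\sigma\in P_i}2^{-d}\prod_{j=1}^d(1+\sigma_jx_{i_j})$. Under the bisection constraint, $OPT=\max\{\mathrm{val}_{\mathcal I}(\alpha):\alpha\in\{\pm1\}^n,\ \sum_i\alpha_i=0\}$, and $AVG$ is the expectation of $\mathrm{val}_{\mathcal I}(\alpha)$ for $\alpha$ uniformly random among all $\alpha\in\{\pm1\}^n$ with $\sum_i\alpha_i=0$. "Finding a kernel on at most $K$ variables" means outputting a set of at most $K$ of the variables together with a multilinear polynomial of degree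 at most $d$ that depends only on these variables and that equals $f_{\mathcal I}(\alpha)$ for every $\alpha\in\{\pm1\}^n$ with $\sum_i\alpha_i=0$. *)

theory Defs
  imports
    "HOL-Probability.Probability"
    "HOL-Library.Landau_Symbols"
    "HOL-Library.Poly_Mapping"
begin

section \<open>Constraint satisfaction problems under the bisection constraint\<close>

text \<open>
  The variables are numbered \<open>0, \<dots>, n - 1\<close>.  A constraint is a pair of the list of its variables
  (repetitions are allowed) and its predicate, a set of sign vectors.  An instance is a list of
  constraints, in which the same constraint may occur several times.
\<close>

type_synonym constraint = "nat list \<times> int list set"

definition csp_instance :: "nat \<Rightarrow> nat \<Rightarrow> constraint list \<Rightarrow> bool" where
  "csp_instance d n Cs \<longleftrightarrow>
     (\<forall>(xs, P) \<in> set Cs. length xs = d \<and> set xs \<subseteq> {..<n} \<and>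
        P \<subseteq> {\<sigma>. length \<sigma> = d \<and> set \<sigma> \<subseteq> {-1, 1}})"

definition satisfies :: "(nat \<Rightarrow> int) \<Rightarrow> constraint \<Rightarrow> bool" where
  "satisfies \<alpha> C \<longleftrightarrow> map \<alpha> (fst C) \<in> snd C"

definition csp_val :: "constraint list \<Rightarrow> (nat \<Rightarrow> int) \<Rightarrow> nat" where
  "csp_val Cs \<alpha> = length (filter (satisfies \<alpha>) Cs)"

definition assignments :: "nat \<Rightarrow> (nat \<Rightarrow> int) set" where
  "assignments n = {..<n} \<rightarrow>\<^sub>E {-1, 1}"

definition bisections :: "nat \<Rightarrow> (nat \<Rightarrow> int) set" where
  "bisections n = {\<alpha> \<in> assignments n. (\<Sum>i<n. \<alpha> i) = 0}"

definition OPT :: "nat \<Rightarrow> constraint list \<Rightarrow> nat" where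
  "OPT n Cs = Max (csp_val Cs ` bisections n)"

definition AVG :: "nat \<Rightarrow> constraint list \<Rightarrow> real" where
  "AVG n Cs = measure_pmf.expectation (pmf_of_set (bisections n)) (\<lambda>\<alpha>. real (csp_val Cs \<alpha>))"


section \<open>Multilinear polynomials and kernels\<close>

text \<open>
  A multilinear polynomial maps each set \<open>S\<close> of variables to the coefficient of the monomial
  \<open>\<Prod>i\<in>S. x\<^sub>i\<close>.
\<close>

type_synonym mlpoly = "nat set \<Rightarrow>\<^sub>0 real"

definition mleval :: "mlpoly \<Rightarrow> (nat \<Rightarrow> int) \<Rightarrow> real" where
  "mleval p \<alpha> = (\<Sum>S \<in> Poly_Mapping.keys p. Poly_Mapping.lookup p S * (\<Prod>i\<in>S. of_int (\<alpha> i)))"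

definition degree_at_most :: "nat \<Rightarrow> mlpoly \<Rightarrow> bool" where
  "degree_at_most d p \<longleftrightarrow> (\<forall>S \<in> Poly_Mapping.keys p. finite S \<and> card S \<le> d)"

definition depends_only_on :: "nat set \<Rightarrow> mlpoly \<Rightarrow> bool" where
  "depends_only_on V p \<longleftrightarrow> (\<forall>S \<in> Poly_Mapping.keys p. S \<subseteq> V)"

text \<open>
  Expanding \<open>\<Prod>j<d. (1 + \<sigma>\<^sub>j x\<^bsub>i j\<^esub>)\<close> gives one term for each \<open>J \<subseteq> {..<d}\<close>.  Modulo \<open>x\<^sup>2 = 1\<close> its monomial
  is the product of the variables that occur an odd number of times at the positions in \<open>J\<close>; if the
  variables of the constraint are distinct, these are all the variables at these positions.
\<close>

definition monomial_of :: "nat list \<Rightarrow> nat set \<Rightarrow> nat set" where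
  "monomial_of xs J = {v \<in> (!) xs ` J. odd (card {j \<in> J. xs ! j = v})}"

definition constraint_poly :: "nat \<Rightarrow> constraint \<Rightarrow> mlpoly" where
  "constraint_poly d C =
     (\<Sum>\<sigma> \<in> snd C. \<Sum>J \<in> Pow {..<d}.
        Poly_Mapping.single (monomial_of (fst C) J) ((1 / 2 ^ d) * (\<Prod>j\<in>J. of_int (\<sigma> ! j))))"

definition csp_poly :: "nat \<Rightarrow> constraint list \<Rightarrow> mlpoly" where
  "csp_poly d Cs = (\<Sum>C \<leftarrow> Cs. constraint_poly d C)"

lemma mleval_superset:
  assumes "finite A" and "Poly_Mapping.keys p \<subseteq> A"
  shows "mleval p \<alpha> = (\<Sum>S\<in>A. Poly_Mapping.lookup p S * (\<Prod>i\<in>S. of_int (\<alpha> i)))"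
  unfolding mleval_def
  by (rule sum.mono_neutral_left) (use assms in \<open>auto simp: in_keys_iff\<close>)

lemma mleval_add: "mleval (p + q) \<alpha> = mleval p \<alpha> + mleval q \<alpha>"
proof -
  let ?A = "Poly_Mapping.keys p \<union> Poly_Mapping.keys q"
  have "Poly_Mapping.keys (p + q) \<subseteq> ?A" by (rule Poly_Mapping.keys_add)
  then show ?thesis
    by (simp add: mleval_superset[of ?A] lookup_add distrib_right sum.distrib)
qed

lemma mleval_0 [simp]: "mleval 0 \<alpha> = 0"
  by (simp add: mleval_def)

lemma mleval_single: "mleval (Poly_Mapping.single S c) \<alpha> = c * (\<Prod>i\<in>S. of_int (\<alpha> i))"
  by (subst mleval_superset[of "{S}"]) auto

lemma mleval_sum: "mleval (\<Sum>a\<in>A. f a) \<alpha> = (\<Sum>a\<in>A. mleval (f a) \<alpha>)"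
  by (induction A rule: infinite_finite_induct) (auto simp: mleval_add)

lemma mleval_sum_list: "mleval (\<Sum>a\<leftarrow>as. f a) \<alpha> = (\<Sum>a\<leftarrow>as. mleval (f a) \<alpha>)"
  by (induction as) (auto simp: mleval_add)

lemma prod_monomial_of:
  assumes "finite J" and "\<And>j. j \<in> J \<Longrightarrow> \<alpha> (xs ! j) \<in> {-1, 1}"
  shows "(\<Prod>v\<in>monomial_of xs J. real_of_int (\<alpha> v)) = (\<Prod>j\<in>J. of_int (\<alpha> (xs ! j)))"
proof -
  have "(\<Prod>j\<in>J. real_of_int (\<alpha> (xs ! j))) =
        (\<Prod>v\<in>(!) xs ` J. \<Prod>j\<in>{j\<in>J. xs ! j = v}. real_of_int (\<alpha> (xs ! j)))"
    using assms(1) by (rule prod.image_gen)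
  also have "\<dots> = (\<Prod>v\<in>(!) xs ` J. real_of_int (\<alpha> v) ^ card {j \<in> J. xs ! j = v})"
    by (intro prod.cong) auto
  also have "\<dots> = (\<Prod>v\<in>(!) xs ` J.
      if odd (card {j \<in> J. xs ! j = v}) then real_of_int (\<alpha> v) else 1)"
  proof (rule prod.cong)
    fix v assume "v \<in> (!) xs ` J"
    then have "\<alpha> v \<in> {-1, 1}" using assms(2) by auto
    then show "real_of_int (\<alpha> v) ^ card {j \<in> J. xs ! j = v} =
        (if odd (card {j \<in> J. xs ! j = v}) then real_of_int (\<alpha> v) else 1)" by auto
  qed simp
  also have "\<dots> = (\<Prod>v\<in>monomial_of xs J. real_of_int (\<alpha> v))"
    unfolding monomial_of_def using assms(1) by (simp add: prod.inter_filter)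
  finally show ?thesis ..
qed

lemma mleval_constraint_poly:
  assumes "length xs = d" and "set xs \<subseteq> {..<n}" and "P \<subseteq> {\<sigma>. length \<sigma> = d \<and> set \<sigma> \<subseteq> {-1, 1}}"
    and "\<alpha> \<in> assignments n"
  shows "mleval (constraint_poly d (xs, P)) \<alpha> = of_bool (satisfies \<alpha> (xs, P))"
proof -
  have \<alpha>: "\<alpha> (xs ! j) \<in> {-1, 1}" if "j < d" for j
  proof -
    have "xs ! j \<in> {..<n}" using that assms(1,2) nth_mem by blast
    then show ?thesis using assms(4) unfolding assignments_def by (rule PiE_mem[rotated])
  qed
  have fin: "finite P"
    by (rule finite_subset[OF _ finite_lists_length_eq[of "{-1, 1 :: int}" d]]) (use assms(3) in auto)
  have "mleval (constraint_poly d (xs, P)) \<alpha> =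
      (\<Sum>\<sigma>\<in>P. \<Sum>J\<in>Pow {..<d}. (1 / 2 ^ d) * (\<Prod>j\<in>J. of_int (\<sigma> ! j)) *
         (\<Prod>v\<in>monomial_of xs J. of_int (\<alpha> v)))"
    by (simp add: constraint_poly_def mleval_sum mleval_single)
  also have "\<dots> = (\<Sum>\<sigma>\<in>P. \<Sum>J\<in>Pow {..<d}. (1 / 2 ^ d) * (\<Prod>j\<in>J. of_int (\<sigma> ! j * \<alpha> (xs ! j))))"
  proof (intro sum.cong refl)
    fix \<sigma> J assume J: "J \<in> Pow {..<d}"
    then have "finite J" using finite_subset by auto
    moreover have "\<alpha> (xs ! j) \<in> {-1, 1}" if "j \<in> J" for j using \<alpha> J that by auto
    ultimately have "(\<Prod>v\<in>monomial_of xs J. real_of_int (\<alpha> v)) = (\<Prod>j\<in>J. of_int (\<alpha> (xs ! j)))"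
      by (rule prod_monomial_of)
    then show "(1 / 2 ^ d) * (\<Prod>j\<in>J. of_int (\<sigma> ! j)) * (\<Prod>v\<in>monomial_of xs J. of_int (\<alpha> v)) =
        (1 / 2 ^ d) * (\<Prod>j\<in>J. real_of_int (\<sigma> ! j * \<alpha> (xs ! j)))"
      by (simp add: prod.distrib)
  qed
  also have "\<dots> = (\<Sum>\<sigma>\<in>P. (1 / 2 ^ d) * (\<Prod>j<d. 1 + of_int (\<sigma> ! j * \<alpha> (xs ! j))))"
    by (subst add.commute) (simp add: prod_add sum_distrib_left del: of_int_mult)
  also have "\<dots> = (\<Sum>\<sigma>\<in>P. of_bool (\<sigma> = map \<alpha> xs))"
  proof (rule sum.cong)
    fix \<sigma> assume \<sigma>: "\<sigma> \<in> P"
    then have len: "length \<sigma> = d" and mem: "\<sigma> ! j \<in> {-1, 1}" if "j < d" for j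
      using assms(3) that nth_mem by blast+
    have len: "length \<sigma> = d" using \<sigma> assms(3) by blast
    show "(1 / 2 ^ d) * (\<Prod>j<d. 1 + real_of_int (\<sigma> ! j * \<alpha> (xs ! j))) = of_bool (\<sigma> = map \<alpha> xs)"
    proof (cases "\<sigma> = map \<alpha> xs")
      case True
      have "1 + real_of_int (\<sigma> ! j * \<alpha> (xs ! j)) = 2" if "j < d" for j
        using True \<alpha>[OF that] that assms(1) by auto
      then show ?thesis using True by simp
    next
      case False
      then obtain j where j: "j < d" "\<sigma> ! j \<noteq> \<alpha> (xs ! j)"
        using len assms(1) by (auto simp: list_eq_iff_nth_eq)
      then have "1 + real_of_int (\<sigma> ! j * \<alpha> (xs ! j)) = 0"
        using mem[OF j(1)] \<alpha>[OF j(1)] by auto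
      then have "(\<Prod>j<d. 1 + real_of_int (\<sigma> ! j * \<alpha> (xs ! j))) = 0"
        using j(1) by (intro prod_zero) auto
      then show ?thesis using False by simp
    qed
  qed simp
  also have "\<dots> = of_bool (satisfies \<alpha> (xs, P))"
    using fin by (simp add: satisfies_def of_bool_def)
  finally show ?thesis .
qed

lemma mleval_csp_poly:
  assumes "csp_instance d n Cs" and "\<alpha> \<in> assignments n"
  shows "mleval (csp_poly d Cs) \<alpha> = real (csp_val Cs \<alpha>)"
  using assms(1)
proof (induction Cs)
  case (Cons C Cs)
  then have "mleval (constraint_poly d C) \<alpha> = of_bool (satisfies \<alpha> C)"
    using mleval_constraint_poly[OF _ _ _ assms(2)] by (cases C) (auto simp: csp_instance_def)
  moreover have "csp_instance d n Cs" using Cons.prems by (simp add: csp_instance_def)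
  ultimately show ?case
    using Cons.IH by (simp add: csp_poly_def mleval_add csp_val_def)
qed (simp add: csp_poly_def csp_val_def)

definition is_kernel :: "nat \<Rightarrow> nat \<Rightarrow> constraint list \<Rightarrow> nat \<Rightarrow> nat set \<Rightarrow> mlpoly \<Rightarrow> bool" where
  "is_kernel d n Cs K V p \<longleftrightarrow>
     V \<subseteq> {..<n} \<and> card V \<le> K \<and> degree_at_most d p \<and> depends_only_on V p \<and>
     (\<forall>\<alpha> \<in> bisections n. mleval p \<alpha> = mleval (csp_poly d Cs) \<alpha>)"

definition kernel_const :: "nat \<Rightarrow> nat" where
  "kernel_const d = 24 * d ^ 2 * 7 ^ d * 9 ^ d * 2 ^ (2 * d) * (\<Prod>i = 2..d. fact i) ^ 2"


section \<open>Programs and running time\<close>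

text \<open>
  The machine model is the word RAM, programmed in a structured language.  A state consists of
  integer registers and integer arrays (all initially \<open>0\<close>, except for the input).  Every assignment
  and every evaluation of a test costs one step; as expressions are part of the program text, this
  differs from counting all arithmetic operations and memory accesses only by a constant factor for
  each program.  An assignment is possible only if the stored value is at most the word bound \<open>W\<close>
  in absolute value; a program attempting to store a larger value is stuck and has no final state.
  The intermediate results inside an expression need at most a constant factor more bits.
\<close>

datatype aexp =
    Lit int
  | Reg nat
  | Arr nat aexp
  | Plus aexp aexp
  | Minus aexp aexp
  | Times aexp aexp
  | Div aexp aexp
  | Mod aexp aexp

datatype bexp =
    Less aexp aexp
  | Equal aexp aexp
  | Neg bexp
  | Conj bexp bexp

datatype com =
    Skip
  | Assign nat aexp
  | Store nat aexp aexp
  | Seq com com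
  | Cond bexp com com
  | While bexp com

record state =
  regs :: "nat \<Rightarrow> int"
  arrs :: "nat \<Rightarrow> int \<Rightarrow> int"

fun aval :: "aexp \<Rightarrow> state \<Rightarrow> int" where
  "aval (Lit k) s = k"
| "aval (Reg r) s = regs s r"
| "aval (Arr A a) s = arrs s A (aval a s)"
| "aval (Plus a b) s = aval a s + aval b s"
| "aval (Minus a b) s = aval a s - aval b s"
| "aval (Times a b) s = aval a s * aval b s"
| "aval (Div a b) s = aval a s div aval b s"
| "aval (Mod a b) s = aval a s mod aval b s"

fun bval :: "bexp \<Rightarrow> state \<Rightarrow> bool" where
  "bval (Less a b) s \<longleftrightarrow> aval a s < aval b s"
| "bval (Equal a b) s \<longleftrightarrow> aval a s = aval b s"
| "bval (Neg b) s \<longleftrightarrow> \<not> bval b s"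
| "bval (Conj b c) s \<longleftrightarrow> bval b s \<and> bval c s"

text \<open>\<open>exec W c s T s'\<close>: with word bound \<open>W\<close>, command \<open>c\<close> leads from \<open>s\<close> to \<open>s'\<close> in \<open>T\<close> steps.\<close>

inductive exec :: "int \<Rightarrow> com \<Rightarrow> state \<Rightarrow> nat \<Rightarrow> state \<Rightarrow> bool" for W :: int where
  Skip: "exec W Skip s 1 s"
| Assign: "\<bar>aval a s\<bar> \<le> W \<Longrightarrow>
    exec W (Assign r a) s 1 (s\<lparr>regs := (regs s)(r := aval a s)\<rparr>)"
| Store: "\<bar>aval a s\<bar> \<le> W \<Longrightarrow>
    exec W (Store A i a) s 1
      (s\<lparr>arrs := (arrs s)(A := (arrs s A)(aval i s := aval a s))\<rparr>)"
| Seq: "exec W c s T s' \<Longrightarrow> exec W c' s' T' s'' \<Longrightarrow> exec W (Seq c c') s (T + T') s''"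
| CondTrue: "bval b s \<Longrightarrow> exec W c s T s' \<Longrightarrow> exec W (Cond b c c') s (Suc T) s'"
| CondFalse: "\<not> bval b s \<Longrightarrow> exec W c' s T s' \<Longrightarrow> exec W (Cond b c c') s (Suc T) s'"
| WhileFalse: "\<not> bval b s \<Longrightarrow> exec W (While b c) s 1 s"
| WhileTrue: "bval b s \<Longrightarrow> exec W c s T s' \<Longrightarrow> exec W (While b c) s' T' s'' \<Longrightarrow>
    exec W (While b c) s (Suc (T + T')) s''"

inductive_cases exec_SkipE: "exec W Skip s T s'"
inductive_cases exec_AssignE: "exec W (Assign r a) s T s'"
inductive_cases exec_StoreE: "exec W (Store A i a) s T s'"
inductive_cases exec_SeqE: "exec W (Seq c c') s T s'"
inductive_cases exec_CondE: "exec W (Cond b c c') s T s'"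
inductive_cases exec_WhileE: "exec W (While b c) s T s'"

lemma exec_deterministic:
  "exec W c s T s' \<Longrightarrow> exec W c s U u \<Longrightarrow> U = T \<and> u = s'"
proof (induction arbitrary: U u rule: exec.induct)
  case (Skip s)
  then show ?case by (rule exec_SkipE) simp
next
  case (Assign a s r)
  from Assign.prems show ?case by (rule exec_AssignE) simp
next
  case (Store a s A i)
  from Store.prems show ?case by (rule exec_StoreE) simp
next
  case (Seq c s T s' c' T' s'')
  from Seq.prems show ?case
  proof (rule exec_SeqE)
    fix T1 s1 T2
    assume "U = T1 + T2" and 1: "exec W c s T1 s1" and 2: "exec W c' s1 T2 u"
    then show ?case using Seq.IH(1)[OF 1] Seq.IH(2)[of T2 u] by simp
  qed
next
  case (CondTrue b s c T s' c')
  from CondTrue.prems show ?case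
  proof (rule exec_CondE)
    fix T1 assume "U = Suc T1" and "exec W c s T1 u"
    then show ?case using CondTrue.IH[of T1 u] by simp
  next
    assume "\<not> bval b s" then show ?case using CondTrue.hyps(1) by simp
  qed
next
  case (CondFalse b s c' T s' c)
  from CondFalse.prems show ?case
  proof (rule exec_CondE)
    fix T1 assume "U = Suc T1" and "exec W c' s T1 u"
    then show ?case using CondFalse.IH[of T1 u] by simp
  next
    assume "bval b s" then show ?case using CondFalse.hyps(1) by simp
  qed
next
  case (WhileFalse b s c)
  from WhileFalse.prems show ?case
    by (rule exec_WhileE) (use WhileFalse.hyps in simp_all)
next
  case (WhileTrue b s c T s' T' s'')
  from WhileTrue.prems show ?case
  proof (rule exec_WhileE)
    assume "\<not> bval b s" then show ?case using WhileTrue.hyps(1) by simp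
  next
    fix T1 s1 T2
    assume "U = Suc (T1 + T2)" and 1: "exec W c s T1 s1" and 2: "exec W (While b c) s1 T2 u"
    then show ?case using WhileTrue.IH(1)[OF 1] WhileTrue.IH(2)[of T2 u] by simp
  qed
qed

section \<open>Input and output\<close>

definition input_state :: "int list \<Rightarrow> state" where
  "input_state xs =
     \<lparr>regs = (\<lambda>_. 0),
      arrs = (\<lambda>A i. if A = 0 \<and> 0 \<le> i \<and> i < int (length xs) then xs ! nat i else 0)\<rparr>"

definition has_output :: "state \<Rightarrow> int list \<Rightarrow> bool" where
  "has_output s xs \<longleftrightarrow> (\<forall>i < length xs. arrs s 1 (int i) = xs ! i)"

definition sign_vector :: "nat \<Rightarrow> nat \<Rightarrow> int list" where
  "sign_vector d k = map (\<lambda>j. if odd (k div 2 ^ j) then 1 else -1) [0..<d]"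

definition encode_constraint :: "nat \<Rightarrow> constraint \<Rightarrow> int list" where
  "encode_constraint d C =
     map int (fst C) @ map (\<lambda>k. if sign_vector d k \<in> snd C then 1 else 0) [0..<2 ^ d]"

text \<open>
  A constraint that occurs several times in the instance is written down once, together with its
  multiplicity.  So the input has length \<open>O(n\<^sup>d)\<close> for fixed \<open>d\<close>, no matter how many constraints there
  are.
\<close>

definition encode_input :: "nat \<Rightarrow> nat \<Rightarrow> constraint list \<Rightarrow> nat \<Rightarrow> int list" where
  "encode_input d n Cs t =
     [int n, int t, int (length (remdups Cs))] @
     concat (map (\<lambda>C. int (count_list Cs C) # encode_constraint d C) (remdups Cs))"

text \<open>
  A polynomial is output as a list of terms, each consisting of the variables of the monomial and
  the numerator and denominator of the coefficient.
\<close>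

datatype answer = Certified | Kernel "nat list" "(nat list \<times> int \<times> int) list"

definition encode_vars :: "nat list \<Rightarrow> int list" where
  "encode_vars xs = int (length xs) # map int xs"

fun encode_answer :: "answer \<Rightarrow> int list" where
  "encode_answer Certified = [0]"
| "encode_answer (Kernel V ts) =
     1 # encode_vars V @ int (length ts) # concat (map (\<lambda>(S, a, b). encode_vars S @ [a, b]) ts)"

definition poly_of_terms :: "(nat list \<times> int \<times> int) list \<Rightarrow> mlpoly" where
  "poly_of_terms ts = (\<Sum>(S, a, b) \<leftarrow> ts. Poly_Mapping.single (set S) (of_int a / of_int b))"

fun correct_answer :: "nat \<Rightarrow> nat \<Rightarrow> constraint list \<Rightarrow> nat \<Rightarrow> answer \<Rightarrow> bool" where
  "correct_answer d n Cs t Certified \<longleftrightarrow> real (OPT n Cs) \<ge> AVG n Cs + real t"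
| "correct_answer d n Cs t (Kernel V ts) \<longleftrightarrow>
     distinct V \<and> (\<forall>(S, a, b) \<in> set ts. distinct S \<and> b > 0) \<and>
     is_kernel d n Cs (kernel_const d * t ^ 2) (set V) (poly_of_terms ts)"

text \<open>For constant \<open>k\<close>, words have \<open>O(log (n + m + t))\<close> bits, where \<open>m\<close> is the number of constraints.\<close>

definition word_bound :: "nat \<Rightarrow> nat \<Rightarrow> constraint list \<Rightarrow> nat \<Rightarrow> int" where
  "word_bound k n Cs t = int ((n + length Cs + t + 2) ^ k)"

end

theory Submission
  imports Defs "HOL-Combinatorics.Permutations"
begin

text \<open>
  Let \<open>f\<close> count the satisfied constraints.  Call \<open>i\<close> and \<open>j\<close> exchangeable if swapping them never
  changes \<open>f\<close> on a bisection.  This is an equivalence relation, and if \<open>V\<close> is the complement of one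
  class, then \<open>f\<close> on bisections is a polynomial of degree \<open>d\<close> in the variables in \<open>V\<close>.  So a kernel
  exists as soon as some class is large.

  If every variable is non-exchangeable with at least \<open>v\<close> others, and some variable with exactly \<open>v\<close>,
  then \<open>f\<close> exceeds its mean by \<open>\<surd>v / (2 \<surd>d 12\<^sup>d)\<close> somewhere.  To see this, match the variables
  randomly and give the two ends of each edge opposite random signs; this is a random bisection.  For
  a fixed matching, \<open>f\<close> is a polynomial of degree \<open>d\<close> in independent signs, so by hypercontractivity
  its mean absolute deviation is at least \<open>3\<^bsup>-d\<^esup>\<close> times the root of its second moment, which in
  turn is bounded below by the influences.  An edge that joins non-exchangeable variables has
  positive influence with probability at least \<open>4\<^bsup>1-d\<^esup>\<close>, and there are at most \<open>v\<close> such edges, so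
  passing from the influences to their square root loses only a factor \<open>\<surd>v\<close>.

  Whether two variables are exchangeable is decided by evaluating \<open>f\<close> at \<open>n\<^bsup>2d-2\<^esup>\<close> bisections,
  those within \<open>d - 1\<close> swaps of a fixed one, since a polynomial of degree below \<open>d\<close> on a cube vanishes if it
  does so at the points of weight below \<open>d\<close>.  Each evaluation scans the \<open>O(n\<^sup>d)\<close> distinct
  constraints, which gives \<open>O(n\<^bsup>3d\<^esup>)\<close> in total.
\<close>

section \<open>Functions of low degree on the cube\<close>

text \<open>The bound \<open>v\<close> on the number of sensitive edges is there because of
  concavity: the mean of a square root is not bounded below by the root of the mean. If the
  influence sum \<open>Z\<close> of every matching is at most \<open>v\<close>, then
  \<open>sqrt Z >= Z / sqrt v\<close>, and \<open>Z\<close> can be averaged linearly. Integrality of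
  \<open>f\<close> turns every change of value into a change of at least 1, so probabilities of
  change bound influences.

  Largeness of a class is measured by half of the kernel bound \<open>K\<close>. Two exchange
  classes are disjoint, so for \<open>n > K\<close> at most one of them misses at most
  \<open>K / 2\<close> variables. If there is one, its complement is the kernel, and at least
  \<open>n / 2\<close> variables remain outside for completing partial assignments to bisections.
  Otherwise \<open>v > K / 2\<close>, and \<open>K >= 8 d 144^d t^2\<close> turns the gain into
  \<open>t\<close>. The base 12 is 3 times 4: a factor 3 per degree from hypercontractivity, and a
  factor 4 per degree from the fraction of a slice on which a nonzero polynomial is nonzero.

  The exponent \<open>3 d\<close> is exactly \<open>2 + (2 d - 2) + d\<close>: pairs of variables,
  test points per pair, and constraints per evaluation.\<close>

definition cube :: "nat \<Rightarrow> bool list set" where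
  "cube N = {ys. length ys = N}"

definition cube_mean :: "nat \<Rightarrow> (bool list \<Rightarrow> real) \<Rightarrow> real" where
  "cube_mean N g = (\<Sum>ys\<in>cube N. g ys) / 2 ^ N"

lemma cube_0 [simp]: "cube 0 = {[]}"
  by (auto simp: cube_def)

lemma cube_Suc: "cube (Suc N) = (#) True ` cube N \<union> (#) False ` cube N"
proof -
  have "ys \<in> (#) True ` cube N \<union> (#) False ` cube N" if "length ys = Suc N" for ys
    using that by (cases ys; cases "hd ys") (auto simp: cube_def image_iff)
  then show ?thesis by (auto simp: cube_def)
qed

lemma Cons_in_cube [simp]: "y # ys \<in> cube (Suc N) \<longleftrightarrow> ys \<in> cube N"
  by (simp add: cube_def)

lemma finite_cube [simp]: "finite (cube N)"
  by (induction N) (auto simp: cube_Suc)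

lemma card_cube: "card (cube N) = 2 ^ N"
  using card_lists_length_eq[of "UNIV :: bool set" N] by (simp add: cube_def)

lemma cube_mean_0 [simp]: "cube_mean 0 g = g []"
  by (simp add: cube_mean_def)

lemma cube_mean_Suc:
  "cube_mean (Suc N) g = (cube_mean N (\<lambda>ys. g (True # ys)) + cube_mean N (\<lambda>ys. g (False # ys))) / 2"
proof -
  have "(\<Sum>ys\<in>cube (Suc N). g ys) =
      (\<Sum>ys\<in>(#) True ` cube N. g ys) + (\<Sum>ys\<in>(#) False ` cube N. g ys)"
    unfolding cube_Suc by (rule sum.union_disjoint) auto
  then show ?thesis
    by (simp add: cube_mean_def sum.reindex add_divide_distrib)
qed

lemma cube_mean_cong: "(\<And>ys. ys \<in> cube N \<Longrightarrow> g ys = h ys) \<Longrightarrow> cube_mean N g = cube_mean N h"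
  by (simp add: cube_mean_def)

lemma cube_mean_mono: "(\<And>ys. ys \<in> cube N \<Longrightarrow> g ys \<le> h ys) \<Longrightarrow> cube_mean N g \<le> cube_mean N h"
  unfolding cube_mean_def by (intro divide_right_mono sum_mono) auto

lemma cube_mean_nonneg: "(\<And>ys. ys \<in> cube N \<Longrightarrow> 0 \<le> g ys) \<Longrightarrow> 0 \<le> cube_mean N g"
  unfolding cube_mean_def by (intro divide_nonneg_nonneg sum_nonneg) auto

lemma cube_mean_add: "cube_mean N (\<lambda>y. g y + h y) = cube_mean N g + cube_mean N h"
  by (simp add: cube_mean_def sum.distrib add_divide_distrib)

lemma cube_mean_diff: "cube_mean N (\<lambda>y. g y - h y) = cube_mean N g - cube_mean N h"
  by (simp add: cube_mean_def sum_subtractf diff_divide_distrib)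

lemma cube_mean_sum: "cube_mean N (\<lambda>y. \<Sum>a\<in>A. g a y) = (\<Sum>a\<in>A. cube_mean N (g a))"
  unfolding cube_mean_def sum_divide_distrib[symmetric] by (subst sum.swap) (rule refl)

lemma cube_mean_cmult: "cube_mean N (\<lambda>y. c * g y) = c * cube_mean N g"
  by (simp add: cube_mean_def sum_distrib_left)

lemma cube_mean_const: "cube_mean N (\<lambda>y. c) = c"
  by (simp add: cube_mean_def card_cube)

lemma cube_mean_Cauchy_Schwarz:
  "(cube_mean N (\<lambda>y. g y * h y))\<^sup>2 \<le> cube_mean N (\<lambda>y. (g y)\<^sup>2) * cube_mean N (\<lambda>y. (h y)\<^sup>2)"
  using Cauchy_Schwarz_ineq_sum[of g h "cube N"]
  by (simp add: cube_mean_def power_divide divide_right_mono flip: power2_eq_square)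

text \<open>The degree is strictly below the bound, so that bound 0 leaves only the zero function.\<close>

fun deglt :: "nat \<Rightarrow> nat \<Rightarrow> (bool list \<Rightarrow> real) \<Rightarrow> bool" where
  "deglt N 0 g \<longleftrightarrow> (\<forall>ys\<in>cube N. g ys = 0)"
| "deglt 0 (Suc d) g \<longleftrightarrow> True"
| "deglt (Suc N) (Suc d) g \<longleftrightarrow>
     deglt N (Suc d) (\<lambda>ys. g (True # ys) + g (False # ys)) \<and>
     deglt N d (\<lambda>ys. g (True # ys) - g (False # ys))"

section \<open>Calculus of the degree on the cube\<close>

lemma deglt_cong: "(\<And>ys. ys \<in> cube N \<Longrightarrow> g ys = h ys) \<Longrightarrow> deglt N d g \<longleftrightarrow> deglt N d h"
proof (induction N d g arbitrary: h rule: deglt.induct)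
  case (3 N d g)
  have "deglt N (Suc d) (\<lambda>ys. g (True # ys) + g (False # ys)) \<longleftrightarrow>
      deglt N (Suc d) (\<lambda>ys. h (True # ys) + h (False # ys))"
    using 3(3) by (intro 3(1)) auto
  moreover have "deglt N d (\<lambda>ys. g (True # ys) - g (False # ys)) \<longleftrightarrow>
      deglt N d (\<lambda>ys. h (True # ys) - h (False # ys))"
    using 3(3) by (intro 3(2)) auto
  ultimately show ?case by simp
qed auto

lemma deglt_Suc: "deglt N d g \<Longrightarrow> deglt N (Suc d) g"
proof (induction N d g rule: deglt.induct)
  case (1 N g)
  then show ?case
  proof (induction N arbitrary: g)
    case (Suc N)
    then have "deglt N (Suc 0) (\<lambda>ys. g (True # ys) + g (False # ys))"
      by (intro Suc.IH) auto
    then show ?case using Suc.prems by auto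
  qed auto
qed auto

lemma deglt_mono: "deglt N d g \<Longrightarrow> d \<le> e \<Longrightarrow> deglt N e g"
  by (induction e) (auto simp: le_Suc_eq intro: deglt_Suc)

lemma deglt_add: "deglt N d g \<Longrightarrow> deglt N d h \<Longrightarrow> deglt N d (\<lambda>y. g y + h y)"
proof (induction N d g arbitrary: h rule: deglt.induct)
  case (3 N d g)
  from 3(1)[of "\<lambda>ys. h (True # ys) + h (False # ys)"] 3(2)[of "\<lambda>ys. h (True # ys) - h (False # ys)"]
    3(3,4)
  show ?case by (simp add: algebra_simps)
qed auto

lemma deglt_cmult: "deglt N d g \<Longrightarrow> deglt N d (\<lambda>y. c * g y)"
  by (induction N d g rule: deglt.induct) (auto simp flip: distrib_left right_diff_distrib)

lemma deglt_diff: "deglt N d g \<Longrightarrow> deglt N d h \<Longrightarrow> deglt N d (\<lambda>y. g y - h y)"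
  using deglt_add[of N d g "\<lambda>y. -1 * h y"] deglt_cmult[of N d h "-1"] by simp

lemma deglt_zero: "deglt N d (\<lambda>y. 0)"
  by (rule deglt_mono[of N 0]) auto

lemma deglt_const: "deglt N (Suc d) (\<lambda>y. c)"
  by (induction N arbitrary: c) (auto simp: deglt_zero simp del: deglt.simps(1))

lemma deglt_sum: "(\<And>i. i \<in> A \<Longrightarrow> deglt N d (g i)) \<Longrightarrow> deglt N d (\<lambda>y. \<Sum>i\<in>A. g i y)"
  by (induction A rule: infinite_finite_induct) (auto intro: deglt_zero deglt_add)

text \<open>With strict bounds, degrees at most \<open>a - 1\<close> and \<open>b - 1\<close> add up
  to at most \<open>a + b - 2\<close>. In the first coordinate, the even part of the product is made
  of even times even and odd times odd parts, its odd part of the mixed products, so the induction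
  closes.\<close>

lemma deglt_mult:
  "deglt N a g \<Longrightarrow> deglt N b h \<Longrightarrow> deglt N (a + b - 1) (\<lambda>y. g y * h y)"
proof (induction N arbitrary: a b g h)
  case 0
  then show ?case by (cases a; cases b; cases "a + b - 1") auto
next
  case (Suc N)
  show ?case
  proof (cases "a = 0 \<or> b = 0")
    case True
    then have "\<forall>ys\<in>cube (Suc N). g ys * h ys = 0" using Suc.prems by auto
    then have "deglt (Suc N) 0 (\<lambda>y. g y * h y)" by simp
    then show ?thesis by (rule deglt_mono) simp
  next
    case False
    then obtain a' b' where ab: "a = Suc a'" "b = Suc b'"
      by (metis not0_implies_Suc)
    define sg dg sh dh where "sg = (\<lambda>ys. g (True # ys) + g (False # ys))"
      and "dg = (\<lambda>ys. g (True # ys) - g (False # ys))"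
      and "sh = (\<lambda>ys. h (True # ys) + h (False # ys))"
      and "dh = (\<lambda>ys. h (True # ys) - h (False # ys))"
    note defs = sg_def dg_def sh_def dh_def
    have d: "deglt N (Suc a') sg" "deglt N a' dg" "deglt N (Suc b') sh" "deglt N b' dh"
      using Suc.prems by (auto simp: ab defs)
    have 1: "deglt N (Suc (a' + b')) (\<lambda>y. sg y * sh y)"
      using Suc.IH[OF d(1,3)] by simp
    have 2: "deglt N (Suc (a' + b')) (\<lambda>y. dg y * dh y)"
      using Suc.IH[OF d(2,4)] by (rule deglt_mono) simp
    have 3: "deglt N (a' + b') (\<lambda>y. sg y * dh y)"
      using Suc.IH[OF d(1,4)] by simp
    have 4: "deglt N (a' + b') (\<lambda>y. dg y * sh y)"
      using Suc.IH[OF d(2,3)] by simp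
    have s: "(\<lambda>ys. g (True # ys) * h (True # ys) + g (False # ys) * h (False # ys)) =
        (\<lambda>y. (1 / 2) * (sg y * sh y + dg y * dh y))"
      by (rule ext) (simp add: defs field_simps)
    have t: "(\<lambda>ys. g (True # ys) * h (True # ys) - g (False # ys) * h (False # ys)) =
        (\<lambda>y. (1 / 2) * (sg y * dh y + dg y * sh y))"
      by (rule ext) (simp add: defs field_simps)
    show ?thesis
      unfolding ab using deglt_cmult[OF deglt_add[OF 1 2], of "1/2"] deglt_cmult[OF deglt_add[OF 3 4], of "1/2"]
      by (simp add: s t)
  qed
qed

lemma deglt_prod:
  assumes "finite A" "\<And>i. i \<in> A \<Longrightarrow> deglt N 2 (g i)"
  shows "deglt N (Suc (card A)) (\<lambda>y. \<Prod>i\<in>A. g i y)"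
  using assms
proof (induction A)
  case empty
  show ?case by (simp add: deglt_const)
next
  case (insert i A)
  have "deglt N (2 + Suc (card A) - 1) (\<lambda>y. g i y * (\<Prod>i\<in>A. g i y))"
    using insert by (intro deglt_mult) auto
  then show ?case using insert by simp
qed

text \<open>Every function of a single bit is affine in it, so its degree is at most 1, which is
  bound 2.\<close>

lemma deglt_coordinate: "k < N \<Longrightarrow> deglt N 2 (\<lambda>y. c (y ! k))"
proof (induction N arbitrary: k c)
  case (Suc N)
  show ?case
  proof (cases k)
    case 0
    then show ?thesis by (simp add: numeral_2_eq_2 deglt_const del: deglt.simps(1))
  next
    case (Suc k')
    then have "deglt N 2 (\<lambda>y. c (y ! k') + c (y ! k'))"
      using Suc.IH[of k' "\<lambda>b. c b + c b"] Suc.prems by simp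
    then show ?thesis using Suc by (simp add: numeral_2_eq_2 deglt_zero del: deglt.simps(1))
  qed
qed simp

text \<open>Setting the first coordinate to \<open>False\<close> keeps both the degree bound and the
  weight bound, so that restriction vanishes by induction. The difference in the first coordinate
  then loses one degree, and it vanishes in weight one less because prepending \<open>True\<close>
  uses up one unit of weight.\<close>

lemma deglt_eq_0:
  assumes "deglt N d g" "\<And>ys. ys \<in> cube N \<Longrightarrow> length (filter id ys) < d \<Longrightarrow> g ys = 0"
  shows "\<forall>ys\<in>cube N. g ys = 0"
  using assms
proof (induction N arbitrary: d g)
  case 0
  then show ?case by (cases d) auto
next
  case (Suc N)
  show ?case
  proof (cases d)
    case 0
    then show ?thesis using Suc.prems(1) by simp
  next
    case d: (Suc d')
    let ?s = "\<lambda>ys. g (True # ys) + g (False # ys)" and ?d = "\<lambda>ys. g (True # ys) - g (False # ys)"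
    have sd: "deglt N (Suc d') ?s" "deglt N d' ?d" using Suc.prems(1) by (auto simp: d)
    have "deglt N (Suc d') (\<lambda>ys. (1 / 2) * (?s ys - ?d ys))"
      using deglt_cmult[OF deglt_diff[OF sd(1) deglt_Suc[OF sd(2)]]] .
    then have F: "\<forall>ys\<in>cube N. g (False # ys) = 0"
      using Suc.prems(2) by (intro Suc.IH[of d]) (auto simp: d)
    have "\<forall>ys\<in>cube N. ?d ys = 0"
      using Suc.prems(2) F by (intro Suc.IH[of d'] sd) (auto simp: d)
    then show ?thesis using F by (auto simp: cube_Suc)
  qed
qed

section \<open>Hypercontractivity and the first absolute moment\<close>

text \<open>Bonami's inequality, by splitting \<open>2 g = s + y\<^sub>1 t\<close> for the first coordinate \<open>y\<^sub>1\<close>.\<close>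

lemma cube_mean_power4:
  "deglt N d g \<Longrightarrow> 9 * cube_mean N (\<lambda>y. (g y) ^ 4) \<le> 9 ^ d * (cube_mean N (\<lambda>y. (g y)\<^sup>2))\<^sup>2"
proof (induction N d g rule: deglt.induct)
  case (1 N g)
  then have "cube_mean N (\<lambda>y. (g y) ^ 4) = cube_mean N (\<lambda>y. 0)"
    by (intro cube_mean_cong) auto
  then show ?case by (simp add: cube_mean_const)
next
  case (2 d g)
  have "(9::real) * 1 \<le> 9 * 9 ^ d" by (intro mult_left_mono) auto
  then have "9 * (g []) ^ 4 \<le> 9 * 9 ^ d * (g []) ^ 4" by (intro mult_right_mono) auto
  then show ?case by (simp add: power2_eq_square power4_eq_xxxx mult.assoc)
next
  case (3 N d g)
  define s t where "s = (\<lambda>ys. g (True # ys) + g (False # ys))"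
    and "t = (\<lambda>ys. g (True # ys) - g (False # ys))"
  define A B where "A = cube_mean N (\<lambda>y. (s y)\<^sup>2)" and "B = cube_mean N (\<lambda>y. (t y)\<^sup>2)"
  define A4 B4 C where "A4 = cube_mean N (\<lambda>y. (s y) ^ 4)" and "B4 = cube_mean N (\<lambda>y. (t y) ^ 4)"
    and "C = cube_mean N (\<lambda>y. (s y)\<^sup>2 * (t y)\<^sup>2)"
  have IH: "9 * A4 \<le> 9 ^ Suc d * A\<^sup>2" "9 * B4 \<le> 9 ^ d * B\<^sup>2"
    using 3 by (auto simp: A_def B_def A4_def B4_def s_def t_def)
  have nn: "A \<ge> 0" "B \<ge> 0" "A4 \<ge> 0" "B4 \<ge> 0" "C \<ge> 0"
    by (auto simp: A_def B_def A4_def B4_def C_def intro!: cube_mean_nonneg)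
  have "C\<^sup>2 \<le> A4 * B4"
    using cube_mean_Cauchy_Schwarz[of N "\<lambda>y. (s y)\<^sup>2" "\<lambda>y. (t y)\<^sup>2"]
    by (simp add: A4_def B4_def C_def)
  \<comment> \<open>The bounds \<open>d + 1\<close> for \<open>s\<close> and \<open>d\<close> for
    \<open>t\<close> combine to \<open>9^d * sqrt 9 = 3 * 9^d\<close>. The binomial coefficient 6
    makes this \<open>18 * 9^d\<close>, exactly the cross term of
    \<open>9^(d+1) * (A + B)^2\<close>. This is where the base 9 comes from.\<close>
  then have "(9 * C)\<^sup>2 \<le> (9 * A4) * (9 * B4)" by (simp add: power2_eq_square)
  also have "\<dots> \<le> (9 ^ Suc d * A\<^sup>2) * (9 ^ d * B\<^sup>2)"
    using IH nn by (intro mult_mono[of "9 * A4" "9 ^ Suc d * A\<^sup>2"]) auto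
  also have "\<dots> = (3 * 9 ^ d * A * B)\<^sup>2"
    by (simp add: power2_eq_square algebra_simps)
  finally have C: "9 * C \<le> 3 * 9 ^ d * A * B"
    by (rule power2_le_imp_le) (use nn in auto)
  have e4: "16 * cube_mean (Suc N) (\<lambda>y. (g y) ^ 4) = A4 + 6 * C + B4"
  proof -
    have "16 * cube_mean (Suc N) (\<lambda>y. (g y) ^ 4) =
        cube_mean N (\<lambda>ys. 8 * (g (True # ys) ^ 4 + g (False # ys) ^ 4))"
      by (simp add: cube_mean_Suc cube_mean_add cube_mean_cmult)
    also have "\<dots> = cube_mean N (\<lambda>y. (s y) ^ 4 + 6 * ((s y)\<^sup>2 * (t y)\<^sup>2) + (t y) ^ 4)"
      by (rule cube_mean_cong) (simp add: s_def t_def, algebra)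
    finally show ?thesis by (simp add: cube_mean_add cube_mean_cmult A4_def B4_def C_def)
  qed
  have e2: "4 * cube_mean (Suc N) (\<lambda>y. (g y)\<^sup>2) = A + B"
  proof -
    have "4 * cube_mean (Suc N) (\<lambda>y. (g y)\<^sup>2) =
        cube_mean N (\<lambda>ys. 2 * (g (True # ys) ^ 2 + g (False # ys) ^ 2))"
      by (simp add: cube_mean_Suc cube_mean_add cube_mean_cmult)
    also have "\<dots> = cube_mean N (\<lambda>y. (s y)\<^sup>2 + (t y)\<^sup>2)"
      by (rule cube_mean_cong) (simp add: s_def t_def, algebra)
    finally show ?thesis by (simp add: cube_mean_add A_def B_def)
  qed
  have "16 * (9 * cube_mean (Suc N) (\<lambda>y. (g y) ^ 4)) = 9 * A4 + 6 * (9 * C) + 9 * B4"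
    using e4 by simp
  also have "\<dots> \<le> 9 ^ Suc d * A\<^sup>2 + 6 * (3 * 9 ^ d * A * B) + 9 ^ d * B\<^sup>2"
    using IH C by linarith
  also have "\<dots> \<le> 9 ^ Suc d * (A\<^sup>2 + 2 * (A * B) + B\<^sup>2)"
    by (simp add: algebra_simps)
  also have "\<dots> = 9 ^ Suc d * (A + B)\<^sup>2" by (simp add: power2_sum)
  also have "\<dots> = 16 * (9 ^ Suc d * (cube_mean (Suc N) (\<lambda>y. (g y)\<^sup>2))\<^sup>2)"
    unfolding e2[symmetric] by (simp add: power_mult_distrib)
  finally show ?case by simp
qed

text \<open>A small fourth moment forces a large first moment. Instead of interpolating between
  norms, a pointwise inequality is averaged: \<open>3 l^2 x^2 - x^4\<close> is at most
  \<open>2 l^3 |x|\<close>, with equality at \<open>|x| = l\<close>. For \<open>l = 3^d s\<close>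
  the fourth moment costs at most \<open>l^2 s^2\<close>, and \<open>2 l^2 s^2\<close> survives on
  the left.\<close>

lemma cube_mean_abs:
  assumes "deglt N (Suc d) g"
  shows "sqrt (cube_mean N (\<lambda>y. (g y)\<^sup>2)) \<le> 3 ^ d * cube_mean N (\<lambda>y. \<bar>g y\<bar>)"
proof -
  define s where "s = sqrt (cube_mean N (\<lambda>y. (g y)\<^sup>2))"
  have s2: "s\<^sup>2 = cube_mean N (\<lambda>y. (g y)\<^sup>2)"
    unfolding s_def by (intro real_sqrt_pow2 cube_mean_nonneg) auto
  have s0: "s \<ge> 0" unfolding s_def by (intro real_sqrt_ge_zero cube_mean_nonneg) auto
  define l where "l = 3 ^ d * s"
  define m where "m = cube_mean N (\<lambda>y. \<bar>g y\<bar>)"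
  show ?thesis
  proof (cases "s = 0")
    case True
    moreover have "m \<ge> 0" unfolding m_def by (rule cube_mean_nonneg) auto
    ultimately show ?thesis by (simp add: s_def[symmetric] m_def[symmetric])
  next
    case False
    with s0 have "s > 0" by simp
    then have l0: "l > 0" by (simp add: l_def)
    have pt: "3 * l\<^sup>2 * x\<^sup>2 - x ^ 4 \<le> 2 * l ^ 3 * \<bar>x\<bar>" for x :: real
    proof -
      define r where "r = \<bar>x\<bar>"
      have "0 \<le> r * (r - l)\<^sup>2 * (r + 2 * l)" using l0 by (auto simp: r_def)
      also have "\<dots> = r ^ 4 - 3 * l\<^sup>2 * r\<^sup>2 + 2 * l ^ 3 * r" by algebra
      finally show ?thesis by (simp add: r_def)
    qed
    have "3 * l\<^sup>2 * s\<^sup>2 - cube_mean N (\<lambda>y. (g y) ^ 4) =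
        cube_mean N (\<lambda>y. 3 * l\<^sup>2 * (g y)\<^sup>2 - (g y) ^ 4)"
      by (simp add: cube_mean_diff cube_mean_cmult s2)
    also have "\<dots> \<le> cube_mean N (\<lambda>y. 2 * l ^ 3 * \<bar>g y\<bar>)"
      by (rule cube_mean_mono) (rule pt)
    also have "\<dots> = 2 * l ^ 3 * m" by (simp add: cube_mean_cmult m_def)
    finally have "3 * l\<^sup>2 * s\<^sup>2 - 9 ^ d * (s\<^sup>2)\<^sup>2 \<le> 2 * l ^ 3 * m"
      using cube_mean_power4[OF assms] by (simp add: s2)
    moreover have "(9::real) ^ d = 3 ^ d * 3 ^ d" by (simp flip: power_mult_distrib)
    then have "9 ^ d * (s\<^sup>2)\<^sup>2 = l\<^sup>2 * s\<^sup>2" by (simp add: l_def power2_eq_square algebra_simps)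
    moreover have "l ^ 3 * m = l\<^sup>2 * (l * m)" by algebra
    ultimately have "l\<^sup>2 * s\<^sup>2 \<le> l\<^sup>2 * (l * m)" by linarith
    then have "s\<^sup>2 \<le> l * m" using l0 by simp
    then have "s * s \<le> s * (3 ^ d * m)" by (simp add: l_def power2_eq_square algebra_simps)
    then have "s \<le> 3 ^ d * m" using \<open>s > 0\<close> by simp
    then show ?thesis by (simp add: s_def m_def)
  qed
qed

section \<open>Influences\<close>

definition flip :: "bool list \<Rightarrow> nat \<Rightarrow> bool list" where
  "flip ys k = ys[k := \<not> ys ! k]"

lemma flip_in_cube [simp]: "flip ys k \<in> cube N \<longleftrightarrow> ys \<in> cube N"
  by (simp add: flip_def cube_def)

lemma flip_Cons [simp]: "flip (y # ys) 0 = (\<not> y) # ys" "flip (y # ys) (Suc k) = y # flip ys k"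
  by (simp_all add: flip_def)

text \<open>Flipping a coordinate negates the monomials that contain it, so a monomial with
  coefficient \<open>c\<close> and \<open>r\<close> variables contributes \<open>4 r c^2\<close>.
  The induction does this without Fourier coefficients. The subtraction is real: for bound 0 the
  factor is negative, but the second moment is 0.\<close>

lemma total_influence_le:
  "deglt N d g \<Longrightarrow>
   (\<Sum>k<N. cube_mean N (\<lambda>y. (g y - g (flip y k))\<^sup>2)) \<le> 4 * (real d - 1) * cube_mean N (\<lambda>y. (g y)\<^sup>2)"
proof (induction N d g rule: deglt.induct)
  case (1 N g)
  have "cube_mean N (\<lambda>y. (g y - g (flip y k))\<^sup>2) = cube_mean N (\<lambda>y. 0)" for k
    using 1 by (intro cube_mean_cong) auto
  moreover have "cube_mean N (\<lambda>y. (g y)\<^sup>2) = cube_mean N (\<lambda>y. 0)"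
    using 1 by (intro cube_mean_cong) auto
  ultimately show ?case by (simp add: cube_mean_const)
next
  case (2 d g)
  then show ?case by simp
next
  case (3 N d g)
  define s t where "s = (\<lambda>ys. g (True # ys) + g (False # ys))"
    and "t = (\<lambda>ys. g (True # ys) - g (False # ys))"
  define A B where "A = cube_mean N (\<lambda>y. (s y)\<^sup>2)" and "B = cube_mean N (\<lambda>y. (t y)\<^sup>2)"
  have IH: "(\<Sum>k<N. cube_mean N (\<lambda>y. (s y - s (flip y k))\<^sup>2)) \<le> 4 * (real (Suc d) - 1) * A"
    "(\<Sum>k<N. cube_mean N (\<lambda>y. (t y - t (flip y k))\<^sup>2)) \<le> 4 * (real d - 1) * B"
    using 3 by (auto simp: A_def B_def s_def t_def)
  have e2: "4 * cube_mean (Suc N) (\<lambda>y. (g y)\<^sup>2) = A + B"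
  proof -
    have "4 * cube_mean (Suc N) (\<lambda>y. (g y)\<^sup>2) =
        cube_mean N (\<lambda>ys. 2 * (g (True # ys) ^ 2 + g (False # ys) ^ 2))"
      by (simp add: cube_mean_Suc cube_mean_add cube_mean_cmult)
    also have "\<dots> = cube_mean N (\<lambda>y. (s y)\<^sup>2 + (t y)\<^sup>2)"
      by (rule cube_mean_cong) (simp add: s_def t_def, algebra)
    finally show ?thesis by (simp add: cube_mean_add A_def B_def)
  qed
  have k0: "cube_mean (Suc N) (\<lambda>y. (g y - g (flip y 0))\<^sup>2) = B"
    by (simp add: cube_mean_Suc B_def t_def power2_commute)
  have kS: "4 * cube_mean (Suc N) (\<lambda>y. (g y - g (flip y (Suc k)))\<^sup>2) =
      cube_mean N (\<lambda>y. (s y - s (flip y k))\<^sup>2) + cube_mean N (\<lambda>y. (t y - t (flip y k))\<^sup>2)" for k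
  proof -
    have "4 * cube_mean (Suc N) (\<lambda>y. (g y - g (flip y (Suc k)))\<^sup>2) =
      cube_mean N (\<lambda>y. 2 * ((g (True # y) - g (True # flip y k))\<^sup>2 + (g (False # y) - g (False # flip y k))\<^sup>2))"
      by (simp add: cube_mean_Suc cube_mean_add cube_mean_cmult)
    also have "\<dots> = cube_mean N (\<lambda>y. (s y - s (flip y k))\<^sup>2 + (t y - t (flip y k))\<^sup>2)"
      by (rule cube_mean_cong) (simp add: s_def t_def, algebra)
    finally show ?thesis by (simp add: cube_mean_add)
  qed
  have "4 * (\<Sum>k<Suc N. cube_mean (Suc N) (\<lambda>y. (g y - g (flip y k))\<^sup>2)) =
      4 * B + (\<Sum>k<N. 4 * cube_mean (Suc N) (\<lambda>y. (g y - g (flip y (Suc k)))\<^sup>2))"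
    unfolding sum.lessThan_Suc_shift k0 by (simp add: sum_distrib_left)
  also have "\<dots> = 4 * B + (\<Sum>k<N. cube_mean N (\<lambda>y. (s y - s (flip y k))\<^sup>2)) +
      (\<Sum>k<N. cube_mean N (\<lambda>y. (t y - t (flip y k))\<^sup>2))"
    unfolding kS by (simp add: sum.distrib)
  also have "\<dots> \<le> 4 * B + 4 * (real (Suc d) - 1) * A + 4 * (real d - 1) * B"
    using IH by linarith
  also have "\<dots> = 4 * real d * (A + B)" by (simp add: algebra_simps)
  also have "\<dots> = 4 * (4 * real d * cube_mean (Suc N) (\<lambda>y. (g y)\<^sup>2))"
    unfolding e2[symmetric] by simp
  finally show ?case by simp
qed

section \<open>Polynomials on the balanced slice\<close>

definition slice :: "nat set \<Rightarrow> (nat \<Rightarrow> int) set" where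
  "slice I = {x \<in> I \<rightarrow>\<^sub>E {-1, 1}. (\<Sum>i\<in>I. x i) = 0}"

lemma bisections_eq_slice: "bisections n = slice {..<n}"
  by (auto simp: bisections_def assignments_def slice_def)

lemma slice_values: "x \<in> slice I \<Longrightarrow> i \<in> I \<Longrightarrow> x i = 1 \<or> x i = -1"
  by (auto simp: slice_def PiE_iff)

lemma finite_slice [simp]: "finite I \<Longrightarrow> finite (slice I)"
  by (rule finite_subset[of _ "I \<rightarrow>\<^sub>E {-1, 1}"]) (auto simp: slice_def intro: finite_PiE)

lemma sum_signs:
  assumes "finite I" "\<And>i. i \<in> I \<Longrightarrow> x i = 1 \<or> x i = (-1 :: int)"
  shows "(\<Sum>i\<in>I. x i) = 2 * int (card {i \<in> I. x i = 1}) - int (card I)"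
proof -
  have "(\<Sum>i\<in>I. x i) = (\<Sum>i\<in>I. 2 * of_bool (x i = 1) - 1)"
    using assms(2) by (intro sum.cong) fastforce+
  also have "\<dots> = 2 * (\<Sum>i\<in>I. of_bool (x i = 1)) - int (card I)"
    by (simp add: sum_subtractf sum_distrib_left)
  also have "(\<Sum>i\<in>I. of_bool (x i = 1)) = int (card {i \<in> I. x i = 1})"
    using assms(1) by (simp add: Int_def)
  finally show ?thesis .
qed

lemma card_slice:
  assumes "finite I" "even (card I)"
  shows "card (slice I) = card I choose (card I div 2)"
proof -
  let ?h = "\<lambda>T. \<lambda>i\<in>I. if i \<in> T then 1 else (-1 :: int)"
  have "bij_betw ?h {T. T \<subseteq> I \<and> card T = card I div 2} (slice I)"
  proof (rule bij_betw_byWitness[where f' = "\<lambda>x. {i \<in> I. x i = 1}"])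
    show "\<forall>T\<in>{T. T \<subseteq> I \<and> card T = card I div 2}. {i \<in> I. ?h T i = 1} = T" by auto
    show "\<forall>x\<in>slice I. ?h {i \<in> I. x i = 1} = x"
      by (auto simp: slice_def PiE_iff extensional_def restrict_def fun_eq_iff)
    show "?h ` {T. T \<subseteq> I \<and> card T = card I div 2} \<subseteq> slice I"
    proof safe
      fix T assume T: "T \<subseteq> I" "card T = card I div 2"
      have "{i \<in> I. ?h T i = 1} = T" using T by auto
      moreover have "\<And>i. i \<in> I \<Longrightarrow> ?h T i = 1 \<or> ?h T i = -1" by auto
      ultimately have "(\<Sum>i\<in>I. ?h T i) = 2 * int (card T) - int (card I)"
        using sum_signs[OF assms(1), of "?h T"] by simp
      also have "2 * int (card T) = int (card I)" using T(2) assms(2) by presburger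
      finally have "(\<Sum>i\<in>I. ?h T i) = 0" by simp
      then show "?h T \<in> slice I" unfolding slice_def by simp
    qed
    show "(\<lambda>x. {i \<in> I. x i = 1}) ` slice I \<subseteq> {T. T \<subseteq> I \<and> card T = card I div 2}"
    proof safe
      fix x assume x: "x \<in> slice I"
      then have "2 * int (card {i \<in> I. x i = 1}) - int (card I) = 0"
        using sum_signs[OF assms(1), of x] slice_values[OF x] by (simp add: slice_def)
      then show "card {i \<in> I. x i = 1} = card I div 2" by linarith
    qed
  qed
  then have "card (slice I) = card {T. T \<subseteq> I \<and> card T = card I div 2}"
    by (simp add: bij_betw_same_card)
  then show ?thesis using assms(1) by (simp add: n_subsets)
qed

lemma even_card_of_slice: "finite I \<Longrightarrow> x \<in> slice I \<Longrightarrow> even (card I)"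
  using sum_signs[of I x] slice_values[of x I] by (simp add: slice_def) presburger

text \<open>Consecutive central binomial coefficients grow by a factor of at most 4. This is the
  loss for each degree in \<open>card_slice_nonzero\<close>.\<close>

lemma card_slice_remove:
  assumes "finite I" "even (card I)" "a \<in> I" "b \<in> I" "a \<noteq> b"
  shows "card (slice I) \<le> 4 * card (slice (I - {a, b}))"
proof -
  have c: "card I = Suc (Suc (card (I - {a, b})))"
  proof -
    have "card {a, b} \<le> card I" using assms by (intro card_mono) auto
    then show ?thesis using assms by (simp add: card_Diff_subset)
  qed
  then obtain m where m: "card (I - {a, b}) = 2 * m" using assms(2) by auto
  have "card (slice I) = 2 * m + 2 choose (m + 1)"
    using card_slice[OF assms(1,2)] c m by simp
  have "2 * m + 2 choose (m + 1) = (2 * m + 1 choose m) + (2 * m + 1 choose (m + 1))"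
    by simp
  also have "(2 * m + 1 choose m) = (2 * m + 1 choose (m + 1))"
    by (subst binomial_symmetric) auto
  also have "(2 * m + 1 choose (m + 1)) = (2 * m choose m) + (2 * m choose (m + 1))" by simp
  also have "(2 * m choose (m + 1)) \<le> (2 * m choose m)" by (rule binomial_maximum')
  finally have "2 * m + 2 choose (m + 1) \<le> 4 * (2 * m choose m)" by simp
  moreover have "card (slice (I - {a, b})) = 2 * m choose m"
    using card_slice[of "I - {a, b}"] assms(1) m by simp
  ultimately show ?thesis using \<open>card (slice I) = 2 * m + 2 choose (m + 1)\<close> by simp
qed

lemma slice_permute:
  assumes "\<pi> permutes I" "x \<in> slice I"
  shows "x \<circ> \<pi> \<in> slice I"
proof -
  have "(\<Sum>i\<in>I. x (\<pi> i)) = (\<Sum>i\<in>I. x i)" using sum.permute[OF assms(1), of x] by (simp add: o_def)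
  then show ?thesis
    using assms permutes_in_image[OF assms(1)] permutes_not_in[OF assms(1)]
    by (auto simp: slice_def PiE_iff extensional_def)
qed

abbreviation transposition :: "nat \<Rightarrow> nat \<Rightarrow> nat \<Rightarrow> nat" where
  "transposition \<equiv> Transposition.transpose"

lemma slice_transpose: "x \<in> slice I \<Longrightarrow> a \<in> I \<Longrightarrow> b \<in> I \<Longrightarrow> x \<circ> transposition a b \<in> slice I"
  by (intro slice_permute permutes_swap_id)

lemma slice_extend:
  assumes "finite I" "a \<in> I" "b \<in> I" "a \<noteq> b" "s = 1 \<or> s = -1" "x \<in> slice (I - {a, b})"
  shows "x(a := s, b := - s) \<in> slice I"
proof -
  have I: "I = insert a (insert b (I - {a, b}))" using assms by auto
  have "(\<Sum>i\<in>I. (x(a := s, b := - s)) i) = (\<Sum>i\<in>I - {a, b}. (x(a := s, b := - s)) i)"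
    by (subst I) (use assms in simp)
  also have "\<dots> = (\<Sum>i\<in>I - {a, b}. x i)" by (rule sum.cong) auto
  finally show ?thesis
    using assms by (auto simp: slice_def PiE_iff extensional_def)
qed

lemma slice_restrict:
  assumes "finite I" "a \<in> I" "b \<in> I" "x \<in> slice I" "x a \<noteq> x b"
  shows "restrict x (I - {a, b}) \<in> slice (I - {a, b})"
proof -
  have I: "I = insert a (insert b (I - {a, b}))" using assms by auto
  have "a \<noteq> b" using assms by auto
  have "(\<Sum>i\<in>I. x i) = x a + x b + (\<Sum>i\<in>I - {a, b}. x i)"
    by (subst I) (use assms \<open>a \<noteq> b\<close> in simp)
  moreover have "x a + x b = 0"
    using slice_values[OF assms(4,2)] slice_values[OF assms(4,3)] assms(5) by auto
  ultimately show ?thesis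
    using assms by (auto simp: slice_def PiE_iff)
qed

lemma slice_update_restrict:
  assumes "x \<in> slice I"
  shows "(restrict x (I - {a, b}))(a := x a, b := x b) = x"
  using assms by (auto simp: slice_def PiE_iff extensional_def fun_eq_iff)

text \<open>Equality holds for all integer arguments, not only on one slice. So \<open>F\<close> may
  be evaluated at points with two coordinates overwritten, at points that are no bisections, and
  along parametrisations by a cube. The bound is strict, as in \<open>deglt\<close>.\<close>

definition polylt :: "nat \<Rightarrow> ((nat \<Rightarrow> int) \<Rightarrow> real) \<Rightarrow> bool" where
  "polylt d F \<longleftrightarrow>
     (\<exists>p. (\<forall>S\<in>Poly_Mapping.keys p. finite S \<and> card S < d) \<and> F = mleval p)"

lemma polylt_zero: "polylt d (\<lambda>x. 0)"
  unfolding polylt_def by (intro exI[of _ 0]) auto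

lemma polylt_add:
  assumes "polylt d F" "polylt d G"
  shows "polylt d (\<lambda>x. F x + G x)"
proof -
  obtain p q where pq: "\<forall>S\<in>Poly_Mapping.keys p. finite S \<and> card S < d" "F = mleval p"
    "\<forall>S\<in>Poly_Mapping.keys q. finite S \<and> card S < d" "G = mleval q"
    using assms by (auto simp: polylt_def)
  show ?thesis
    unfolding polylt_def
    using pq Poly_Mapping.keys_add[of p q] by (intro exI[of _ "p + q"]) (auto simp: mleval_add)
qed

lemma polylt_sum: "(\<And>i. i \<in> A \<Longrightarrow> polylt d (F i)) \<Longrightarrow> polylt d (\<lambda>x. \<Sum>i\<in>A. F i x)"
  by (induction A rule: infinite_finite_induct) (auto intro: polylt_zero polylt_add)

lemma polylt_monomial:
  assumes "finite S" "card S < d"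
  shows "polylt d (\<lambda>x. c * (\<Prod>i\<in>S. of_int (x i)))"
  unfolding polylt_def
  using assms by (intro exI[of _ "Poly_Mapping.single S c"]) (auto simp: mleval_single)

text \<open>A discrete derivative in the direction of a swap. Monomials containing both or neither
  of \<open>a\<close> and \<open>b\<close> cancel, and the others lose the one they contain, which
  lowers the degree by one.\<close>

lemma polylt_exchange:
  assumes "polylt (Suc d) F" "a \<noteq> b"
  shows "polylt d (\<lambda>x. F (x(a := 1, b := -1)) - F (x(a := -1, b := 1)))"
proof -
  obtain p where p: "\<And>S. S \<in> Poly_Mapping.keys p \<Longrightarrow> finite S \<and> card S \<le> d" "F = mleval p"
    using assms by (auto simp: polylt_def less_Suc_eq_le)
  let ?m = "\<lambda>S x. (\<Prod>i\<in>S. real_of_int (x i))"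
  have mono: "polylt d (\<lambda>x. c * (?m S (x(a := 1, b := -1)) - ?m S (x(a := -1, b := 1))))"
    if S: "finite S" "card S \<le> d" for S c
  proof -
    have upd: "?m (S - {a, b}) (x(a := s, b := t)) = ?m (S - {a, b}) x" for x s t
      by (rule prod.cong) auto
    have card: "card (S - {e}) < d" if "e \<in> S" for e
      using that S card_Diff1_less[of S e] by simp
    consider "a \<in> S" "b \<in> S" | "a \<in> S" "b \<notin> S" | "a \<notin> S" "b \<in> S" | "a \<notin> S" "b \<notin> S" by blast
    then show ?thesis
    proof cases
      case 1
      have "?m S (x(a := s, b := t)) = s * t * ?m (S - {a, b}) x" for x s t
      proof -
        have "S = insert a (insert b (S - {a, b}))" using 1 by auto
        then have "?m S (x(a := s, b := t)) =
            ?m (insert a (insert b (S - {a, b}))) (x(a := s, b := t))" by simp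
        then show ?thesis using S assms(2) by (simp add: upd)
      qed
      then show ?thesis by (simp add: polylt_zero)
    next
      case 2
      have "?m S (x(a := s, b := t)) = s * ?m (S - {a}) x" for x s t
      proof -
        have "S - {a} = S - {a, b}" using 2 by auto
        then show ?thesis using S assms(2) upd[of x s t] prod.remove[of S a "\<lambda>i. real_of_int ((x(a := s, b := t)) i)"] 2
          by simp
      qed
      then have "(\<lambda>x. c * (?m S (x(a := 1, b := -1)) - ?m S (x(a := -1, b := 1)))) =
          (\<lambda>x. (2 * c) * ?m (S - {a}) x)" by (simp add: fun_eq_iff)
      then show ?thesis using polylt_monomial[of "S - {a}" d "2 * c"] card[OF 2(1)] S by simp
    next
      case 3
      have "?m S (x(a := s, b := t)) = t * ?m (S - {b}) x" for x s t
      proof -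
        have "S - {b} = S - {a, b}" using 3 by auto
        then show ?thesis using S assms(2) upd[of x s t] prod.remove[of S b "\<lambda>i. real_of_int ((x(a := s, b := t)) i)"] 3
          by simp
      qed
      then have "(\<lambda>x. c * (?m S (x(a := 1, b := -1)) - ?m S (x(a := -1, b := 1)))) =
          (\<lambda>x. (- 2 * c) * ?m (S - {b}) x)" by (simp add: fun_eq_iff)
      then show ?thesis using polylt_monomial[of "S - {b}" d "- 2 * c"] card[OF 3(2)] S by simp
    next
      case 4
      then have "S - {a, b} = S" by auto
      then show ?thesis using upd by (simp add: polylt_zero)
    qed
  qed
  have "(\<lambda>x. F (x(a := 1, b := -1)) - F (x(a := -1, b := 1))) =
      (\<lambda>x. \<Sum>S\<in>Poly_Mapping.keys p. Poly_Mapping.lookup p S *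
        (?m S (x(a := 1, b := -1)) - ?m S (x(a := -1, b := 1))))"
    by (simp add: p(2) mleval_def right_diff_distrib sum_subtractf)
  then show ?thesis using mono p(1) by (auto intro!: polylt_sum)
qed

lemma slice_transitive:
  assumes "finite I" "x \<in> slice I" "y \<in> slice I"
  shows "\<exists>\<sigma>. \<sigma> permutes I \<and> y = x \<circ> \<sigma>"
proof -
  have c1: "2 * card {i \<in> I. z i = 1} = card I" if "z \<in> slice I" for z
    using sum_signs[OF assms(1), of z] slice_values[OF that] that by (simp add: slice_def)
  have c2: "card {i \<in> I. z i = -1} = card I - card {i \<in> I. z i = 1}" if "z \<in> slice I" for z
  proof -
    have "{i \<in> I. z i = -1} = I - {i \<in> I. z i = 1}" using slice_values[OF that] by fastforce
    then show ?thesis using assms(1) by (simp add: card_Diff_subset)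
  qed
  have cnt: "count (image_mset z (mset_set I)) a = card {i \<in> I. z i = a}" for z :: "nat \<Rightarrow> int" and a
    using assms(1)
  proof (induction I rule: finite_induct)
    case (insert i I)
    have "{k \<in> insert i I. z k = a} = (if z i = a then insert i {k \<in> I. z k = a} else {k \<in> I. z k = a})"
      by auto
    then show ?case using insert by simp
  qed simp
  have "card {i \<in> I. y i = a} = card {i \<in> I. x i = a}" for a
  proof -
    consider "a = 1" | "a = -1" | "a \<noteq> 1" "a \<noteq> -1" by blast
    then show ?thesis
    proof cases
      case 3
      then have "{i \<in> I. y i = a} = {}" "{i \<in> I. x i = a} = {}"
        using slice_values assms by fastforce+
      then show ?thesis by (simp only:)
    qed (use c1[OF assms(2)] c1[OF assms(3)] c2[OF assms(2)] c2[OF assms(3)] in auto)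
  qed
  then have "image_mset y (mset_set I) = image_mset x (mset_set I)"
    by (intro multiset_eqI) (simp add: cnt)
  from image_mset_eq_implies_permutes[OF assms(1) this]
  obtain \<sigma> where \<sigma>: "\<sigma> permutes I" "\<forall>i\<in>I. y i = x (\<sigma> i)" by metis
  have "y = x \<circ> \<sigma>"
  proof
    fix i show "y i = (x \<circ> \<sigma>) i"
    proof (cases "i \<in> I")
      case False
      then show ?thesis using assms permutes_not_in[OF \<sigma>(1)]
        by (auto simp: slice_def PiE_iff extensional_def)
    qed (use \<sigma> in simp)
  qed
  then show ?thesis using \<sigma>(1) by blast
qed

text \<open>Transpositions generate the permutations, which act transitively on the slice. The lemma
  is used backwards: a function with two different values on the slice is changed by some
  transposition.\<close>

lemma slice_invariant_imp_const:
  assumes "finite I" "\<And>x a b. x \<in> slice I \<Longrightarrow> a \<in> I \<Longrightarrow> b \<in> I \<Longrightarrow> F (x \<circ> transposition a b) = F x"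
    and "x \<in> slice I" "y \<in> slice I"
  shows "F x = F y"
proof -
  obtain \<sigma> where \<sigma>: "\<sigma> permutes I" "y = x \<circ> \<sigma>" using slice_transitive assms by blast
  have "\<forall>x\<in>slice I. F (x \<circ> \<sigma>) = F x"
    using \<sigma>(1) assms(1)
  proof (induction rule: permutes_induct)
    case (swap a b p)
    show ?case
    proof
      fix x assume x: "x \<in> slice I"
      have "F ((x \<circ> transposition a b) \<circ> p) = F (x \<circ> transposition a b)"
        using swap x slice_transpose by blast
      then show "F (x \<circ> (transposition a b \<circ> p)) = F x"
        using assms(2)[OF x] swap by (simp add: comp_assoc)
    qed
  qed simp
  then show ?thesis using \<sigma>(2) assms(3) by simp
qed

lemma comp_transpose_eq_upd: "x \<circ> transposition a b = x(a := x b, b := x a)"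
  by (auto simp: Transposition.transpose_def fun_eq_iff)

lemma exchange_nonzero:
  fixes F :: "(nat \<Rightarrow> int) \<Rightarrow> real"
  assumes "finite I" "a \<in> I" "b \<in> I" "z \<in> slice I" "F (z \<circ> transposition a b) \<noteq> F z"
  shows "a \<noteq> b \<and> (\<exists>x\<in>slice (I - {a, b}). F (x(a := 1, b := -1)) - F (x(a := -1, b := 1)) \<noteq> 0)"
proof -
  have ne: "z a \<noteq> z b"
  proof
    assume "z a = z b"
    then have "z \<circ> transposition a b = z" by (auto simp: Transposition.transpose_def fun_eq_iff)
    then show False using assms(5) by simp
  qed
  let ?r = "restrict z (I - {a, b})"
  have "z = ?r(a := z a, b := z b)" by (rule slice_update_restrict[OF assms(4), symmetric])
  moreover have "z \<circ> transposition a b = ?r(a := z b, b := z a)"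
    using assms(4) ne
    by (intro ext) (auto simp: Transposition.transpose_def slice_def PiE_iff extensional_def)
  ultimately have "F (?r(a := z a, b := z b)) \<noteq> F (?r(a := z b, b := z a))"
    using assms(5) by metis
  moreover have "z a = 1 \<and> z b = -1 \<or> z a = -1 \<and> z b = 1"
    using ne slice_values[OF assms(4,2)] slice_values[OF assms(4,3)] by auto
  ultimately have "F (?r(a := 1, b := -1)) - F (?r(a := -1, b := 1)) \<noteq> 0" by (elim disjE conjE) simp_all
  moreover have "?r \<in> slice (I - {a, b})" using slice_restrict[OF assms(1-4) ne] .
  ultimately show ?thesis using ne by blast
qed

text \<open>A Schwartz-Zippel bound for the balanced slice. If \<open>F\<close> has both zeros and
  nonzeros, some exchange difference \<open>?G\<close> is not identically zero on the slice without
  \<open>a\<close> and \<open>b\<close>. Its degree is one less, so induction applies, and returning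
  to the full slice costs a factor of at most 4.\<close>

lemma card_slice_nonzero:
  assumes "polylt (Suc k) F" "finite I" "x \<in> slice I" "F x \<noteq> 0"
  shows "card (slice I) \<le> 4 ^ k * card {x \<in> slice I. F x \<noteq> 0}"
  using assms
proof (induction k arbitrary: F I x)
  case 0
  then obtain p where p: "\<And>S. S \<in> Poly_Mapping.keys p \<Longrightarrow> S = {}" "F = mleval p"
    by (auto simp: polylt_def less_Suc0) (metis card_0_eq)
  have "Poly_Mapping.keys p \<subseteq> {{}}" using p(1) by auto
  then have "F y = Poly_Mapping.lookup p {}" for y
    unfolding p(2) by (subst mleval_superset[of "{{}}"]) auto
  then have "{x \<in> slice I. F x \<noteq> 0} = slice I" using 0(4) by auto
  then show ?case by simp
next
  case (Suc k)
  show ?case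
  proof (cases "\<forall>y\<in>slice I. F y \<noteq> 0")
    case True
    then have "{x \<in> slice I. F x \<noteq> 0} = slice I" by auto
    then show ?thesis by simp
  next
    case False
    then obtain y where y: "y \<in> slice I" "F y = 0" by blast
    obtain z a b where z: "z \<in> slice I" "a \<in> I" "b \<in> I" "F (z \<circ> transposition a b) \<noteq> F z"
      using slice_invariant_imp_const[OF Suc.prems(2), of F x y] y Suc.prems(3,4) by metis
    let ?G = "\<lambda>x. F (x(a := 1, b := -1)) - F (x(a := -1, b := 1))"
    let ?I = "I - {a, b}"
    obtain z' where ab: "a \<noteq> b" and z': "z' \<in> slice ?I" "?G z' \<noteq> 0"
      using exchange_nonzero[OF Suc.prems(2) z(2,3,1,4)] by blast
    have "polylt (Suc k) ?G" using polylt_exchange Suc.prems(1) ab by blast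
    have IH: "card (slice ?I) \<le> 4 ^ k * card {x \<in> slice ?I. ?G x \<noteq> 0}"
      by (rule Suc.IH[OF \<open>polylt (Suc k) ?G\<close> _ z']) (use Suc.prems(2) in simp)
    \<comment> \<open>Where the difference is nonzero, at least one of the two extensions is a
      nonzero of \<open>F\<close>. Restriction recovers the original point, so the map is
      injective.\<close>
    let ?e = "\<lambda>x. if F (x(a := 1, b := -1)) \<noteq> 0 then x(a := 1, b := -1) else x(a := -1, b := 1 :: int)"
    have "card {x \<in> slice ?I. ?G x \<noteq> 0} \<le> card {x \<in> slice I. F x \<noteq> 0}"
    proof (rule card_inj_on_le[of ?e])
      show "inj_on ?e {x \<in> slice ?I. ?G x \<noteq> 0}"
      proof (rule inj_on_inverseI[of _ "\<lambda>x. restrict x ?I"])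
        fix x assume "x \<in> {x \<in> slice ?I. ?G x \<noteq> 0}"
        then have "x \<in> extensional ?I" by (auto simp: slice_def PiE_iff)
        then show "restrict (?e x) ?I = x" by (auto simp: fun_eq_iff extensional_def)
      qed
      show "?e ` {x \<in> slice ?I. ?G x \<noteq> 0} \<subseteq> {x \<in> slice I. F x \<noteq> 0}"
        using slice_extend[OF Suc.prems(2) z(2,3) ab, of 1]
          slice_extend[OF Suc.prems(2) z(2,3) ab, of "-1"] by auto
      show "finite {x \<in> slice I. F x \<noteq> 0}" using Suc.prems(2) by simp
    qed
    then have "card (slice ?I) \<le> 4 ^ k * card {x \<in> slice I. F x \<noteq> 0}"
      using IH by (meson le_trans mult_le_mono2)
    moreover have "card (slice I) \<le> 4 * card (slice ?I)"
      using card_slice_remove even_card_of_slice Suc.prems(2,3) z(2,3) ab by metis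
    ultimately show ?thesis by simp
  qed
qed

section \<open>Exchangeability as an equivalence relation\<close>

definition exchangeable :: "((nat \<Rightarrow> int) \<Rightarrow> real) \<Rightarrow> nat set \<Rightarrow> nat \<Rightarrow> nat \<Rightarrow> bool" where
  "exchangeable f I i j \<longleftrightarrow> (\<forall>x\<in>slice I. f (x \<circ> transposition i j) = f x)"

lemma exchangeable_refl: "exchangeable f I i i"
  by (simp add: exchangeable_def)

lemma exchangeable_sym: "exchangeable f I i j \<longleftrightarrow> exchangeable f I j i"
  by (simp add: exchangeable_def transpose_commute)

text \<open>The transposition of \<open>i\<close> and \<open>k\<close> is the conjugate of that of
  \<open>j\<close> and \<open>k\<close> by that of \<open>i\<close> and \<open>j\<close>, hence a
  product of three transpositions that each preserve \<open>f\<close> on the slice.\<close>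

lemma exchangeable_trans:
  assumes "exchangeable f I i j" "exchangeable f I j k" "i \<in> I" "j \<in> I" "k \<in> I"
  shows "exchangeable f I i k"
proof (cases "i = k \<or> j = k")
  case True
  then show ?thesis using assms exchangeable_refl by auto
next
  case False
  show ?thesis
    unfolding exchangeable_def
  proof
    fix x assume x: "x \<in> slice I"
    have "transposition i j \<circ> transposition j k \<circ> transposition i j = transposition i k"
      using False by (intro transpose_comp_triple) auto
    then have "f (x \<circ> transposition i k) = f (((x \<circ> transposition i j) \<circ> transposition j k) \<circ> transposition i j)"
      by (simp add: comp_assoc)
    also have "\<dots> = f x"
      using assms x slice_transpose by (simp add: exchangeable_def)
    finally show "f (x \<circ> transposition i k) = f x" .
  qed
qed

text \<open>The nonvanishing bound is applied to the exchange difference, whose degree is at most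
  \<open>d\<close> because that of \<open>f\<close> is at most \<open>d + 1\<close>. From here on
  \<open>d\<close> is one less than the arity.\<close>

lemma card_exchange_pairs:
  assumes "polylt (Suc (Suc d)) f" "finite I" "i \<in> I" "j \<in> I" "\<not> exchangeable f I i j"
  shows "card (slice (I - {i, j})) \<le>
    4 ^ d * card {x \<in> slice I. x i = 1 \<and> x j = -1 \<and> f x \<noteq> f (x \<circ> transposition i j)}"
proof -
  let ?G = "\<lambda>x. f (x(i := 1, j := -1)) - f (x(i := -1, j := 1))"
  let ?I = "I - {i, j}"
  obtain z where z: "i \<noteq> j" "z \<in> slice ?I" "?G z \<noteq> 0"
    using assms exchange_nonzero[OF assms(2-4), of _ f] by (auto simp: exchangeable_def)
  have "card (slice ?I) \<le> 4 ^ d * card {x \<in> slice ?I. ?G x \<noteq> 0}"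
    by (rule card_slice_nonzero[OF polylt_exchange[OF assms(1) z(1)] _ z(2,3)]) (use assms(2) in simp)
  moreover have "card {x \<in> slice ?I. ?G x \<noteq> 0} \<le>
      card {x \<in> slice I. x i = 1 \<and> x j = -1 \<and> f x \<noteq> f (x \<circ> transposition i j)}"
  proof (rule card_inj_on_le[of "\<lambda>x. x(i := 1, j := -1)"])
    show "inj_on (\<lambda>x. x(i := 1, j := -1)) {x \<in> slice ?I. ?G x \<noteq> 0}"
    proof (rule inj_on_inverseI[of _ "\<lambda>x. restrict x ?I"])
      fix x assume "x \<in> {x \<in> slice ?I. ?G x \<noteq> 0}"
      then have "x \<in> extensional ?I" by (auto simp: slice_def PiE_iff)
      then show "restrict (x(i := 1, j := -1)) ?I = x" by (auto simp: fun_eq_iff extensional_def)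
    qed
    have "(x(i := 1, j := -1)) \<circ> transposition i j = x(i := -1, j := 1)" for x :: "nat \<Rightarrow> int"
      using z(1) by (auto simp: comp_transpose_eq_upd fun_eq_iff)
    then show "(\<lambda>x. x(i := 1, j := -1)) ` {x \<in> slice ?I. ?G x \<noteq> 0} \<subseteq>
        {x \<in> slice I. x i = 1 \<and> x j = -1 \<and> f x \<noteq> f (x \<circ> transposition i j)}"
      using slice_extend[OF assms(2-4) z(1), of 1] z(1) by auto
    show "finite {x \<in> slice I. x i = 1 \<and> x j = -1 \<and> f x \<noteq> f (x \<circ> transposition i j)}"
      using assms(2) by simp
  qed
  ultimately show ?thesis by (meson le_trans mult_le_mono2)
qed

section \<open>Anti-concentration on the balanced slice\<close>

text \<open>In a transitive action a uniformly random permutation moves any fixed element to a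
  uniformly random one. The sum over permutations does not depend on the base point, so it can be
  averaged over \<open>X\<close> and the two sums interchanged. The action is from the right, as
  permutations act on assignments by precomposition.\<close>

lemma sum_permutes_transitive:
  fixes \<phi> :: "'x \<Rightarrow> real"
  assumes "finite I" "finite X" "x0 \<in> X"
    and act: "\<And>\<pi> x. \<pi> permutes I \<Longrightarrow> x \<in> X \<Longrightarrow> act \<pi> x \<in> X"
    and comp: "\<And>\<pi> \<sigma> x. \<pi> permutes I \<Longrightarrow> \<sigma> permutes I \<Longrightarrow> x \<in> X \<Longrightarrow> act \<pi> (act \<sigma> x) = act (\<sigma> \<circ> \<pi>) x"
    and id: "\<And>x. x \<in> X \<Longrightarrow> act id x = x"
    and trans: "\<And>x. x \<in> X \<Longrightarrow> \<exists>\<sigma>. \<sigma> permutes I \<and> x = act \<sigma> x0"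
  shows "real (card X) * (\<Sum>\<pi> | \<pi> permutes I. \<phi> (act \<pi> x0)) = fact (card I) * (\<Sum>x\<in>X. \<phi> x)"
proof -
  let ?P = "{\<pi>. \<pi> permutes I}"
  have const: "(\<Sum>\<pi>\<in>?P. \<phi> (act \<pi> x)) = (\<Sum>\<pi>\<in>?P. \<phi> (act \<pi> x0))" if x: "x \<in> X" for x
  proof -
    obtain \<sigma> where \<sigma>: "\<sigma> permutes I" "x = act \<sigma> x0" using trans[OF x] by blast
    have "(\<Sum>\<pi>\<in>?P. \<phi> (act \<pi> x)) = (\<Sum>\<pi>\<in>?P. \<phi> (act (\<sigma> \<circ> \<pi>) x0))"
      by (rule sum.cong) (use \<sigma> comp assms(3) in auto)
    also have "\<dots> = (\<Sum>\<pi>\<in>?P. \<phi> (act \<pi> x0))"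
      using setum_permutations_compose_left[OF \<sigma>(1), of "\<lambda>\<pi>. \<phi> (act \<pi> x0)"] by simp
    finally show ?thesis .
  qed
  have reindex: "(\<Sum>x\<in>X. \<phi> (act \<pi> x)) = (\<Sum>x\<in>X. \<phi> x)" if \<pi>: "\<pi> permutes I" for \<pi>
  proof (rule sum.reindex_bij_betw)
    show "bij_betw (act \<pi>) X X"
    proof (rule bij_betw_byWitness[where f' = "act (inv \<pi>)"])
      show "\<forall>x\<in>X. act (inv \<pi>) (act \<pi> x) = x"
        using comp[OF permutes_inv[OF \<pi>] \<pi>] id by (simp add: permutes_inv_o[OF \<pi>])
      show "\<forall>x\<in>X. act \<pi> (act (inv \<pi>) x) = x"
        using comp[OF \<pi> permutes_inv[OF \<pi>]] id by (simp add: permutes_inv_o[OF \<pi>])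
    qed (use act \<pi> permutes_inv in blast)+
  qed
  have "real (card X) * (\<Sum>\<pi>\<in>?P. \<phi> (act \<pi> x0)) = (\<Sum>x\<in>X. \<Sum>\<pi>\<in>?P. \<phi> (act \<pi> x))"
    by (simp add: const)
  also have "\<dots> = (\<Sum>\<pi>\<in>?P. \<Sum>x\<in>X. \<phi> (act \<pi> x))" by (rule sum.swap)
  also have "\<dots> = (\<Sum>\<pi>\<in>?P. \<Sum>x\<in>X. \<phi> x)" by (rule sum.cong) (simp_all add: reindex)
  also have "\<dots> = fact (card I) * (\<Sum>x\<in>X. \<phi> x)"
    using card_permutations[OF refl assms(1)] by simp
  finally show ?thesis .
qed

lemma sum_permutes_slice:
  fixes \<phi> :: "(nat \<Rightarrow> int) \<Rightarrow> real"
  assumes "finite I" "x \<in> slice I"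
  shows "real (card (slice I)) * (\<Sum>\<pi> | \<pi> permutes I. \<phi> (x \<circ> \<pi>)) = fact (card I) * (\<Sum>x\<in>slice I. \<phi> x)"
  using assms
  by (intro sum_permutes_transitive[where act = "\<lambda>\<pi> x. x \<circ> \<pi>"])
    (auto intro: slice_permute slice_transitive simp: comp_assoc)

text \<open>What a single edge of a random matching sees: a bisection together with the two ends of
  the edge. Ordering the ends by their sign makes the permutations act transitively.\<close>

definition split_pairs :: "nat set \<Rightarrow> ((nat \<Rightarrow> int) \<times> nat \<times> nat) set" where
  "split_pairs I = {(x, p, q). x \<in> slice I \<and> p \<in> I \<and> q \<in> I \<and> x p = 1 \<and> x q = -1}"

lemma finite_split_pairs: "finite I \<Longrightarrow> finite (split_pairs I)"
  by (rule finite_subset[of _ "slice I \<times> I \<times> I"]) (auto simp: split_pairs_def)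

lemma split_pairs_transitive:
  assumes "finite I" "(x, p, q) \<in> split_pairs I" "(y, p', q') \<in> split_pairs I"
  shows "\<exists>\<sigma>. \<sigma> permutes I \<and> y = x \<circ> \<sigma> \<and> p' = inv \<sigma> p \<and> q' = inv \<sigma> q"
proof -
  have x: "x \<in> slice I" "p \<in> I" "q \<in> I" "x p = 1" "x q = -1"
    and y: "y \<in> slice I" "p' \<in> I" "q' \<in> I" "y p' = 1" "y q' = -1"
    using assms by (auto simp: split_pairs_def)
  obtain \<sigma> where \<sigma>: "\<sigma> permutes I" "y = x \<circ> \<sigma>" using slice_transitive assms(1) x y by blast
  define p1 q1 where "p1 = inv \<sigma> p" and "q1 = inv \<sigma> q"
  have s: "\<sigma> p1 = p" "\<sigma> q1 = q" using permutes_inverses[OF \<sigma>(1)] by (auto simp: p1_def q1_def)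
  have i: "p1 \<in> I" "q1 \<in> I" using permutes_in_image[OF \<sigma>(1)] s x by metis+
  have v: "y p1 = 1" "y q1 = -1" using s \<sigma>(2) x by auto
  \<comment> \<open>The first permutation yields the right assignment but marks the wrong positions.
    The correction \<open>\<tau>\<close> moves marks only among positions of equal sign, so it does
    not change \<open>y\<close>.\<close>
  define \<tau> where "\<tau> = transposition p1 p' \<circ> transposition q1 q'"
  have \<tau>: "\<tau> permutes I" unfolding \<tau>_def using i y by (intro permutes_compose permutes_swap_id)
  have ne: "p' \<noteq> q1" "p' \<noteq> q'" "p1 \<noteq> q1" "p1 \<noteq> q'" using v y by auto
  have \<tau>v: "\<tau> p' = p1" "\<tau> q' = q1" using ne by (auto simp: \<tau>_def Transposition.transpose_def)
  have y\<tau>: "y \<circ> \<tau> = y" using v y by (auto simp: \<tau>_def Transposition.transpose_def fun_eq_iff)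
  have "inv (\<sigma> \<circ> \<tau>) p = p'" "inv (\<sigma> \<circ> \<tau>) q = q'"
    using permutes_inv_eq[OF permutes_compose[OF \<tau> \<sigma>(1)]] \<tau>v s by auto
  moreover have "y = x \<circ> (\<sigma> \<circ> \<tau>)" using y\<tau> \<sigma>(2) by (simp add: comp_assoc)
  ultimately show ?thesis using permutes_compose[OF \<tau> \<sigma>(1)] by blast
qed

lemma sum_permutes_split_pairs:
  fixes \<phi> :: "(nat \<Rightarrow> int) \<Rightarrow> nat \<Rightarrow> nat \<Rightarrow> real"
  assumes "finite I" "(x, p, q) \<in> split_pairs I"
  shows "real (card (split_pairs I)) * (\<Sum>\<pi> | \<pi> permutes I. \<phi> (x \<circ> \<pi>) (inv \<pi> p) (inv \<pi> q)) =
    fact (card I) * (\<Sum>(x, p, q)\<in>split_pairs I. \<phi> x p q)"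
proof -
  define act :: "(nat \<Rightarrow> nat) \<Rightarrow> (nat \<Rightarrow> int) \<times> nat \<times> nat \<Rightarrow> (nat \<Rightarrow> int) \<times> nat \<times> nat"
    where "act = (\<lambda>\<pi> (x, p, q). (x \<circ> \<pi>, inv \<pi> p, inv \<pi> q))"
  have "real (card (split_pairs I)) * (\<Sum>\<pi> | \<pi> permutes I. (\<lambda>(x, p, q). \<phi> x p q) (act \<pi> (x, p, q))) =
    fact (card I) * (\<Sum>z\<in>split_pairs I. (\<lambda>(x, p, q). \<phi> x p q) z)"
  proof (rule sum_permutes_transitive[OF assms(1) finite_split_pairs[OF assms(1)] assms(2)])
    fix \<pi> z assume \<pi>: "\<pi> permutes I" and z: "z \<in> split_pairs I"
    then show "act \<pi> z \<in> split_pairs I"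
      using slice_permute[OF \<pi>] permutes_in_image[OF permutes_inv[OF \<pi>]] permutes_inverses(1)[OF \<pi>]
      by (auto simp: split_pairs_def act_def)
  next
    fix \<pi> \<sigma> z assume "\<pi> permutes I" "\<sigma> permutes I" "z \<in> split_pairs I"
    then show "act \<pi> (act \<sigma> z) = act (\<sigma> \<circ> \<pi>) z"
      by (auto simp: act_def comp_assoc o_inv_distrib permutes_bij split: prod.splits)
  next
    fix z show "act id z = z" by (cases z) (simp add: act_def)
  next
    fix z assume "z \<in> split_pairs I"
    then show "\<exists>\<sigma>. \<sigma> permutes I \<and> z = act \<sigma> (x, p, q)"
      using split_pairs_transitive[OF assms] by (cases z) (auto simp: act_def)
  qed
  then show ?thesis by (simp add: act_def)
qed

lemma card_split_pairs_eq:
  assumes "finite I"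
  shows "card (split_pairs I) = (\<Sum>i\<in>I. \<Sum>j\<in>I. card {x \<in> slice I. x i = 1 \<and> x j = -1})"
    and "(\<Sum>(x, i, j)\<in>split_pairs I. of_bool (P x i j)) =
      real (\<Sum>i\<in>I. \<Sum>j\<in>I. card {x \<in> slice I. x i = 1 \<and> x j = -1 \<and> P x i j})"
proof -
  have gen: "card {(x, i, j). (x, i, j) \<in> split_pairs I \<and> Q x i j} =
      (\<Sum>i\<in>I. \<Sum>j\<in>I. card {x \<in> slice I. x i = 1 \<and> x j = -1 \<and> Q x i j})" for Q
  proof -
    let ?S = "SIGMA i:I. SIGMA j:I. {x \<in> slice I. x i = 1 \<and> x j = -1 \<and> Q x i j}"
    have "bij_betw (\<lambda>(i, j, x). (x, i, j)) ?S {(x, i, j). (x, i, j) \<in> split_pairs I \<and> Q x i j}"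
      by (rule bij_betw_byWitness[where f' = "\<lambda>(x, i, j). (i, j, x)"]) (auto simp: split_pairs_def)
    then have "card {(x, i, j). (x, i, j) \<in> split_pairs I \<and> Q x i j} = card ?S"
      by (simp add: bij_betw_same_card)
    also have "\<dots> = (\<Sum>i\<in>I. card (SIGMA j:I. {x \<in> slice I. x i = 1 \<and> x j = -1 \<and> Q x i j}))"
      using assms by (intro card_SigmaI) auto
    also have "\<dots> = (\<Sum>i\<in>I. \<Sum>j\<in>I. card {x \<in> slice I. x i = 1 \<and> x j = -1 \<and> Q x i j})"
      using assms by (intro sum.cong card_SigmaI) auto
    finally show ?thesis .
  qed
  show "card (split_pairs I) = (\<Sum>i\<in>I. \<Sum>j\<in>I. card {x \<in> slice I. x i = 1 \<and> x j = -1})"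
    using gen[of "\<lambda>_ _ _. True"] by simp
  have "(\<Sum>(x, i, j)\<in>split_pairs I. of_bool (P x i j)) =
      (\<Sum>z\<in>split_pairs I. of_bool (case z of (x, i, j) \<Rightarrow> P x i j) :: real)"
    by (rule sum.cong) auto
  also have "\<dots> = real (card {z \<in> split_pairs I. case z of (x, i, j) \<Rightarrow> P x i j})"
    using finite_split_pairs[OF assms] by (simp add: Int_def)
  also have "{z \<in> split_pairs I. case z of (x, i, j) \<Rightarrow> P x i j} =
      {(x, i, j). (x, i, j) \<in> split_pairs I \<and> P x i j}" by auto
  finally show "(\<Sum>(x, i, j)\<in>split_pairs I. of_bool (P x i j)) =
      real (\<Sum>i\<in>I. \<Sum>j\<in>I. card {x \<in> slice I. x i = 1 \<and> x j = -1 \<and> P x i j})"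
    by (simp add: gen)
qed

lemma card_slice_split:
  assumes "finite I" "i \<in> I" "j \<in> I" "i \<noteq> j"
  shows "card {x \<in> slice I. x i = 1 \<and> x j = -1} = card (slice (I - {i, j}))"
proof -
  have "bij_betw (\<lambda>x. restrict x (I - {i, j})) {x \<in> slice I. x i = 1 \<and> x j = -1} (slice (I - {i, j}))"
  proof (rule bij_betw_byWitness[where f' = "\<lambda>x. x(i := 1, j := -1)"])
    show "\<forall>x\<in>{x \<in> slice I. x i = 1 \<and> x j = -1}. (restrict x (I - {i, j}))(i := 1, j := -1) = x"
      using slice_update_restrict by (metis (mono_tags, lifting) mem_Collect_eq)
    show "\<forall>x\<in>slice (I - {i, j}). restrict (x(i := 1, j := -1)) (I - {i, j}) = x"
    proof
      fix x assume "x \<in> slice (I - {i, j})"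
      then have "x \<in> extensional (I - {i, j})" by (auto simp: slice_def PiE_iff)
      then show "restrict (x(i := 1, j := -1)) (I - {i, j}) = x"
        by (auto simp: fun_eq_iff extensional_def)
    qed
    show "(\<lambda>x. restrict x (I - {i, j})) ` {x \<in> slice I. x i = 1 \<and> x j = -1} \<subseteq> slice (I - {i, j})"
      using slice_restrict[OF assms(1-3)] by auto
    show "(\<lambda>x. x(i := 1, j := -1)) ` slice (I - {i, j}) \<subseteq> {x \<in> slice I. x i = 1 \<and> x j = -1}"
      using slice_extend[OF assms, of 1] assms(4) by auto
  qed
  then show ?thesis by (rule bij_betw_same_card)
qed

text \<open>Given one end \<open>i\<close>, the other end is uniform among the remaining
  \<open>card I - 1\<close> variables, since all slices with two variables removed have the same
  size. At least \<open>v\<close> choices are non-exchangeable with \<open>i\<close>, and for each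
  of them the swap changes \<open>f\<close> with probability at least \<open>4^(-d)\<close>.\<close>

lemma sum_split_pairs_ge:
  assumes "polylt (Suc (Suc d)) f" "finite I" "even (card I)"
    and v: "\<And>i. i \<in> I \<Longrightarrow> v \<le> card {j \<in> I. \<not> exchangeable f I i j}"
  shows "real v * real (card (split_pairs I)) \<le>
    4 ^ d * (real (card I) - 1) * (\<Sum>(x, i, j)\<in>split_pairs I. of_bool (f x \<noteq> f (x \<circ> transposition i j)))"
proof (cases "I = {}")
  case True
  then have "split_pairs I = {}" by (auto simp: split_pairs_def)
  then show ?thesis by simp
next
  case False
  define n where "n = card I"
  have n: "n \<ge> 1" using False assms(2) by (simp add: n_def Suc_le_eq card_gt_0_iff)
  define \<beta> where "\<beta> = (n - 2) choose ((n - 2) div 2)"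
  have \<beta>: "card (slice (I - {i, j})) = \<beta>" if "i \<in> I" "j \<in> I" "i \<noteq> j" for i j
  proof -
    have "card {i, j} \<le> card I" using that assms(2) by (intro card_mono) auto
    then have "card (I - {i, j}) = n - 2" "even (n - 2)"
      using that assms(2,3) by (auto simp: n_def card_Diff_subset)
    then show ?thesis using card_slice[of "I - {i, j}"] assms(2) by (simp add: \<beta>_def)
  qed
  let ?D = "\<lambda>i j. card {x \<in> slice I. x i = 1 \<and> x j = -1 \<and> f x \<noteq> f (x \<circ> transposition i j)}"
  have "card (split_pairs I) = (\<Sum>i\<in>I. \<Sum>j\<in>I. if j = i then 0 else \<beta>)"
    unfolding card_split_pairs_eq(1)[OF assms(2)]
  proof (intro sum.cong refl)
    fix i j assume ij: "i \<in> I" "j \<in> I"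
    have "{x \<in> slice I. x i = 1 \<and> x i = (-1 :: int)} = {}" by auto
    then have "card {x \<in> slice I. x i = 1 \<and> x i = -1} = 0" by (simp only: card.empty)
    then show "card {x \<in> slice I. x i = 1 \<and> x j = -1} = (if j = i then 0 else \<beta>)"
      using card_slice_split[OF assms(2) ij] \<beta>[OF ij] by auto
  qed
  also have "\<dots> = n * ((n - 1) * \<beta>)"
  proof -
    have "(\<Sum>j\<in>I. if j = i then 0 else \<beta>) = (n - 1) * \<beta>" if "i \<in> I" for i
      using sum.remove[OF assms(2) that, of "\<lambda>j. if j = i then 0 else \<beta>"] assms(2) that
      by (simp add: n_def)
    then show ?thesis by (simp add: n_def)
  qed
  finally have S: "real (card (split_pairs I)) = real n * (real n - 1) * real \<beta>"
    using n by (simp add: of_nat_diff)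
  have D: "v * \<beta> \<le> 4 ^ d * (\<Sum>j\<in>I. ?D i j)" if i: "i \<in> I" for i
  proof -
    have "v * \<beta> \<le> card {j \<in> I. \<not> exchangeable f I i j} * \<beta>" using v[OF i] by simp
    also have "\<dots> = (\<Sum>j | j \<in> I \<and> \<not> exchangeable f I i j. \<beta>)" by simp
    also have "\<dots> \<le> (\<Sum>j | j \<in> I \<and> \<not> exchangeable f I i j. 4 ^ d * ?D i j)"
    proof (rule sum_mono)
      fix j assume "j \<in> {j. j \<in> I \<and> \<not> exchangeable f I i j}"
      then have j: "j \<in> I" "\<not> exchangeable f I i j" by auto
      then have "i \<noteq> j" using exchangeable_refl by blast
      then show "\<beta> \<le> 4 ^ d * ?D i j"
        using card_exchange_pairs[OF assms(1,2) i j] \<beta>[OF i j(1)] by simp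
    qed
    also have "\<dots> \<le> (\<Sum>j\<in>I. 4 ^ d * ?D i j)"
      using assms(2) by (intro sum_mono2) auto
    finally show ?thesis by (simp add: sum_distrib_left)
  qed
  have "n * (v * \<beta>) = (\<Sum>i\<in>I. v * \<beta>)" by (simp add: n_def)
  also have "\<dots> \<le> (\<Sum>i\<in>I. 4 ^ d * (\<Sum>j\<in>I. ?D i j))" by (rule sum_mono) (rule D)
  finally have "n * (v * \<beta>) \<le> 4 ^ d * (\<Sum>i\<in>I. \<Sum>j\<in>I. ?D i j)" by (simp add: sum_distrib_left)
  then have "real (n * (v * \<beta>)) \<le> real (4 ^ d * (\<Sum>i\<in>I. \<Sum>j\<in>I. ?D i j))"
    by (rule of_nat_mono)
  then have "(real n - 1) * (real n * (real v * real \<beta>)) \<le>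
      (real n - 1) * (4 ^ d * real (\<Sum>i\<in>I. \<Sum>j\<in>I. ?D i j))"
    using n by (intro mult_left_mono) (auto simp del: of_nat_sum)
  then show ?thesis
    unfolding card_split_pairs_eq(2)[OF assms(2)] S n_def[symmetric] by (simp add: mult_ac del: of_nat_sum)
qed

section \<open>Random matchings as cubes inside the slice\<close>

lemma deglt_polylt:
  assumes "polylt d F" "\<And>i. deglt N 2 (\<lambda>y. real_of_int (x y i))"
  shows "deglt N d (\<lambda>y. F (x y))"
proof -
  obtain p where p: "\<And>S. S \<in> Poly_Mapping.keys p \<Longrightarrow> finite S \<and> card S < d" "F = mleval p"
    using assms(1) by (auto simp: polylt_def)
  show ?thesis
    unfolding p(2) mleval_def
  proof (intro deglt_sum deglt_cmult)
    fix S assume "S \<in> Poly_Mapping.keys p"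
    then have S: "finite S" "Suc (card S) \<le> d" using p(1)[of S] by auto
    show "deglt N d (\<lambda>y. \<Prod>i\<in>S. real_of_int (x y i))"
      using deglt_mono[OF deglt_prod[OF S(1), of N "\<lambda>i y. real_of_int (x y i)"] S(2)] assms(2) by blast
  qed
qed

text \<open>The fixed matching of \<open>2 k\<close> with \<open>2 k + 1\<close>; bit
  \<open>k\<close> decides which end is positive. A random matching is this one composed with a
  random permutation, so one cube serves all matchings.\<close>

definition spread :: "nat \<Rightarrow> bool list \<Rightarrow> nat \<Rightarrow> int" where
  "spread N ys = (\<lambda>i\<in>{..<2 * N}. if even i = ys ! (i div 2) then 1 else -1)"

lemma spread_in_slice: "spread N ys \<in> slice {..<2 * N}"
proof -
  have "(\<Sum>i<2 * N. spread N ys i) =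
      (\<Sum>i<2 * N. if even i then (if ys ! (i div 2) then 1 else -1) else (if ys ! (i div 2) then -1 else 1))"
    by (rule sum.cong) (auto simp: spread_def)
  also have "\<dots> = 0" by (induction N) auto
  finally show ?thesis by (auto simp: slice_def spread_def)
qed

lemma spread_flip:
  assumes "k < N" "ys \<in> cube N"
  shows "spread N (flip ys k) = spread N ys \<circ> transposition (2 * k) (2 * k + 1)"
proof
  fix i
  consider "i = 2 * k" | "i = 2 * k + 1" | "i \<noteq> 2 * k" "i \<noteq> 2 * k + 1" by blast
  then show "spread N (flip ys k) i = (spread N ys \<circ> transposition (2 * k) (2 * k + 1)) i"
  proof cases
    case 3
    then have "i div 2 \<noteq> k" by presburger
    then show ?thesis using 3 by (simp add: spread_def flip_def)
  qed (use assms in \<open>auto simp: spread_def flip_def cube_def\<close>)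
qed

lemma deglt_spread: "deglt N 2 (\<lambda>y. real_of_int ((spread N y \<circ> \<pi>) i))"
proof (cases "\<pi> i < 2 * N")
  case True
  then have "deglt N 2 (\<lambda>y. (\<lambda>b. if even (\<pi> i) = b then 1 else -1) (y ! (\<pi> i div 2)))"
    by (intro deglt_coordinate) auto
  moreover have "(\<lambda>y. real_of_int ((spread N y \<circ> \<pi>) i)) =
      (\<lambda>y. (\<lambda>b. if even (\<pi> i) = b then 1 else -1) (y ! (\<pi> i div 2)))"
    using True by (auto simp: spread_def fun_eq_iff)
  ultimately show ?thesis by simp
next
  case False
  then have "(\<lambda>y. real_of_int ((spread N y \<circ> \<pi>) i)) = (\<lambda>y. real_of_int undefined)"
    by (auto simp: spread_def fun_eq_iff)
  then show ?thesis by (simp add: numeral_2_eq_2 deglt_const)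
qed

lemma transposition_permutes:
  assumes "\<pi> permutes I"
  shows "transposition p q \<circ> \<pi> = \<pi> \<circ> transposition (inv \<pi> p) (inv \<pi> q)"
proof -
  have "x = inv \<pi> y \<longleftrightarrow> \<pi> x = y" for x y using permutes_inv_eq[OF assms] by metis
  then show ?thesis
    using permutes_inverses[OF assms] by (auto simp: fun_eq_iff Transposition.transpose_def)
qed

text \<open>Suppose all deviations \<open>X\<close> stay below \<open>c\<close>. Three estimates
  then collide: the mean of \<open>|X|\<close> is below \<open>2 c\<close>, the mean of
  \<open>Z\<close> over the permutations is at least \<open>v / (2 * 4^d)\<close>, and
  \<open>Z\<close> is at most \<open>sqrt v * 2 * sqrt (d + 1) * 3^(d+1)\<close> times the mean of
  \<open>|X|\<close> for that matching. Solving for \<open>c\<close> gives the stated constant, with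
  \<open>12 = 4 * 3\<close>.\<close>

lemma exists_above_mean:
  fixes f :: "(nat \<Rightarrow> int) \<Rightarrow> real"
  assumes "N > 0" "v > 0"
    and f: "polylt (Suc (Suc d)) f" "\<And>x. x \<in> slice {..<2 * N} \<Longrightarrow> f x \<in> \<int>"
    and v: "\<And>i. i < 2 * N \<Longrightarrow> v \<le> card {j \<in> {..<2 * N}. \<not> exchangeable f {..<2 * N} i j}"
    and i0: "i0 < 2 * N" "card {j \<in> {..<2 * N}. \<not> exchangeable f {..<2 * N} i0 j} = v"
  shows "\<exists>x\<in>slice {..<2 * N}. (\<Sum>x\<in>slice {..<2 * N}. f x) / card (slice {..<2 * N}) +
    sqrt v / (2 * sqrt (Suc d) * 12 ^ Suc d) \<le> f x"
proof (rule ccontr)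
  define I where "I = {..<2 * N}"
  define m where "m = card (slice I)"
  define \<mu> where "\<mu> = (\<Sum>x\<in>slice I. f x) / m"
  define c where "c = sqrt v / (2 * sqrt (Suc d) * 12 ^ Suc d)"
  define X where "X = (\<lambda>x. f x - \<mu>)"
  define L where "L = (\<Sum>x\<in>slice I. \<bar>X x\<bar>)"
  define P where "P = {\<pi>. \<pi> permutes I}"
  define D where "D = 4 * real (Suc d)"
  define Z where "Z = (\<lambda>\<pi>. \<Sum>k<N. cube_mean N (\<lambda>y.
    of_bool (f (spread N y \<circ> \<pi>) \<noteq> f (spread N (flip y k) \<circ> \<pi>))))"
  define M where "M = (\<lambda>\<pi>. cube_mean N (\<lambda>y. \<bar>X (spread N y \<circ> \<pi>)\<bar>))"
  assume "\<not> ?thesis"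
  then have less: "X x < c" if "x \<in> slice I" for x
    using that by (force simp: I_def X_def c_def \<mu>_def m_def not_le)
  have I: "finite I" "card I = 2 * N" by (simp_all add: I_def)
  have c0: "c > 0" using assms(2) by (simp add: c_def)
  have P: "finite P" "card P = fact (2 * N)"
    using finite_permutations[OF I(1)] card_permutations[OF I(2) I(1)] by (simp_all add: P_def)
  have m0: "m > 0"
    using spread_in_slice[of N] I(1) by (auto simp: m_def card_gt_0_iff I_def)
  have perm_slice: "spread N y \<circ> \<pi> \<in> slice I" if "\<pi> \<in> P" for \<pi> y
    using slice_permute[of \<pi> I] spread_in_slice that by (auto simp: I_def P_def)
  \<comment> \<open>The deviations sum to 0, so their positive and negative parts have equal mass:
    an upper bound on \<open>X\<close> alone controls the sum of \<open>|X|\<close>.\<close>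
  have "L < 2 * c * m"
  proof -
    have "L < (\<Sum>x\<in>slice I. 2 * c - X x)"
      unfolding L_def
    proof (rule sum_strict_mono)
      fix x assume "x \<in> slice I"
      then show "\<bar>X x\<bar> < 2 * c - X x" using less[of x] c0 by auto
    qed (use I m0 in \<open>auto simp: m_def\<close>)
    also have "\<dots> = 2 * c * m - ((\<Sum>x\<in>slice I. f x) - m * \<mu>)"
      by (simp add: X_def sum_subtractf m_def)
    also have "\<dots> = 2 * c * m" using m0 by (simp add: \<mu>_def)
    finally show ?thesis .
  qed
  have sum_M: "real m * (\<Sum>\<pi>\<in>P. M \<pi>) = fact (2 * N) * L"
  proof -
    have "real m * (\<Sum>\<pi>\<in>P. M \<pi>) = cube_mean N (\<lambda>y. real m * (\<Sum>\<pi>\<in>P. \<bar>X (spread N y \<circ> \<pi>)\<bar>))"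
      by (simp add: M_def cube_mean_cmult cube_mean_sum)
    also have "\<dots> = cube_mean N (\<lambda>y. fact (2 * N) * L)"
      using sum_permutes_slice[OF I(1), of _ "\<lambda>x. \<bar>X x\<bar>"] spread_in_slice
      by (intro cube_mean_cong) (simp add: P_def m_def L_def I_def)
    finally show ?thesis by (simp add: cube_mean_const)
  qed
  have Z0: "Z \<pi> \<ge> 0" for \<pi>
    unfolding Z_def by (intro sum_nonneg cube_mean_nonneg) auto
  have Z_v: "Z \<pi> \<le> v" if \<pi>: "\<pi> \<in> P" for \<pi>
  proof -
    define E where "E = {k. k < N \<and> \<not> exchangeable f I (inv \<pi> (2 * k)) (inv \<pi> (2 * k + 1))}"
    have \<pi>p: "\<pi> permutes I" using \<pi> by (simp add: P_def)
    have inI: "inv \<pi> (2 * k) \<in> I" "inv \<pi> (2 * k + 1) \<in> I" if "k < N" for k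
      using permutes_in_image[OF permutes_inv[OF \<pi>p]] that by (auto simp: I_def)
    have "cube_mean N (\<lambda>y. of_bool (f (spread N y \<circ> \<pi>) \<noteq> f (spread N (flip y k) \<circ> \<pi>))) \<le>
        of_bool (k \<in> E)" if k: "k < N" for k
    proof -
      have "cube_mean N (\<lambda>y. of_bool (f (spread N y \<circ> \<pi>) \<noteq> f (spread N (flip y k) \<circ> \<pi>))) \<le>
          cube_mean N (\<lambda>y. of_bool (k \<in> E))"
      proof (rule cube_mean_mono)
        fix y assume y: "y \<in> cube N"
        note transposition_permutes[OF \<pi>p, of "2 * k" "2 * k + 1"]
        then have "spread N (flip y k) \<circ> \<pi> =
            (spread N y \<circ> \<pi>) \<circ> transposition (inv \<pi> (2 * k)) (inv \<pi> (2 * k + 1))"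
          unfolding spread_flip[OF k y] by (simp add: comp_assoc)
        then show "of_bool (f (spread N y \<circ> \<pi>) \<noteq> f (spread N (flip y k) \<circ> \<pi>)) \<le> (of_bool (k \<in> E) :: real)"
          using k perm_slice[OF \<pi>, of y]
          by (auto simp: E_def exchangeable_def intro!: bexI[of _ "spread N y \<circ> \<pi>"])
      qed
      then show ?thesis by (simp add: cube_mean_const)
    qed
    then have "Z \<pi> \<le> (\<Sum>k<N. of_bool (k \<in> E))"
      unfolding Z_def by (intro sum_mono) auto
    also have "\<dots> = card E" by (simp add: E_def Int_def)
    also have "card E \<le> card {j \<in> I. \<not> exchangeable f I i0 j}"
    proof -
      let ?V = "{j \<in> I. \<not> exchangeable f I i0 j}"
      \<comment> \<open>If both ends of an edge were exchangeable with \<open>i0\<close>, they would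
        be exchangeable with each other. So a sensitive edge has an end among the \<open>v\<close>
        variables not exchangeable with \<open>i0\<close>, and the edge can be read off from that
        end.\<close>
      let ?h = "\<lambda>k. if inv \<pi> (2 * k) \<in> ?V then inv \<pi> (2 * k) else inv \<pi> (2 * k + 1)"
      have h: "inv \<pi> (2 * k) \<in> ?V \<or> inv \<pi> (2 * k + 1) \<in> ?V" if "k \<in> E" for k
        using that inI[of k] exchangeable_trans[of f I "inv \<pi> (2 * k)" i0 "inv \<pi> (2 * k + 1)"] i0(1)
          exchangeable_sym[of f I i0]
        by (auto simp: E_def I_def)
      show ?thesis
      proof (rule card_inj_on_le[of ?h])
        show "inj_on ?h E"
        proof (rule inj_on_inverseI[of _ "\<lambda>j. \<pi> j div 2"])
          fix k show "\<pi> (?h k) div 2 = k" using permutes_inverses[OF \<pi>p] by auto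
        qed
        show "?h ` E \<subseteq> ?V" using h by auto
      qed (use I in simp)
    qed
    finally show ?thesis using i0 by (simp add: I_def)
  qed
  have M_Z: "Z \<pi> \<le> sqrt v * sqrt D * 3 ^ Suc d * M \<pi>" if \<pi>: "\<pi> \<in> P" for \<pi>
  proof -
    let ?g = "\<lambda>y. X (spread N y \<circ> \<pi>)"
    have g: "deglt N (Suc (Suc d)) ?g"
      unfolding X_def by (intro deglt_diff deglt_const deglt_polylt[OF f(1)] deglt_spread)
    have "Z \<pi> \<le> (\<Sum>k<N. cube_mean N (\<lambda>y. (?g y - ?g (flip y k))\<^sup>2))"
      unfolding Z_def
    proof (intro sum_mono cube_mean_mono)
      fix k y
      \<comment> \<open>The values are integers, so a nonzero difference has square at least 1 and
        the indicator is below the squared difference.\<close>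
      have "f (spread N y \<circ> \<pi>) - f (spread N (flip y k) \<circ> \<pi>) \<in> \<int>"
        using f(2) perm_slice[OF \<pi>] by (auto simp: I_def)
      then have "f (spread N y \<circ> \<pi>) \<noteq> f (spread N (flip y k) \<circ> \<pi>) \<Longrightarrow>
          1 \<le> \<bar>f (spread N y \<circ> \<pi>) - f (spread N (flip y k) \<circ> \<pi>)\<bar>"
        by (intro Ints_nonzero_abs_ge1) auto
      then show "of_bool (f (spread N y \<circ> \<pi>) \<noteq> f (spread N (flip y k) \<circ> \<pi>)) \<le> (?g y - ?g (flip y k))\<^sup>2"
        by (auto simp: X_def simp flip: abs_le_square_iff[of 1, simplified])
    qed
    also have "\<dots> \<le> D * cube_mean N (\<lambda>y. (?g y)\<^sup>2)"
      using total_influence_le[OF g] by (simp add: D_def)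
    finally have "sqrt (Z \<pi>) \<le> sqrt D * sqrt (cube_mean N (\<lambda>y. (?g y)\<^sup>2))"
      by (simp flip: real_sqrt_mult)
    also have "\<dots> \<le> sqrt D * (3 ^ Suc d * M \<pi>)"
      unfolding M_def using cube_mean_abs[OF g] by (intro mult_left_mono) (auto simp: D_def)
    \<comment> \<open>One of the two factors \<open>sqrt Z\<close> is bounded by
      \<open>sqrt v\<close>, which makes the inequality linear in \<open>Z\<close> and ready for
      averaging.\<close>
    finally have "sqrt (Z \<pi>) * sqrt (Z \<pi>) \<le> sqrt v * (sqrt D * (3 ^ Suc d * M \<pi>))"
      using Z_v[OF \<pi>] Z0[of \<pi>] by (intro mult_mono) auto
    then show ?thesis using Z0[of \<pi>] by (simp add: mult_ac)
  qed
  \<comment> \<open>For fixed bits and a fixed edge, a random permutation produces a uniform element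
    of \<open>split_pairs I\<close>. Summing over \<open>N\<close> edges turns
    \<open>v / (4^d (2 N - 1))\<close> into at least \<open>v / (2 * 4^d)\<close>.\<close>
  have sum_Z: "fact (2 * N) * real v \<le> 2 * 4 ^ d * (\<Sum>\<pi>\<in>P. Z \<pi>)"
  proof -
    let ?\<phi> = "\<lambda>x i j. of_bool (f x \<noteq> f (x \<circ> transposition i j)) :: real"
    define s where "s = real (card (split_pairs I))"
    define T where "T = (\<Sum>(x, i, j)\<in>split_pairs I. ?\<phi> x i j)"
    have T: "real v * s \<le> 4 ^ d * (2 * real N - 1) * T"
      using sum_split_pairs_ge[OF f(1) I(1), of v] v by (simp add: s_def T_def I_def)
    have S: "s * (\<Sum>\<pi>\<in>P. of_bool (f (spread N y \<circ> \<pi>) \<noteq> f (spread N (flip y k) \<circ> \<pi>))) = fact (2 * N) * T"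
      and s0: "s > 0" if y: "y \<in> cube N" and k: "k < N" for y k
    proof -
      define p q where "p = (if y ! k then 2 * k else 2 * k + 1)"
        and "q = (if y ! k then 2 * k + 1 else 2 * k)"
      have mem: "(spread N y, p, q) \<in> split_pairs I"
        using k spread_in_slice by (auto simp: split_pairs_def p_def q_def I_def spread_def)
      then show "s > 0" using finite_split_pairs[OF I(1)] by (auto simp: s_def card_gt_0_iff)
      have tr: "transposition (2 * k) (2 * k + 1) = transposition p q"
        by (auto simp: p_def q_def transpose_commute)
      have "(\<Sum>\<pi>\<in>P. of_bool (f (spread N y \<circ> \<pi>) \<noteq> f (spread N (flip y k) \<circ> \<pi>))) =
          (\<Sum>\<pi> | \<pi> permutes I. ?\<phi> (spread N y \<circ> \<pi>) (inv \<pi> p) (inv \<pi> q))"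
        unfolding P_def
      proof (rule sum.cong)
        fix \<pi> assume "\<pi> \<in> {\<pi>. \<pi> permutes I}"
        then have \<pi>p: "\<pi> permutes I" by simp
        note transposition_permutes[OF \<pi>p, of p q]
        then have "spread N (flip y k) \<circ> \<pi> = (spread N y \<circ> \<pi>) \<circ> transposition (inv \<pi> p) (inv \<pi> q)"
          unfolding spread_flip[OF k y] tr by (simp add: comp_assoc)
        then show "of_bool (f (spread N y \<circ> \<pi>) \<noteq> f (spread N (flip y k) \<circ> \<pi>)) =
            ?\<phi> (spread N y \<circ> \<pi>) (inv \<pi> p) (inv \<pi> q)" by simp
      qed simp
      then show "s * (\<Sum>\<pi>\<in>P. of_bool (f (spread N y \<circ> \<pi>) \<noteq> f (spread N (flip y k) \<circ> \<pi>))) = fact (2 * N) * T"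
        using sum_permutes_split_pairs[OF I(1) mem, of ?\<phi>] by (simp add: s_def T_def I(2))
    qed
    have "s * (\<Sum>\<pi>\<in>P. Z \<pi>) = (\<Sum>k<N. cube_mean N (\<lambda>y. s * (\<Sum>\<pi>\<in>P.
        of_bool (f (spread N y \<circ> \<pi>) \<noteq> f (spread N (flip y k) \<circ> \<pi>)))))"
      unfolding Z_def cube_mean_cmult cube_mean_sum sum_distrib_left[symmetric]
      by (subst sum.swap) (rule refl)
    also have "\<dots> = (\<Sum>k<N. cube_mean N (\<lambda>y. fact (2 * N) * T))"
      by (intro sum.cong cube_mean_cong refl) (use S in simp)
    also have "\<dots> = real N * (fact (2 * N) * T)" by (simp add: cube_mean_const)
    finally have Zs: "s * (\<Sum>\<pi>\<in>P. Z \<pi>) = real N * (fact (2 * N) * T)" .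
    have s0: "s > 0" using s0[of "replicate N True" 0] assms(1) by (simp add: cube_def)
    have T0: "T \<ge> 0" unfolding T_def by (rule sum_nonneg) auto
    have "(2 * real N - 1) * T \<le> 2 * real N * T" using T0 by (simp add: mult_right_mono)
    then have "4 ^ d * ((2 * real N - 1) * T) \<le> 4 ^ d * (2 * real N * T)"
      by (intro mult_left_mono) auto
    with T have "real v * s \<le> 4 ^ d * (2 * real N * T)" by linarith
    then have "fact (2 * N) * (real v * s) \<le> fact (2 * N) * (4 ^ d * (2 * real N * T))"
      by (intro mult_left_mono) auto
    also have "\<dots> = 2 * 4 ^ d * (s * (\<Sum>\<pi>\<in>P. Z \<pi>))" by (simp add: Zs)
    finally have "s * (fact (2 * N) * real v) \<le> s * (2 * 4 ^ d * (\<Sum>\<pi>\<in>P. Z \<pi>))"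
      by (simp add: mult_ac)
    then show ?thesis using s0 by simp
  qed
  define K where "K = sqrt v * sqrt D * 3 ^ Suc d"
  have "(\<Sum>\<pi>\<in>P. Z \<pi>) \<le> (\<Sum>\<pi>\<in>P. K * M \<pi>)"
    using M_Z by (intro sum_mono) (simp add: K_def)
  then have "real m * (\<Sum>\<pi>\<in>P. Z \<pi>) \<le> K * (real m * (\<Sum>\<pi>\<in>P. M \<pi>))"
    using m0 by (simp flip: sum_distrib_left)
  also have "\<dots> = fact (2 * N) * (K * L)" by (simp add: sum_M)
  finally have ZL: "real m * (\<Sum>\<pi>\<in>P. Z \<pi>) \<le> fact (2 * N) * (K * L)" .
  have "fact (2 * N) * (real m * real v) = real m * (fact (2 * N) * real v)" by simp
  also have "\<dots> \<le> real m * (2 * 4 ^ d * (\<Sum>\<pi>\<in>P. Z \<pi>))"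
    using sum_Z by (intro mult_left_mono) auto
  also have "\<dots> = 2 * 4 ^ d * (real m * (\<Sum>\<pi>\<in>P. Z \<pi>))" by simp
  also have "\<dots> \<le> 2 * 4 ^ d * (fact (2 * N) * (K * L))"
    using ZL by (intro mult_left_mono) auto
  also have "\<dots> = fact (2 * N) * (2 * 4 ^ d * (K * L))" by simp
  finally have "fact (2 * N) * (real m * real v) \<le> fact (2 * N) * (2 * 4 ^ d * (K * L))" .
  then have "real m * real v \<le> 2 * 4 ^ d * (K * L)" by simp
  also have "\<dots> < 2 * 4 ^ d * (K * (2 * c * m))"
    using \<open>L < 2 * c * m\<close> assms(2) by (simp add: K_def D_def)
  also have "\<dots> = real m * real v"
  proof -
    have D: "sqrt D = 2 * sqrt (Suc d)" unfolding D_def real_sqrt_mult by simp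
    have "(12::real) ^ Suc d = 4 ^ Suc d * 3 ^ Suc d" by (simp flip: power_mult_distrib)
    then have "K * c * (4 * 4 ^ d) = sqrt v * sqrt v"
      by (simp add: K_def c_def D field_simps)
    then have "K * c * (4 * 4 ^ d) = real v" by simp
    then show ?thesis by (simp add: mult_ac)
  qed
  finally show False by simp
qed

section \<open>Test points for exchangeability\<close>

definition signs :: "nat \<Rightarrow> (nat \<Rightarrow> bool) \<Rightarrow> nat \<Rightarrow> int" where
  "signs n b = (\<lambda>v\<in>{..<n}. if b v then 1 else -1)"

lemma signs_in_assignments: "signs n b \<in> assignments n"
  by (auto simp: signs_def assignments_def)

lemma signs_transposition:
  "i < n \<Longrightarrow> j < n \<Longrightarrow> signs n (b \<circ> transposition i j) = signs n b \<circ> transposition i j"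
  by (auto simp: signs_def fun_eq_iff Transposition.transpose_def)

lemma signs_of_slice: "x \<in> slice {..<n} \<Longrightarrow> signs n (\<lambda>v. x v = 1) = x"
  using slice_values[of x "{..<n}"] by (fastforce simp: signs_def fun_eq_iff slice_def PiE_iff extensional_def)

lemma signs_cong: "(\<And>v. v < n \<Longrightarrow> b v = b' v) \<Longrightarrow> signs n b = signs n b'"
  by (auto simp: signs_def)

lemma signs_in_slice_iff: "signs n b \<in> slice {..<n} \<longleftrightarrow> 2 * card {v \<in> {..<n}. b v} = n"
proof -
  have "(\<Sum>i<n. signs n b i) = 2 * int (card {i \<in> {..<n}. signs n b i = 1}) - int n"
    using sum_signs[of "{..<n}" "signs n b"] by (simp add: signs_def)
  also have "{i \<in> {..<n}. signs n b i = 1} = {v \<in> {..<n}. b v}" by (auto simp: signs_def)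
  finally show ?thesis by (auto simp: slice_def signs_def)
qed

section \<open>Lists of swaps\<close>

fun swaps :: "(nat \<times> nat) list \<Rightarrow> nat \<Rightarrow> nat" where
  "swaps [] = id"
| "swaps ((p, q) # L) = transposition p q \<circ> swaps L"

text \<open>In this order \<open>b \<circ> swaps L\<close> is the content of an array
  \<open>b\<close> after executing the swaps of \<open>L\<close> from first to last, as each
  executed swap precomposes one more transposition.\<close>

lemma swaps_append: "swaps (L @ M) = swaps L \<circ> swaps M"
  by (induction L rule: swaps.induct) (auto simp: comp_assoc)

lemma swaps_replicate: "swaps (replicate k (p, p)) = id"
  by (induction k) auto

lemma swaps_permutes:
  assumes "\<forall>(p, q)\<in>set L. p \<in> I \<and> q \<in> I"
  shows "swaps L permutes I"
  using assms by (induction L rule: swaps.induct) (auto intro!: permutes_compose permutes_swap_id permutes_id)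

lemma swaps_fixed: "v \<notin> fst ` set L \<Longrightarrow> v \<notin> snd ` set L \<Longrightarrow> swaps L v = v"
proof (induction L rule: swaps.induct)
  case (2 p q L)
  then show ?case by (auto simp: Transposition.transpose_def)
qed simp

lemma inj_swaps: "inj (swaps L)"
  using swaps_permutes[of L UNIV] by (simp add: permutes_inj)

lemma swaps_fst:
  assumes "distinct (map fst L @ map snd L)" "(p, q) \<in> set L"
  shows "swaps L p = q"
  using assms
proof (induction L rule: swaps.induct)
  case (2 p' q' L)
  show ?case
  proof (cases "(p, q) = (p', q')")
    case True
    have "p' \<notin> fst ` set L" "p' \<notin> snd ` set L" using 2(2) by auto
    then show ?thesis using True swaps_fixed[of p' L] by simp
  next
    case False
    then have L: "(p, q) \<in> set L" using 2(3) by auto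
    then have "q \<in> snd ` set L" by force
    then have "q \<noteq> p'" "q \<noteq> q'" using 2(2) by auto
    moreover have "swaps L p = q" using 2 L by auto
    ultimately show ?thesis by simp
  qed
qed simp

lemma slice_signs_swaps:
  assumes "signs n b \<in> slice {..<n}" "\<forall>(p, q)\<in>set L. p < n \<and> q < n"
  shows "signs n (b \<circ> swaps L) \<in> slice {..<n}"
  using assms
proof (induction L arbitrary: b rule: swaps.induct)
  case (2 p q L)
  have "signs n (b \<circ> transposition p q) \<in> slice {..<n}"
    using 2 slice_transpose[of "signs n b" "{..<n}" p q] by (auto simp: signs_transposition)
  then have "signs n ((b \<circ> transposition p q) \<circ> swaps L) \<in> slice {..<n}"
    using 2(1)[of "b \<circ> transposition p q"] 2(3) by (simp add: o_def)
  then show ?case by (simp only: swaps.simps comp_assoc)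
qed simp

text \<open>Each position that loses its bit is paired with one that gains it; equal weight makes
  the pairing perfect. Since the swaps are disjoint, carrying out an arbitrary subset of them
  parametrises a cube of assignments of the same weight from \<open>b\<close> to
  \<open>b'\<close>.\<close>

lemma swaps_between:
  assumes "card {v \<in> {..<n}. b v} = card {v \<in> {..<n}. b' v}"
  obtains L where "distinct (map fst L @ map snd L)"
    and "fst ` set L \<union> snd ` set L \<subseteq> {v \<in> {..<n}. b v \<noteq> b' v}"
    and "\<And>v. v < n \<Longrightarrow> b' v = b (swaps L v)"
proof -
  have "\<exists>L. distinct (map fst L @ map snd L) \<and> fst ` set L \<union> snd ` set L \<subseteq> {v \<in> {..<n}. b v \<noteq> b' v} \<and>
      (\<forall>v<n. b' v = b (swaps L v))"
    using assms
  proof (induction "card {v \<in> {..<n}. b v \<noteq> b' v}" arbitrary: b rule: less_induct)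
    case less
    let ?D = "\<lambda>b. {v \<in> {..<n}. b v \<noteq> b' v}"
    show ?case
    proof (cases "?D b = {}")
      case True
      then show ?thesis by (intro exI[of _ "[]"]) auto
    next
      case False
      have eq: "{v \<in> {..<n}. b v} = {v \<in> {..<n}. b' v}"
        if "{v \<in> {..<n}. b v} \<subseteq> {v \<in> {..<n}. b' v} \<or> {v \<in> {..<n}. b' v} \<subseteq> {v \<in> {..<n}. b v}"
        using that less.prems card_subset_eq[of "{v \<in> {..<n}. b v}" "{v \<in> {..<n}. b' v}"]
          card_subset_eq[of "{v \<in> {..<n}. b' v}" "{v \<in> {..<n}. b v}"] by auto
      have ne: "{v \<in> {..<n}. b v} \<noteq> {v \<in> {..<n}. b' v}" using False by blast
      then obtain p where p: "p < n" "b p" "\<not> b' p" using eq by blast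
      obtain q where q: "q < n" "\<not> b q" "b' q" using eq ne by blast
      let ?b = "b \<circ> transposition p q"
      have "p \<noteq> q" using p q by auto
      have D: "?D ?b = ?D b - {p, q}"
        using p q by (auto simp: Transposition.transpose_def)
      have "card (?D ?b) < card (?D b)"
        unfolding D using p q by (intro psubset_card_mono) auto
      moreover have "card {v \<in> {..<n}. ?b v} = card {v \<in> {..<n}. b' v}"
      proof -
        have "{v \<in> {..<n}. ?b v} = insert q ({v \<in> {..<n}. b v} - {p})"
          using p q by (auto simp: Transposition.transpose_def split: if_splits)
        also have "card \<dots> = card {v \<in> {..<n}. b v}"
        proof -
          have "card {v \<in> {..<n}. b v} > 0" using p by (auto simp: card_gt_0_iff)
          then show ?thesis using p q by (simp add: card_Diff_singleton)
        qed
        finally show ?thesis using less.prems by simp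
      qed
      ultimately obtain L where L: "distinct (map fst L @ map snd L)"
        "fst ` set L \<union> snd ` set L \<subseteq> ?D ?b" "\<forall>v<n. b' v = ?b (swaps L v)"
        using less.hyps[of ?b] by blast
      show ?thesis
      proof (intro exI[of _ "(p, q) # L"] conjI)
        show "distinct (map fst ((p, q) # L) @ map snd ((p, q) # L))"
          using L(1,2) \<open>p \<noteq> q\<close> unfolding D by auto
        show "fst ` set ((p, q) # L) \<union> snd ` set ((p, q) # L) \<subseteq> ?D b"
          using L(2) p q unfolding D by auto
        show "\<forall>v<n. b' v = b (swaps ((p, q) # L) v)" using L(3) by simp
      qed
    qed
  qed
  then show ?thesis using that by blast
qed

section \<open>Cubes spanned by disjoint swaps\<close>

definition select :: "'a list \<Rightarrow> bool list \<Rightarrow> 'a list" where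
  "select xs ys = map fst (filter snd (zip xs ys))"

lemma select_Cons [simp]: "select (x # xs) (y # ys) = (if y then x # select xs ys else select xs ys)"
  by (simp add: select_def)

lemma select_Nil [simp]: "select [] ys = []"
  by (simp add: select_def)

lemma set_select_subset: "set (select xs ys) \<subseteq> set xs"
  by (auto simp: select_def dest: set_zip_leftD)

lemma select_all: "select xs (replicate (length xs) True) = xs"
  by (induction xs) auto

lemma length_select: "length xs = length ys \<Longrightarrow> length (select xs ys) = length (filter id ys)"
  by (induction xs ys rule: list_induct2) auto

lemma distinct_select: "distinct xs \<Longrightarrow> distinct (select xs ys)"
proof (induction xs arbitrary: ys)
  case (Cons x xs)
  then show ?case using set_select_subset[of xs] by (cases ys) (auto simp: select_def)
qed simp

lemma map_select: "map h (select xs ys) = select (map h xs) ys"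
  by (simp add: select_def zip_map1 filter_map o_def case_prod_unfold)

lemma distinct_select_pairs:
  assumes "distinct (map fst L @ map snd L)"
  shows "distinct (map fst (select L ys) @ map snd (select L ys))"
  using assms set_select_subset[of L ys]
  by (auto simp: map_select distinct_select) (metis disjoint_iff list.set_map map_select set_select_subset subsetD)

text \<open>A position is moved by at most one of the disjoint swaps, so its value depends on at
  most one bit of \<open>ys\<close> and is affine in it.\<close>

lemma deglt_swaps_select:
  fixes h :: "bool \<Rightarrow> real"
  assumes "length L = N" "distinct (map fst L @ map snd L)"
  shows "deglt N 2 (\<lambda>ys. h (b (swaps (select L ys) v)))"
  using assms
proof (induction N arbitrary: L b)
  case 0
  then show ?case by (simp add: numeral_2_eq_2)
next
  case (Suc N)
  then obtain p q L' where L: "L = (p, q) # L'" by (cases L) auto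
  have L': "length L' = N" "distinct (map fst L' @ map snd L')" using Suc.prems L by auto
  have pq: "p \<notin> fst ` set L'" "p \<notin> snd ` set L'" "q \<notin> fst ` set L'" "q \<notin> snd ` set L'"
    using Suc.prems L by auto
  let ?b = "b \<circ> transposition p q"
  have pq': "swaps (select L' ys) p = p" "swaps (select L' ys) q = q" for ys
    using pq set_select_subset[of L' ys] by (auto intro!: swaps_fixed)
  have sum: "deglt N 2 (\<lambda>ys. h (?b (swaps (select L' ys) v)) + h (b (swaps (select L' ys) v)))"
    by (intro deglt_add Suc.IH L')
  have diff: "deglt N (Suc 0) (\<lambda>ys. h (?b (swaps (select L' ys) v)) - h (b (swaps (select L' ys) v)))"
  proof (cases "v = p \<or> v = q")
    case True
    then have "swaps (select L' ys) v = v" for ys using pq' by auto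
    then show ?thesis by (simp add: deglt_const del: o_apply)
  next
    case False
    then have "swaps (select L' ys) v \<noteq> p" "swaps (select L' ys) v \<noteq> q" for ys
      using pq' inj_swaps[of "select L' ys"] by (metis injD)+
    then have "?b (swaps (select L' ys) v) = b (swaps (select L' ys) v)" for ys by simp
    then show ?thesis by (simp add: deglt_const del: o_apply)
  qed
  show ?case
    using sum diff by (simp add: L numeral_2_eq_2 del: deglt.simps(1))
qed

lemma deglt_signs_swaps:
  assumes "length L = N" "distinct (map fst L @ map snd L)"
  shows "deglt N 2 (\<lambda>ys. real_of_int (signs n (b \<circ> swaps (select L ys)) v))"
proof (cases "v < n")
  case True
  then have "(\<lambda>ys. real_of_int (signs n (b \<circ> swaps (select L ys)) v)) =
      (\<lambda>ys. (\<lambda>c. if c then 1 else -1) (b (swaps (select L ys) v)))"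
    by (auto simp: signs_def)
  then show ?thesis using deglt_swaps_select[OF assms] by simp
qed (simp add: signs_def numeral_2_eq_2 deglt_const)

text \<open>A single loop counter below \<open>n^l\<close> codes an \<open>l\<close>-tuple of
  variables, least significant digit first. So one loop enumerates tuples of any fixed
  length.\<close>

definition digits :: "nat \<Rightarrow> nat \<Rightarrow> nat \<Rightarrow> nat list" where
  "digits n l c = map (\<lambda>j. c div n ^ j mod n) [0..<l]"

lemma length_digits [simp]: "length (digits n l c) = l"
  by (simp add: digits_def)

lemma nth_digits: "j < l \<Longrightarrow> digits n l c ! j = c div n ^ j mod n"
  by (simp add: digits_def)

lemma digits_Suc: "digits n (Suc l) c = (c mod n) # digits n l (c div n)"
  by (rule nth_equalityI) (auto simp: nth_digits nth_Cons div_mult2_eq split: nat.splits)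

lemma bij_betw_digits: "bij_betw (digits n l) {..<n ^ l} {xs. length xs = l \<and> set xs \<subseteq> {..<n}}"
proof -
  let ?X = "{xs. length xs = l \<and> set xs \<subseteq> {..<n}}"
  have surj: "xs \<in> digits n l ` {..<n ^ l}" if "length xs = l" "set xs \<subseteq> {..<n}" for xs
    using that
  proof (induction l arbitrary: xs)
    case 0
    then show ?case by (auto simp: digits_def)
  next
    case (Suc l)
    then obtain x ys where xs: "xs = x # ys" "x < n" "length ys = l" "set ys \<subseteq> {..<n}"
      by (cases xs) auto
    obtain c where c: "c < n ^ l" "digits n l c = ys" using Suc.IH[OF xs(3,4)] by auto
    have "x + n * c < n + n * c" using xs by simp
    also have "\<dots> = n * Suc c" by simp
    also have "\<dots> \<le> n * n ^ l" using c by (intro mult_le_mono) auto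
    finally have "x + n * c < n ^ Suc l" by simp
    moreover have "digits n (Suc l) (x + n * c) = xs" using xs c by (simp add: digits_Suc)
    ultimately show ?case by (metis imageI lessThan_iff)
  qed
  have sub: "digits n l ` {..<n ^ l} \<subseteq> ?X"
  \<comment> \<open>Since \<open>x mod 0 = x\<close>, digits to base 0 are out of range; but for
    \<open>l > 0\<close> there are no codes below \<open>0^l\<close>.\<close>
  proof (cases "n = 0 \<and> l > 0")
    case False
    then show ?thesis by (auto simp: digits_def)
  qed (auto simp: power_0_left)
  have "digits n l ` {..<n ^ l} = ?X" using surj sub by blast
  moreover have "card ?X = card {..<n ^ l}"
    using card_lists_length_eq[of "{..<n}" l] by (simp add: conj_commute)
  ultimately show ?thesis
    by (simp add: bij_betw_def eq_card_imp_inj_on)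
qed

text \<open>The alternating assignment, with one swap if necessary to give \<open>i\<close> and \<open>j\<close> different values.\<close>

definition base_bits :: "nat \<Rightarrow> nat \<Rightarrow> nat \<Rightarrow> bool" where
  "base_bits i j = (if odd i = odd j then odd \<circ> transposition j (j + 1 - 2 * (j mod 2)) else odd)"

definition test_swaps :: "nat \<Rightarrow> nat \<Rightarrow> nat \<Rightarrow> (nat \<times> nat) list" where
  "test_swaps n k c = map (\<lambda>l. (c div n ^ (2 * l) mod n, c div n ^ (2 * l + 1) mod n)) [0..<k]"

definition test_bits :: "nat \<Rightarrow> nat \<Rightarrow> nat \<Rightarrow> nat \<Rightarrow> nat \<Rightarrow> nat \<Rightarrow> bool" where
  "test_bits n k i j c = base_bits i j \<circ> swaps (test_swaps n k c)"

lemma signs_odd_in_slice: "even n \<Longrightarrow> signs n odd \<in> slice {..<n}"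
proof (elim evenE)
  fix m assume "n = 2 * m"
  moreover have "2 * card {v \<in> {..<2 * m}. odd v} = 2 * m"
  proof (induction m)
    case (Suc m)
    have "{v \<in> {..<2 * Suc m}. odd v} = insert (2 * m + 1) {v \<in> {..<2 * m}. odd v}"
      by (auto simp: less_Suc_eq)
    then show ?case using Suc by simp
  qed simp
  ultimately show ?thesis by (simp add: signs_in_slice_iff)
qed

text \<open>The partner is \<open>j\<close> with its last binary digit flipped, which stays below an
  even \<open>n\<close>.\<close>

lemma partner_less: "even n \<Longrightarrow> j < n \<Longrightarrow> j + 1 - 2 * (j mod 2) < (n :: nat)"
  by (cases "even j") (auto simp: odd_iff_mod_2_eq_one elim!: evenE oddE)

lemma signs_base_in_slice: "even n \<Longrightarrow> j < n \<Longrightarrow> signs n (base_bits i j) \<in> slice {..<n}"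
  using slice_transpose[OF signs_odd_in_slice[of n], of j "j + 1 - 2 * (j mod 2)"] partner_less[of n j]
  by (auto simp: base_bits_def signs_transposition signs_odd_in_slice)

text \<open>The corrective swap is made only if \<open>i\<close> and \<open>j\<close> have equal
  parity. It moves \<open>j\<close> and a position of the other parity, hence not
  \<open>i\<close>.\<close>

lemma base_bits_ne: "i \<noteq> j \<Longrightarrow> base_bits i j i \<noteq> base_bits i j j"
  by (cases "even j"; cases "even i")
    (auto simp: base_bits_def Transposition.transpose_def odd_iff_mod_2_eq_one)

text \<open>Shorter lists are padded with the trivial swap of 0 with itself, so testing lists of
  exactly \<open>k\<close> swaps covers all lists of at most \<open>k\<close>.\<close>

lemma exists_test_swaps:
  assumes "length L \<le> k" "\<forall>(p, q)\<in>set L. p < n \<and> q < n" "n > 0"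
  obtains c where "c < n ^ (2 * k)" "swaps (test_swaps n k c) = swaps L"
proof -
  define M where "M = L @ replicate (k - length L) (0, 0)"
  define xs where "xs = concat (map (\<lambda>(p, q). [p, q]) M)"
  have M: "length M = k" "\<forall>(p, q)\<in>set M. p < n \<and> q < n"
    using assms by (auto simp: M_def)
  have gen: "length (concat (map (\<lambda>(p, q). [p, q]) M)) = 2 * length M \<and>
      (\<forall>l<length M. concat (map (\<lambda>(p, q). [p, q]) M) ! (2 * l) = fst (M ! l) \<and>
        concat (map (\<lambda>(p, q). [p, q]) M) ! (2 * l + 1) = snd (M ! l))" for M :: "(nat \<times> nat) list"
    by (induction M) (auto simp: nth_Cons split: nat.splits)
  have "xs \<in> {xs. length xs = 2 * k \<and> set xs \<subseteq> {..<n}}"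
    using gen[of M] M by (auto simp: xs_def)
  then obtain c where c: "c < n ^ (2 * k)" "digits n (2 * k) c = xs"
    unfolding bij_betw_imp_surj_on[OF bij_betw_digits, symmetric] using that by auto
  have "test_swaps n k c = M"
  proof (rule nth_equalityI)
    fix l assume "l < length (test_swaps n k c)"
    then have l: "l < k" by (simp add: test_swaps_def)
    have "xs ! (2 * l) = fst (M ! l)" "xs ! (2 * l + 1) = snd (M ! l)"
      using gen[of M] l M by (auto simp: xs_def)
    then show "test_swaps n k c ! l = M ! l"
      using l nth_digits[of "2 * l" "2 * k" n c] nth_digits[of "2 * l + 1" "2 * k" n c]
      unfolding c(2) by (simp add: test_swaps_def prod_eq_iff)
  qed (simp add: test_swaps_def M)
  then have "swaps (test_swaps n k c) = swaps L"
    by (simp add: M_def swaps_append swaps_replicate)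
  with c(1) that show ?thesis by blast
qed

lemma test_swaps_less: "n > 0 \<Longrightarrow> \<forall>(p, q)\<in>set (test_swaps n k c). p < n \<and> q < n"
  by (auto simp: test_swaps_def)

text \<open>A bisection at which exchanging \<open>i\<close> and \<open>j\<close> matters can be
  made to agree with the base point at \<open>i\<close> and \<open>j\<close>. The swaps connecting
  the two then avoid both positions. Along the cube of subsets of these swaps, the exchange
  difference has degree at most \<open>k\<close>, so it already fails to vanish at a subset of at
  most \<open>k\<close> swaps, which is a test point.\<close>

lemma exchangeable_iff_tests:
  assumes f: "polylt (Suc (Suc k)) f" and "even n" "i < n" "j < n"
  shows "exchangeable f {..<n} i j \<longleftrightarrow>
    (\<forall>c<n ^ (2 * k). f (signs n (test_bits n k i j c \<circ> transposition i j)) = f (signs n (test_bits n k i j c)))"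
proof
  assume ex: "exchangeable f {..<n} i j"
  show "\<forall>c<n ^ (2 * k). f (signs n (test_bits n k i j c \<circ> transposition i j)) = f (signs n (test_bits n k i j c))"
  proof (intro allI impI)
    fix c
    have "signs n (test_bits n k i j c) \<in> slice {..<n}"
      unfolding test_bits_def using assms
      by (intro slice_signs_swaps signs_base_in_slice test_swaps_less) auto
    then show "f (signs n (test_bits n k i j c \<circ> transposition i j)) = f (signs n (test_bits n k i j c))"
      using ex assms by (simp add: signs_transposition exchangeable_def)
  qed
next
  assume tests: "\<forall>c<n ^ (2 * k). f (signs n (test_bits n k i j c \<circ> transposition i j)) = f (signs n (test_bits n k i j c))"
  show "exchangeable f {..<n} i j"
  proof (rule ccontr)
    assume "\<not> exchangeable f {..<n} i j"
    then obtain x where x: "x \<in> slice {..<n}" "f (x \<circ> transposition i j) \<noteq> f x"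
      by (auto simp: exchangeable_def)
    have xne: "x i \<noteq> x j"
    proof
      assume "x i = x j"
      then have "x \<circ> transposition i j = x" by (auto simp: Transposition.transpose_def fun_eq_iff)
      then show False using x(2) by simp
    qed
    then have ij: "i \<noteq> j" by auto
    let ?b0 = "base_bits i j"
    \<comment> \<open>Exchanging \<open>i\<close> and \<open>j\<close> in a witness gives another
      witness. Its values at \<open>i\<close> and \<open>j\<close> differ, as do those of the base
      point, so one of the two witnesses agrees with the base point there.\<close>
    define z where "z = (if (x i = 1) = ?b0 i then x else x \<circ> transposition i j)"
    have z: "z \<in> slice {..<n}" "f (z \<circ> transposition i j) \<noteq> f z"
      using x slice_transpose[OF x(1), of i j] assms by (auto simp: z_def comp_assoc)
    have xv: "x i = 1 \<or> x i = -1" "x j = 1 \<or> x j = -1" using slice_values[OF x(1)] assms by auto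
    have zi: "(z i = 1) = ?b0 i" and zj: "(z j = 1) = ?b0 j"
      using xne xv base_bits_ne[OF ij] by (auto simp: z_def)
    have "2 * card {v \<in> {..<n}. ?b0 v} = n" "2 * card {v \<in> {..<n}. z v = 1} = n"
      using signs_in_slice_iff[of n ?b0] signs_base_in_slice[OF assms(2,4)]
        signs_in_slice_iff[of n "\<lambda>v. z v = 1"] signs_of_slice[OF z(1)] z(1) by auto
    then have "card {v \<in> {..<n}. ?b0 v} = card {v \<in> {..<n}. z v = 1}" by simp
    then obtain L where L: "distinct (map fst L @ map snd L)"
      "fst ` set L \<union> snd ` set L \<subseteq> {v \<in> {..<n}. ?b0 v \<noteq> (z v = 1)}"
      "\<And>v. v < n \<Longrightarrow> (z v = 1) = ?b0 (swaps L v)"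
      by (rule swaps_between) blast
    have Ln: "\<forall>(p, q)\<in>set (select L ys). p < n \<and> q < n" for ys
      using L(2) set_select_subset[of L ys] by fastforce
    have fixed: "swaps (select L ys) i = i" "swaps (select L ys) j = j" for ys
      using L(2) set_select_subset[of L ys] zi zj by (auto intro!: swaps_fixed)
    define y where "y = (\<lambda>ys. signs n (?b0 \<circ> swaps (select L ys)))"
    let ?G = "\<lambda>x. f (x(i := 1, j := -1)) - f (x(i := -1, j := 1))"
    have G: "deglt (length L) (Suc k) (\<lambda>ys. ?G (y ys))"
    proof (rule deglt_polylt[OF polylt_exchange[OF f ij]])
      fix v
      show "deglt (length L) 2 (\<lambda>ys. real_of_int (y ys v))"
        unfolding y_def by (rule deglt_signs_swaps[OF refl L(1)])
    qed
    \<comment> \<open>On the whole cube the values at \<open>i\<close> and \<open>j\<close> are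
      fixed and distinct, so up to sign \<open>?G\<close> compares \<open>f\<close> before and after
      the exchange.\<close>
    have Gy: "?G (y ys) = 0 \<longleftrightarrow> f (y ys) = f (y ys \<circ> transposition i j)" for ys
    proof -
      have yi: "y ys i = (if ?b0 i then 1 else -1)" "y ys j = (if ?b0 j then 1 else -1)"
        using fixed assms by (auto simp: y_def signs_def)
      have "y ys = (y ys)(i := y ys i, j := y ys j)" by simp
      moreover have "y ys \<circ> transposition i j = (y ys)(i := y ys j, j := y ys i)"
        using ij by (auto simp: comp_transpose_eq_upd)
      ultimately show ?thesis using yi base_bits_ne[OF ij] by (cases "?b0 i") auto
    qed
    have "\<forall>ys\<in>cube (length L). ?G (y ys) = 0"
    proof (rule deglt_eq_0[OF G])
      fix ys assume ys: "ys \<in> cube (length L)" "length (filter id ys) < Suc k"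
      then have "length (select L ys) \<le> k" by (simp add: length_select cube_def)
      then obtain c where c: "c < n ^ (2 * k)" "swaps (test_swaps n k c) = swaps (select L ys)"
        using exists_test_swaps[OF _ Ln] assms(3) by (metis gr_zeroI not_less0)
      then have "f (signs n (?b0 \<circ> swaps (select L ys) \<circ> transposition i j)) = f (y ys)"
        using tests by (auto simp: test_bits_def y_def)
      then show "?G (y ys) = 0" unfolding Gy using assms by (simp add: signs_transposition y_def)
    qed
    then have "?G (y (replicate (length L) True)) = 0" by (simp add: cube_def)
    moreover have "y (replicate (length L) True) = z"
    proof -
      have "signs n (?b0 \<circ> swaps L) = signs n (\<lambda>v. z v = 1)"
        by (rule signs_cong) (use L(3) in simp)
      then show ?thesis by (simp add: y_def select_all signs_of_slice[OF z(1)])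
    qed
    ultimately show False using z(2) unfolding Gy by simp
  qed
qed

section \<open>The kernel polynomial\<close>

lemma sum_list_concat: "sum_list (concat xss) = sum_list (map sum_list xss)"
  by (induction xss) auto

lemma subseqs_map: "List.subseqs (map f xs) = map (map f) (List.subseqs xs)"
  by (induction xs) (auto simp: Let_def o_def)

lemma sum_list_subseqs:
  fixes h :: "'a set \<Rightarrow> real"
  assumes "distinct xs"
  shows "(\<Sum>ys\<leftarrow>List.subseqs xs. h (set ys)) = (\<Sum>Y\<in>Pow (set xs). h Y)"
proof -
  have "(\<Sum>ys\<leftarrow>List.subseqs xs. h (set ys)) = sum_list (map h (map set (List.subseqs xs)))" by (simp add: o_def)
  also have "\<dots> = (\<Sum>Y\<in>set (map set (List.subseqs xs)). h Y)"
    using distinct_set_subseqs[OF assms] by (rule sum_list_distinct_conv_sum_set)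
  also have "set (map set (List.subseqs xs)) = Pow (set xs)" by (simp add: subseqs_powset)
  finally show ?thesis .
qed

text \<open>
  Moebius interpolation of \<open>F\<close> from the sets of at most \<open>d\<close> elements, in the variables
  \<open>(1 + x\<^sub>i) / 2\<close>.  The coefficients are never collected: monomials may occur repeatedly in the output.
\<close>

definition terms_at :: "(nat set \<Rightarrow> int) \<Rightarrow> nat list \<Rightarrow> (nat list \<times> int \<times> int) list" where
  "terms_at F T = concat (map (\<lambda>U. map (\<lambda>S. (S, (-1) ^ (length T - length U) * F (set U), 2 ^ length T))
     (List.subseqs T)) (List.subseqs T))"

definition kernel_terms :: "nat \<Rightarrow> nat \<Rightarrow> nat set \<Rightarrow> (nat set \<Rightarrow> int) \<Rightarrow> (nat list \<times> int \<times> int) list" where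
  "kernel_terms n d V F = concat (map (\<lambda>l. concat (map (\<lambda>c.
     if sorted_wrt (<) (digits n l c) \<and> set (digits n l c) \<subseteq> V then terms_at F (digits n l c) else [])
     [0..<n ^ l])) [0..<Suc d])"

definition moebius_sum :: "(nat set \<Rightarrow> real) \<Rightarrow> nat set \<Rightarrow> real" where
  "moebius_sum F X = (\<Sum>U\<in>Pow X. (-1) ^ (card X - card U) * F U)"

text \<open>Moebius inversion on the lattice of subsets. The auxiliary \<open>g\<close> brings it
  into the self-inverse form in which both directions carry the sign
  \<open>(-1)^card\<close>.\<close>

lemma sum_moebius:
  assumes "finite U"
  shows "(\<Sum>T\<in>Pow U. moebius_sum F T) = F U"
proof -
  define g where "g = (\<lambda>S. \<Sum>T\<in>Pow S. (-1) ^ card T * F T)"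
  have "moebius_sum F T = (-1) ^ card T * g T" if "T \<in> Pow U" for T
  proof -
    have T: "finite T" using that assms finite_subset by auto
    have "(-1) ^ (card T - card V) = (-1) ^ card T * (-1 :: real) ^ card V" if "V \<in> Pow T" for V
      using that T by (simp add: card_mono neg_one_power_add_eq_neg_one_power_diff flip: power_add)
    then show ?thesis by (simp add: moebius_sum_def g_def sum_distrib_left mult.assoc)
  qed
  then have "(\<Sum>T\<in>Pow U. moebius_sum F T) = (\<Sum>T\<in>Pow U. (-1) ^ card T * g T)" by simp
  also have "\<dots> = F U"
    using inclusion_exclusion_symmetric[of g F U] assms by (simp add: g_def)
  finally show ?thesis .
qed

lemma mleval_poly_of_terms:
  "mleval (poly_of_terms ts) x = (\<Sum>(S, a, b)\<leftarrow>ts. of_int a / of_int b * (\<Prod>i\<in>set S. of_int (x i)))"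
  unfolding poly_of_terms_def mleval_sum_list
  by (intro arg_cong[where f = sum_list] map_cong) (auto simp: mleval_single)

text \<open>For fixed \<open>U\<close>, the sum over \<open>S\<close> expands the product of the
  \<open>1 + x i\<close> over \<open>T\<close>; the sum over \<open>U\<close> then forms the Moebius
  coefficient.\<close>

lemma sum_list_terms_at:
  assumes "distinct T"
  shows "(\<Sum>(S, a, b)\<leftarrow>terms_at F T. of_int a / of_int b * (\<Prod>i\<in>set S. of_int (x i))) =
    moebius_sum (\<lambda>U. of_int (F U)) (set T) * (\<Prod>i\<in>set T. (1 + real_of_int (x i)) / 2)"
proof -
  have "(\<Sum>(S, a, b)\<leftarrow>terms_at F T. of_int a / of_int b * (\<Prod>i\<in>set S. of_int (x i))) =
      (\<Sum>U\<leftarrow>List.subseqs T. \<Sum>S\<leftarrow>List.subseqs T. (-1) ^ (length T - length U) * of_int (F (set U)) / 2 ^ length T *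
         (\<Prod>i\<in>set S. real_of_int (x i)))"
    by (simp add: terms_at_def sum_list_concat map_concat o_def)
  also have "\<dots> = (\<Sum>U\<leftarrow>List.subseqs T. (-1) ^ (card (set T) - card (set U)) * of_int (F (set U)) *
      (\<Sum>S\<leftarrow>List.subseqs T. (\<Prod>i\<in>set S. real_of_int (x i)) / 2 ^ length T))"
  proof (intro arg_cong[where f = sum_list] map_cong refl)
    fix U assume "U \<in> set (List.subseqs T)"
    then have "length U = card (set U)" "length T = card (set T)"
      using assms subseqs_distinctD[of U T] distinct_card[of U] distinct_card[of T] by simp_all
    then show "(\<Sum>S\<leftarrow>List.subseqs T. (-1) ^ (length T - length U) * of_int (F (set U)) / 2 ^ length T *
         (\<Prod>i\<in>set S. real_of_int (x i))) =
       (-1) ^ (card (set T) - card (set U)) * of_int (F (set U)) *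
      (\<Sum>S\<leftarrow>List.subseqs T. (\<Prod>i\<in>set S. real_of_int (x i)) / 2 ^ length T)"
      by (simp add: sum_list_const_mult[symmetric])
  qed
  also have "\<dots> = (\<Sum>U\<in>Pow (set T). (-1) ^ (card (set T) - card U) * of_int (F U) *
      (\<Sum>S\<in>Pow (set T). (\<Prod>i\<in>S. real_of_int (x i)) / 2 ^ length T))"
    by (subst sum_list_subseqs[OF assms, symmetric])+ (rule refl)
  also have "\<dots> = moebius_sum (\<lambda>U. of_int (F U)) (set T) * ((\<Sum>S\<in>Pow (set T). \<Prod>i\<in>S. real_of_int (x i)) / 2 ^ length T)"
    by (simp add: moebius_sum_def sum_distrib_right sum_divide_distrib)
  also have "(\<Sum>S\<in>Pow (set T). \<Prod>i\<in>S. real_of_int (x i)) = (\<Prod>i\<in>set T. real_of_int (x i) + 1)"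
    by (simp add: prod_add)
  finally show ?thesis
    using distinct_card[OF assms] by (simp add: prod_dividef add.commute)
qed

text \<open>Strictly increasing tuples correspond to sets, so every \<open>X\<close> is visited
  exactly once, at the level given by its size.\<close>

lemma mleval_kernel_terms:
  assumes "V \<subseteq> {..<n}"
  shows "mleval (poly_of_terms (kernel_terms n d V F)) x =
    (\<Sum>X | X \<subseteq> V \<and> card X \<le> d. moebius_sum (\<lambda>U. of_int (F U)) X * (\<Prod>i\<in>X. (1 + real_of_int (x i)) / 2))"
proof -
  have finV: "finite V" using assms finite_subset by blast
  define E where "E = (\<lambda>X. moebius_sum (\<lambda>U. of_int (F U)) X * (\<Prod>i\<in>X. (1 + real_of_int (x i)) / 2))"
  let ?ok = "\<lambda>T. sorted_wrt (<) T \<and> set T \<subseteq> V"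
  let ?ev = "\<lambda>(S, a, b). real_of_int a / of_int b * (\<Prod>i\<in>set S. real_of_int (x i))"
  have block: "(\<Sum>c\<leftarrow>[0..<n ^ l]. sum_list (map ?ev (if ?ok (digits n l c) then terms_at F (digits n l c) else []))) =
      (\<Sum>X | X \<subseteq> V \<and> card X = l. E X)" for l
  proof -
    have "(\<Sum>c\<leftarrow>[0..<n ^ l]. sum_list (map ?ev (if ?ok (digits n l c) then terms_at F (digits n l c) else []))) =
        (\<Sum>c\<leftarrow>[0..<n ^ l]. if ?ok (digits n l c) then E (set (digits n l c)) else 0)"
    proof (intro arg_cong[where f = sum_list] map_cong refl)
      fix c
      show "sum_list (map ?ev (if ?ok (digits n l c) then terms_at F (digits n l c) else [])) =
          (if ?ok (digits n l c) then E (set (digits n l c)) else 0)"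
        using sum_list_terms_at[where T = "digits n l c" and F = F and x = x]
        by (auto simp: E_def strict_sorted_iff)
    qed
    also have "\<dots> = (\<Sum>c\<in>{..<n ^ l}. if ?ok (digits n l c) then E (set (digits n l c)) else 0)"
      by (simp add: interv_sum_list_conv_sum_set_nat atLeast0LessThan)
    also have "\<dots> = (\<Sum>T\<in>{T. length T = l \<and> set T \<subseteq> {..<n}}. if ?ok T then E (set T) else 0)"
      by (rule sum.reindex_bij_betw[OF bij_betw_digits])
    also have "\<dots> = (\<Sum>T\<in>{T \<in> {T. length T = l \<and> set T \<subseteq> {..<n}}. ?ok T}. E (set T))"
      using finite_lists_length_eq[of "{..<n}" l] by (intro sum.inter_filter[symmetric]) (simp add: conj_commute)
    also have "\<dots> = (\<Sum>X | X \<subseteq> V \<and> card X = l. E X)"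
    proof (rule sum.reindex_bij_betw)
      show "bij_betw set {T \<in> {T. length T = l \<and> set T \<subseteq> {..<n}}. ?ok T} {X. X \<subseteq> V \<and> card X = l}"
      proof (rule bij_betw_byWitness[where f' = sorted_list_of_set])
        show "\<forall>T\<in>{T \<in> {T. length T = l \<and> set T \<subseteq> {..<n}}. ?ok T}. sorted_list_of_set (set T) = T"
          by (auto simp: strict_sorted_iff sorted_list_of_set_sort_remdups distinct_remdups_id sorted_sort_id)
        show "\<forall>X\<in>{X. X \<subseteq> V \<and> card X = l}. set (sorted_list_of_set X) = X"
          using finV finite_subset by fastforce
        show "set ` {T \<in> {T. length T = l \<and> set T \<subseteq> {..<n}}. ?ok T} \<subseteq> {X. X \<subseteq> V \<and> card X = l}"
          by (auto simp: strict_sorted_iff distinct_card)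
        show "sorted_list_of_set ` {X. X \<subseteq> V \<and> card X = l} \<subseteq> {T \<in> {T. length T = l \<and> set T \<subseteq> {..<n}}. ?ok T}"
          using assms finV finite_subset by fastforce
      qed
    qed
    finally show ?thesis .
  qed
  have "mleval (poly_of_terms (kernel_terms n d V F)) x =
      (\<Sum>l\<leftarrow>[0..<Suc d]. \<Sum>c\<leftarrow>[0..<n ^ l].
        sum_list (map ?ev (if ?ok (digits n l c) then terms_at F (digits n l c) else [])))"
    unfolding mleval_poly_of_terms kernel_terms_def
    by (simp add: sum_list_concat map_concat o_def del: upt_Suc)
  also have "\<dots> = (\<Sum>l\<leftarrow>[0..<Suc d]. \<Sum>X | X \<subseteq> V \<and> card X = l. E X)"
    unfolding block ..
  also have "\<dots> = (\<Sum>l\<in>{..d}. \<Sum>X | X \<in> {X. X \<subseteq> V \<and> card X \<le> d} \<and> card X = l. E X)"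
    by (simp add: interv_sum_list_conv_sum_set_nat atLeast0LessThan lessThan_Suc_atMost del: upt_Suc)
      (intro sum.cong refl, auto)
  also have "\<dots> = (\<Sum>X | X \<subseteq> V \<and> card X \<le> d. E X)"
    using finV by (intro sum.group) auto
  finally show ?thesis by (simp add: E_def)
qed

lemma set_select: "length ps = length ys \<Longrightarrow> set (select ps ys) = {ps ! k | k. k < length ps \<and> ys ! k}"
  by (auto simp: select_def set_zip image_iff) blast

lemma mem_select:
  assumes "distinct ps" "length ps = length ys" "k < length ps"
  shows "ps ! k \<in> set (select ps ys) \<longleftrightarrow> ys ! k"
proof -
  have "ps ! k \<in> set (select ps ys) \<longleftrightarrow> (\<exists>k'. ps ! k = ps ! k' \<and> k' < length ps \<and> ys ! k')"
    by (simp add: set_select[OF assms(2)])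
  also have "\<dots> \<longleftrightarrow> ys ! k"
  proof
    assume "\<exists>k'. ps ! k = ps ! k' \<and> k' < length ps \<and> ys ! k'"
    then obtain k' where k': "ps ! k = ps ! k'" "k' < length ps" "ys ! k'" by (elim exE conjE)
    then have "k = k'" using nth_eq_iff_index_eq[OF assms(1,3) k'(2)] by simp
    then show "ys ! k" using k'(3) by simp
  qed (use assms(3) in \<open>intro exI[of _ k], simp\<close>)
  finally show ?thesis .
qed

text \<open>The truncated Moebius expansion \<open>Q\<close> has degree at most \<open>d\<close>,
  and it agrees with \<open>G\<close> at all points of weight at most \<open>d\<close>, where
  inversion gives the exact value. By \<open>deglt_eq_0\<close> the two are equal everywhere, in
  particular at the top point.\<close>

lemma interpolation:
  assumes "distinct ps" "deglt (length ps) (Suc d) G"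
    and G: "\<And>ys. ys \<in> cube (length ps) \<Longrightarrow> length (filter id ys) \<le> d \<Longrightarrow> G ys = F (set (select ps ys))"
  shows "G (replicate (length ps) True) = (\<Sum>X | X \<subseteq> set ps \<and> card X \<le> d. moebius_sum F X)"
proof -
  let ?N = "length ps"
  define Q where "Q = (\<lambda>ys. \<Sum>X | X \<subseteq> set ps \<and> card X \<le> d.
    moebius_sum F X * (\<Prod>v\<in>X. of_bool (v \<in> set (select ps ys))))"
  have coord: "deglt ?N 2 (\<lambda>ys. of_bool (v \<in> set (select ps ys)))" if v: "v \<in> set ps" for v
  proof -
    obtain k where k: "k < ?N" "v = ps ! k" using v by (auto simp: in_set_conv_nth)
    have d: "deglt ?N 2 (\<lambda>ys. of_bool (ys ! k))" using deglt_coordinate[OF k(1), of of_bool] .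
    have eq: "of_bool (ys ! k) = (of_bool (v \<in> set (select ps ys)) :: real)" if "ys \<in> cube ?N" for ys
      using mem_select[OF assms(1), of ys k] that k by (simp add: cube_def)
    show ?thesis by (rule iffD1[OF deglt_cong[OF eq] d])
  qed
  have Qval: "Q ys = (\<Sum>X | X \<subseteq> set (select ps ys) \<and> card X \<le> d. moebius_sum F X)" for ys
  proof -
    have "Q ys = (\<Sum>X | X \<subseteq> set ps \<and> card X \<le> d. if X \<subseteq> set (select ps ys) then moebius_sum F X else 0)"
      unfolding Q_def
    proof (rule sum.cong)
      fix X assume "X \<in> {X. X \<subseteq> set ps \<and> card X \<le> d}"
      then have "finite X" using finite_subset by auto
      then show "moebius_sum F X * (\<Prod>v\<in>X. of_bool (v \<in> set (select ps ys))) =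
          (if X \<subseteq> set (select ps ys) then moebius_sum F X else 0)"
        by (cases "X \<subseteq> set (select ps ys)") (auto intro!: prod_zero prod.neutral simp: subset_iff)
    qed simp
    also have "\<dots> = (\<Sum>X | X \<in> {X. X \<subseteq> set ps \<and> card X \<le> d} \<and> X \<subseteq> set (select ps ys). moebius_sum F X)"
      by (subst sum.inter_filter) auto
    also have "{X. X \<in> {X. X \<subseteq> set ps \<and> card X \<le> d} \<and> X \<subseteq> set (select ps ys)} =
        {X. X \<subseteq> set (select ps ys) \<and> card X \<le> d}" using set_select_subset[of ps ys] by auto
    finally show ?thesis .
  qed
  have "deglt ?N (Suc d) Q"
    unfolding Q_def
  proof (intro deglt_sum deglt_cmult)
    fix X assume X: "X \<in> {X. X \<subseteq> set ps \<and> card X \<le> d}"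
    then have "deglt ?N (Suc (card X)) (\<lambda>ys. \<Prod>v\<in>X. of_bool (v \<in> set (select ps ys)))"
      by (intro deglt_prod coord) (auto intro: finite_subset)
    then show "deglt ?N (Suc d) (\<lambda>ys. \<Prod>v\<in>X. of_bool (v \<in> set (select ps ys)))"
      by (rule deglt_mono) (use X in auto)
  qed
  then have "deglt ?N (Suc d) (\<lambda>ys. G ys - Q ys)" by (intro deglt_diff assms(2))
  then have "\<forall>ys\<in>cube ?N. G ys - Q ys = 0"
  proof (rule deglt_eq_0)
    fix ys assume ys: "ys \<in> cube ?N" "length (filter id ys) < Suc d"
    let ?U = "set (select ps ys)"
    have "card ?U \<le> d"
      using ys card_length[of "select ps ys"] by (simp add: length_select cube_def)
    then have "{X. X \<subseteq> ?U \<and> card X \<le> d} = Pow ?U"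
      using card_mono[of ?U] by (auto intro: order_trans)
    then have "Q ys = F ?U" unfolding Qval using sum_moebius[of ?U F] by simp
    then show "G ys - Q ys = 0" using G[of ys] ys by simp
  qed
  then have "G (replicate ?N True) = Q (replicate ?N True)" by (simp add: cube_def)
  then show ?thesis by (simp add: Qval select_all)
qed

section \<open>Partial assignments completed to bisections\<close>

text \<open>
  The assignment that is \<open>1\<^sub>U\<close> on \<open>V\<close> and is completed to a bisection outside \<open>V\<close>.  For \<open>V = {..<n}\<close>
  it is just \<open>1\<^sub>U\<close>, in general not a bisection; then the interpolation recovers \<open>f\<close> everywhere.
\<close>

definition fill :: "nat \<Rightarrow> nat set \<Rightarrow> nat set \<Rightarrow> nat \<Rightarrow> bool" where
  "fill n V U v = (if v \<in> V then v \<in> U else card U + card {w \<in> {..<v}. w \<notin> V} < n div 2)"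

lemma card_rank_less:
  "card {w \<in> {..<n :: nat}. w \<notin> V \<and> card {u \<in> {..<w}. u \<notin> V} < k} = min k (card {w \<in> {..<n}. w \<notin> V})"
proof (induction n)
  case (Suc n)
  have split: "{w \<in> {..<Suc n}. P w} = (if P n then insert n {w \<in> {..<n}. P w} else {w \<in> {..<n}. P w})" for P
    by (auto simp: less_Suc_eq)
  show ?case unfolding split using Suc by auto
qed simp

text \<open>Exactly the first \<open>n div 2 - card U\<close> positions outside \<open>V\<close> are
  set. There are enough of them because at least half of all positions lie outside
  \<open>V\<close>.\<close>

lemma card_fill_outside:
  assumes "card U \<le> n div 2" "2 * card V \<le> n" "V \<subseteq> {..<n}"
  shows "card {w \<in> {..<n}. w \<notin> V \<and> fill n V U w} = n div 2 - card U"
proof -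
  have "{w \<in> {..<n}. w \<notin> V \<and> fill n V U w} =
      {w \<in> {..<n}. w \<notin> V \<and> card {u \<in> {..<w}. u \<notin> V} < n div 2 - card U}"
    by (auto simp: fill_def)
  moreover have "card {w \<in> {..<n}. w \<notin> V} = n - card V"
  proof -
    have "{w \<in> {..<n}. w \<notin> V} = {..<n} - V" by auto
    then show ?thesis using assms(3) by (simp add: card_Diff_subset finite_subset)
  qed
  ultimately show ?thesis using assms card_rank_less[of n V "n div 2 - card U"] by (simp only:) linarith
qed

lemma fill_in_slice:
  assumes "even n" "2 * card V \<le> n" "V \<subseteq> {..<n}" "U \<subseteq> V"
  shows "signs n (fill n V U) \<in> slice {..<n}"
proof -
  have fin: "finite V" "finite U"
    using finite_subset[OF assms(3)] finite_subset[OF assms(4)] by auto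
  have U: "card U \<le> n div 2" using card_mono[OF fin(1) assms(4)] assms(2) by linarith
  have "{v \<in> {..<n}. fill n V U v} = U \<union> {w \<in> {..<n}. w \<notin> V \<and> fill n V U w}"
    using assms(3,4) by (auto simp: fill_def)
  moreover have "card \<dots> = card U + card {w \<in> {..<n}. w \<notin> V \<and> fill n V U w}"
    using assms(4) fin by (intro card_Un_disjoint) auto
  ultimately show ?thesis
    using card_fill_outside[OF U assms(2,3)] U assms(1) by (simp add: signs_in_slice_iff)
qed

text \<open>The swaps leading from \<open>b\<close> to \<open>b'\<close> touch only positions where
  the two differ, hence only positions outside \<open>V\<close>, and each of them preserves the
  value.\<close>

lemma eq_if_exchangeable_outside:
  assumes "\<And>i j. i \<in> {..<n} - V \<Longrightarrow> j \<in> {..<n} - V \<Longrightarrow> exchangeable f {..<n} i j"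
    and "signs n b \<in> slice {..<n}" "signs n b' \<in> slice {..<n}" "\<And>v. v \<in> V \<Longrightarrow> v < n \<Longrightarrow> b v = b' v"
  shows "f (signs n b) = f (signs n b')"
proof -
  have "card {v \<in> {..<n}. b v} = card {v \<in> {..<n}. b' v}"
    using assms(2,3) by (simp add: signs_in_slice_iff)
  then obtain L where L: "fst ` set L \<union> snd ` set L \<subseteq> {v \<in> {..<n}. b v \<noteq> b' v}"
    "\<And>v. v < n \<Longrightarrow> b' v = b (swaps L v)"
    by (rule swaps_between) blast
  have "\<forall>(p, q)\<in>set L. p \<in> {..<n} - V \<and> q \<in> {..<n} - V" using L(1) assms(4) by force
  then have "f (signs n (b \<circ> swaps L)) = f (signs n b)"
    using assms(2)
  proof (induction L arbitrary: b rule: swaps.induct)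
    case (2 p q L)
    have pq: "p < n" "q < n" "exchangeable f {..<n} p q" using 2(2) assms(1) by auto
    have s: "signs n (b \<circ> transposition p q) \<in> slice {..<n}"
      using 2(3) pq slice_transpose by (simp add: signs_transposition)
    have "f (signs n ((b \<circ> transposition p q) \<circ> swaps L)) = f (signs n (b \<circ> transposition p q))"
      using 2(2) by (intro 2(1) s) auto
    also have "\<dots> = f (signs n b)" using pq 2(3) by (simp add: signs_transposition exchangeable_def)
    finally show ?case by (simp only: swaps.simps comp_assoc)
  qed simp
  moreover have "signs n (b \<circ> swaps L) = signs n b'" by (rule signs_cong) (use L(2) in simp)
  ultimately show ?thesis by simp
qed

text \<open>At a bisection \<open>x\<close> the product is the indicator of
  \<open>X \<subseteq> P\<close>, where \<open>P\<close> collects the positive variables in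
  \<open>V\<close>. So the sum is the interpolation formula at the top of the cube of subsets of
  \<open>P\<close>. What remains is a cube of assignments along which \<open>f\<close> has degree at
  most \<open>d\<close> and takes the prescribed values.\<close>

lemma kernel_eval:
  assumes f: "polylt (Suc d) f" and n: "even n" and V: "V \<subseteq> {..<n}" and x: "x \<in> slice {..<n}"
    and cases: "V = {..<n} \<or> 2 * card V \<le> n \<and>
      (\<forall>i\<in>{..<n} - V. \<forall>j\<in>{..<n} - V. exchangeable f {..<n} i j)"
  shows "(\<Sum>X | X \<subseteq> V \<and> card X \<le> d. moebius_sum (\<lambda>U. f (signs n (fill n V U))) X *
    (\<Prod>i\<in>X. (1 + real_of_int (x i)) / 2)) = f x"
proof -
  define P where "P = {v \<in> V. x v = 1}"
  define ps where "ps = sorted_list_of_set P"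
  define F where "F = (\<lambda>U. f (signs n (fill n V U)))"
  let ?N = "length ps"
  have fin: "finite V" using V finite_subset by blast
  then have ps: "distinct ps" "set ps = P" by (simp_all add: ps_def P_def)
  have xV: "x v = 1 \<or> x v = -1" if "v \<in> V" for v using slice_values[OF x] V that by auto
  have "(\<Sum>X | X \<subseteq> V \<and> card X \<le> d. moebius_sum F X * (\<Prod>i\<in>X. (1 + real_of_int (x i)) / 2)) =
      (\<Sum>X | X \<subseteq> V \<and> card X \<le> d. if X \<subseteq> P then moebius_sum F X else 0)"
  proof (rule sum.cong)
    fix X assume X: "X \<in> {X. X \<subseteq> V \<and> card X \<le> d}"
    then have "finite X" using fin finite_subset by auto
    show "moebius_sum F X * (\<Prod>i\<in>X. (1 + real_of_int (x i)) / 2) = (if X \<subseteq> P then moebius_sum F X else 0)"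
    proof (cases "X \<subseteq> P")
      case True
      then have "(\<Prod>i\<in>X. (1 + real_of_int (x i)) / 2) = (\<Prod>i\<in>X. 1)"
        by (intro prod.cong) (auto simp: P_def)
      then show ?thesis using True by simp
    next
      case False
      then obtain i where "i \<in> X" "i \<notin> P" by blast
      then have "x i = -1" using X xV by (auto simp: P_def)
      then have "(\<Prod>i\<in>X. (1 + real_of_int (x i)) / 2) = 0"
        using \<open>finite X\<close> \<open>i \<in> X\<close> by (intro prod_zero) force+
      then show ?thesis using False by simp
    qed
  qed simp
  also have "\<dots> = (\<Sum>X | X \<in> {X. X \<subseteq> V \<and> card X \<le> d} \<and> X \<subseteq> P. moebius_sum F X)"
    using fin by (subst sum.inter_filter) auto
  also have "{X. X \<in> {X. X \<subseteq> V \<and> card X \<le> d} \<and> X \<subseteq> P} = {X. X \<subseteq> set ps \<and> card X \<le> d}"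
    by (auto simp: ps P_def)
  also have "(\<Sum>X | X \<subseteq> set ps \<and> card X \<le> d. moebius_sum F X) = f x"
    using cases
  proof
    \<comment> \<open>Here the cube consists of the indicators of subsets of \<open>P\<close>. They
      need not be bisections, which is harmless since \<open>f\<close> is a polynomial on all
      assignments.\<close>
    assume VI: "V = {..<n}"
    let ?G = "\<lambda>ys. f (signs n (\<lambda>v. v \<in> set (select ps ys)))"
    have "deglt ?N (Suc d) ?G"
    proof (rule deglt_polylt[OF f])
      fix v show "deglt ?N 2 (\<lambda>ys. real_of_int (signs n (\<lambda>v. v \<in> set (select ps ys)) v))"
      proof (cases "v < n \<and> v \<in> set ps")
        case True
        then obtain k where k: "k < ?N" "v = ps ! k" by (auto simp: in_set_conv_nth)
        have d: "deglt ?N 2 (\<lambda>ys. (\<lambda>b. if b then 1 else -1) (ys ! k))" by (rule deglt_coordinate[OF k(1)])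
        have eq: "(\<lambda>b. if b then 1 else -1) (ys ! k) =
            real_of_int (signs n (\<lambda>v. v \<in> set (select ps ys)) v)" if "ys \<in> cube ?N" for ys
          using mem_select[OF ps(1), of ys k] that k True by (simp add: signs_def cube_def)
        show ?thesis by (rule iffD1[OF deglt_cong[OF eq] d])
      next
        case False
        then have "signs n (\<lambda>v. v \<in> set (select ps ys)) v = (if v < n then -1 else undefined)" for ys
          using set_select_subset[of ps ys] by (auto simp: signs_def)
        then show ?thesis by (simp add: numeral_2_eq_2 deglt_const)
      qed
    qed
    from interpolation[OF ps(1) this, of F]
    have "?G (replicate ?N True) = (\<Sum>X | X \<subseteq> set ps \<and> card X \<le> d. moebius_sum F X)"
      by (simp add: F_def fill_def VI signs_def cong: if_cong restrict_cong)
    moreover have "signs n (\<lambda>v. v \<in> P) = x"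
    proof -
      have "signs n (\<lambda>v. v \<in> P) = signs n (\<lambda>v. x v = 1)" by (rule signs_cong) (auto simp: P_def VI)
      then show ?thesis by (simp add: signs_of_slice[OF x])
    qed
    ultimately show ?thesis by (simp add: select_all ps)
  next
    assume "2 * card V \<le> n \<and> (\<forall>i\<in>{..<n} - V. \<forall>j\<in>{..<n} - V. exchangeable f {..<n} i j)"
    then have c: "2 * card V \<le> n" and ex: "\<And>i j. i \<in> {..<n} - V \<Longrightarrow> j \<in> {..<n} - V \<Longrightarrow> exchangeable f {..<n} i j"
      by auto
    let ?base = "fill n V {}"
    define W where "W = {w \<in> {..<n}. w \<notin> V \<and> ?base w}"
    have "card W = n div 2" unfolding W_def using card_fill_outside[of "{}" n V] c V by simp
    moreover have "card P \<le> card V" using fin by (intro card_mono) (auto simp: P_def)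
    ultimately have "card P \<le> card W" using c by linarith
    \<comment> \<open>Every element of \<open>P\<close> gets its own position outside
      \<open>V\<close> that is set in the base assignment. Swapping the two moves a 1 into
      \<open>V\<close> and preserves the balance, so the whole cube consists of bisections.\<close>
    then obtain W' where W': "W' \<subseteq> W" "card W' = card P"
      by (rule obtain_subset_with_card_n)
    define ws where "ws = sorted_list_of_set W'"
    have "finite W'" using W'(1) by (rule finite_subset) (simp add: W_def)
    then have ws: "distinct ws" "set ws = W'" "length ws = ?N"
      using W'(2) ps distinct_card[of ps] by (simp_all add: ws_def)
    define L where "L = zip ps ws"
    have L: "map fst L = ps" "map snd L = ws" "length L = ?N" using ws by (simp_all add: L_def)
    have dL: "distinct (map fst L @ map snd L)"
      unfolding L using ps ws W' by (auto simp: P_def W_def)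
    have sel: "set (select ps ys) = fst ` set (select L ys)" "snd ` set (select L ys) \<subseteq> W" for ys
      using map_select[of fst L ys] map_select[of snd L ys] L set_select_subset[of ws ys] ws W'
      by (metis set_map, metis set_map subset_trans)
    let ?mix = "\<lambda>ys. ?base \<circ> swaps (select L ys)"
    let ?G = "\<lambda>ys. f (signs n (?mix ys))"
    have bV: "?mix ys v \<longleftrightarrow> v \<in> set (select ps ys)" if v: "v \<in> V" for ys v
    proof (cases "v \<in> set (select ps ys)")
      case True
      then obtain q where q: "(v, q) \<in> set (select L ys)" using sel(1) by force
      then have "swaps (select L ys) v = q"
        using swaps_fst[OF distinct_select_pairs[OF dL]] by blast
      moreover have "q \<in> W" using q sel(2) by force
      ultimately show ?thesis using True by (simp add: W_def)
    next
      case False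
      then have "v \<notin> fst ` set (select L ys)" "v \<notin> snd ` set (select L ys)"
        using sel[of ys] v by (auto simp: W_def)
      then show ?thesis using False v by (simp add: swaps_fixed fill_def)
    qed
    have slice: "signs n (?mix ys) \<in> slice {..<n}" for ys
    proof (rule slice_signs_swaps)
      show "signs n ?base \<in> slice {..<n}" using fill_in_slice[OF n c V] by simp
      have "p < n \<and> q < n" if "(p, q) \<in> set (select L ys)" for p q
      proof -
        have "p \<in> set ps" "q \<in> W" using that sel[of ys] set_select_subset[of ps ys] by force+
        then show ?thesis using V ps by (auto simp: P_def W_def)
      qed
      then show "\<forall>(p, q)\<in>set (select L ys). p < n \<and> q < n" by blast
    qed
    have "deglt ?N (Suc d) ?G"
    proof (rule deglt_polylt[OF f])
      fix v show "deglt ?N 2 (\<lambda>ys. real_of_int (signs n (?mix ys) v))"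
        by (rule deglt_signs_swaps[OF L(3) dL])
    qed
    then have "?G (replicate ?N True) = (\<Sum>X | X \<subseteq> set ps \<and> card X \<le> d. moebius_sum F X)"
    proof (rule interpolation[OF ps(1)])
      fix ys show "?G ys = F (set (select ps ys))"
        unfolding F_def
      proof (rule eq_if_exchangeable_outside[OF ex slice])
        have "set (select ps ys) \<subseteq> V" using set_select_subset[of ps ys] ps by (auto simp: P_def)
        then show "signs n (fill n V (set (select ps ys))) \<in> slice {..<n}"
          by (rule fill_in_slice[OF n c V])
        show "?mix ys v = fill n V (set (select ps ys)) v" if "v \<in> V" for v
          using bV[OF that] that by (simp add: fill_def)
      qed
    qed
    moreover have "?G (replicate ?N True) = f (signs n (\<lambda>v. x v = 1))"
    proof (rule eq_if_exchangeable_outside[OF ex slice])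
      show "signs n (\<lambda>v. x v = 1) \<in> slice {..<n}" using signs_of_slice[OF x] x by simp
      show "?mix (replicate ?N True) v = (x v = 1)" if "v \<in> V" for v
        using bV[OF that, of "replicate ?N True"] that by (simp add: select_all ps P_def)
    qed
    ultimately show ?thesis by (simp add: signs_of_slice[OF x])
  qed
  finally show ?thesis by (simp add: F_def)
qed

section \<open>The answer of the algorithm\<close>

lemma polylt_sum_list: "(\<And>C. C \<in> set Cs \<Longrightarrow> polylt d (F C)) \<Longrightarrow> polylt d (\<lambda>x. \<Sum>C\<leftarrow>Cs. F C x)"
  by (induction Cs) (auto intro: polylt_zero polylt_add)

lemma polylt_csp_poly: "polylt (Suc d) (mleval (csp_poly d Cs))"
proof -
  have "polylt (Suc d) (\<lambda>x. \<Sum>C\<leftarrow>Cs. \<Sum>\<sigma>\<in>snd C. \<Sum>J\<in>Pow {..<d}.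
      (1 / 2 ^ d) * (\<Prod>j\<in>J. of_int (\<sigma> ! j)) * (\<Prod>i\<in>monomial_of (fst C) J. of_int (x i)))"
  proof (intro polylt_sum_list polylt_sum polylt_monomial)
    fix C :: constraint and J assume "J \<in> Pow {..<d}"
    then have J: "finite J" "card J \<le> d" using finite_subset card_mono[of "{..<d}" J] by auto
    have sub: "monomial_of (fst C) J \<subseteq> (!) (fst C) ` J" by (auto simp: monomial_of_def)
    then show "finite (monomial_of (fst C) J)" using J finite_subset by blast
    have "card (monomial_of (fst C) J) \<le> card ((!) (fst C) ` J)" using sub J by (intro card_mono) auto
    also have "\<dots> \<le> d" using J card_image_le le_trans by blast
    finally show "card (monomial_of (fst C) J) < Suc d" by simp
  qed
  moreover have "mleval (csp_poly d Cs) = (\<lambda>x. \<Sum>C\<leftarrow>Cs. \<Sum>\<sigma>\<in>snd C. \<Sum>J\<in>Pow {..<d}.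
      (1 / 2 ^ d) * (\<Prod>j\<in>J. of_int (\<sigma> ! j)) * (\<Prod>i\<in>monomial_of (fst C) J. of_int (x i)))"
    by (simp add: csp_poly_def mleval_sum_list constraint_poly_def mleval_sum mleval_single fun_eq_iff)
  ultimately show ?thesis by simp
qed

lemma keys_poly_of_terms:
  "Poly_Mapping.keys (poly_of_terms ts) \<subseteq> set ` fst ` set ts"
proof (induction ts)
  case (Cons t ts)
  obtain S a b where t: "t = (S, a, b)" by (cases t)
  have "Poly_Mapping.keys (poly_of_terms (t # ts)) \<subseteq>
      Poly_Mapping.keys (Poly_Mapping.single (set S) (real_of_int a / of_int b)) \<union>
      Poly_Mapping.keys (poly_of_terms ts)"
    using Poly_Mapping.keys_add[of "Poly_Mapping.single (set S) (real_of_int a / real_of_int b)" "poly_of_terms ts"]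
    by (simp add: poly_of_terms_def t)
  also have "\<dots> \<subseteq> insert (set S) (set ` fst ` set ts)" using Cons by (auto split: if_splits)
  finally show ?case by (simp add: t)
qed (simp add: poly_of_terms_def)

lemma kernel_terms_wf:
  assumes "(S, a, b) \<in> set (kernel_terms n d V F)"
  shows "distinct S" "b > 0" "set S \<subseteq> V" "length S \<le> d"
proof -
  obtain l c where lc: "l \<le> d" "sorted_wrt (<) (digits n l c)" "set (digits n l c) \<subseteq> V"
    "(S, a, b) \<in> set (terms_at F (digits n l c))"
    using assms by (fastforce simp: kernel_terms_def less_Suc_eq_le simp del: upt_Suc split: if_splits)
  then have S: "S \<in> set (List.subseqs (digits n l c))" and b: "b = 2 ^ l"
    by (auto simp: terms_at_def)
  show "distinct S" using S lc(2) subseqs_distinctD by (auto simp: strict_sorted_iff)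
  show "b > 0" using b by simp
  have sub: "set S \<subseteq> set (digits n l c)" using S subseqs_powset[of "digits n l c"] by blast
  then show "set S \<subseteq> V" using lc by auto
  have "length S = card (set S)" using \<open>distinct S\<close> by (simp add: distinct_card)
  also have "\<dots> \<le> card (set (digits n l c))" using sub by (intro card_mono) auto
  also have "\<dots> \<le> d" using card_length[of "digits n l c"] lc(1) by simp
  finally show "length S \<le> d" .
qed

section \<open>Choice of the kernel variables\<close>

definition split_count :: "((nat \<Rightarrow> int) \<Rightarrow> real) \<Rightarrow> nat \<Rightarrow> nat \<Rightarrow> nat" where
  "split_count f n i = card {j \<in> {..<n}. \<not> exchangeable f {..<n} i j}"

text \<open>A variable is dropped only if \<open>n > K\<close> and its class misses at most
  \<open>K / 2\<close> variables, so each variable is decided by its own count. With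
  \<open>K / 2\<close> instead of \<open>K\<close> the dropped class is unique and contains at least
  half of the variables.\<close>

definition kernel_vars :: "((nat \<Rightarrow> int) \<Rightarrow> real) \<Rightarrow> nat \<Rightarrow> nat \<Rightarrow> nat set" where
  "kernel_vars f n K = {i \<in> {..<n}. n \<le> K \<or> K < 2 * split_count f n i}"

definition csp_answer :: "nat \<Rightarrow> nat \<Rightarrow> constraint list \<Rightarrow> nat \<Rightarrow> answer" where
  "csp_answer d n Cs t =
     (let K = kernel_const d * t ^ 2; V = kernel_vars (mleval (csp_poly d Cs)) n K in
      if card V \<le> K
      then Kernel (sorted_list_of_set V)
             (kernel_terms n d V (\<lambda>U. int (csp_val Cs (signs n (fill n V U)))))
      else Certified)"

lemma split_count_eq_card_Diff:
  "split_count f n i = n - card {j \<in> {..<n}. exchangeable f {..<n} i j}"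
proof -
  have "{j \<in> {..<n}. \<not> exchangeable f {..<n} i j} = {..<n} - {j \<in> {..<n}. exchangeable f {..<n} i j}"
    by auto
  moreover have "card ({..<n} - {j \<in> {..<n}. exchangeable f {..<n} i j}) =
      card {..<n} - card {j \<in> {..<n}. exchangeable f {..<n} i j}"
    by (rule card_Diff_subset) auto
  ultimately show ?thesis by (simp only: split_count_def card_lessThan)
qed

text \<open>Distinct classes are disjoint, so their two complements together have at least
  \<open>n > K\<close> elements and cannot both have at most \<open>K / 2\<close>. Hence either
  nothing is dropped or exactly one class is.\<close>

lemma kernel_vars_cases:
  assumes "n > K"
  shows "kernel_vars f n K = {..<n} \<and> (\<forall>i<n. K < 2 * split_count f n i) \<or>
    2 * card (kernel_vars f n K) \<le> K \<and>
    (\<forall>i\<in>{..<n} - kernel_vars f n K. \<forall>j\<in>{..<n} - kernel_vars f n K. exchangeable f {..<n} i j)"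
proof (cases "\<forall>i<n. K < 2 * split_count f n i")
  case True
  then show ?thesis by (auto simp: kernel_vars_def)
next
  case False
  then obtain i where i: "i < n" "2 * split_count f n i \<le> K" by (auto simp: not_less)
  let ?cl = "\<lambda>i. {j \<in> {..<n}. exchangeable f {..<n} i j}"
  have card_cl: "card (?cl i) \<le> n" for i using card_mono[of "{..<n}" "?cl i"] by auto
  have "j \<in> kernel_vars f n K \<longleftrightarrow> \<not> exchangeable f {..<n} i j" if j: "j < n" for j
  proof (cases "exchangeable f {..<n} i j")
    case True
    then have "?cl j = ?cl i"
      using exchangeable_trans[of f "{..<n}"] exchangeable_sym[of f "{..<n}"] i j by blast
    then have "split_count f n j = split_count f n i" by (simp only: split_count_eq_card_Diff)
    then show ?thesis using True i j assms by (simp add: kernel_vars_def)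
  next
    case ne: False
    have "?cl i \<inter> ?cl j = {}"
      using exchangeable_trans[of f "{..<n}" i _ j] exchangeable_sym[of f "{..<n}"] i j ne by blast
    then have "card (?cl i) + card (?cl j) = card (?cl i \<union> ?cl j)" by (subst card_Un_disjoint) auto
    also have "\<dots> \<le> n" using card_mono[of "{..<n}" "?cl i \<union> ?cl j"] by auto
    finally have "n \<le> split_count f n i + split_count f n j"
      using card_cl[of i] card_cl[of j] by (simp add: split_count_eq_card_Diff)
    then have "K < 2 * split_count f n j" using i assms by linarith
    then show ?thesis using ne j by (simp add: kernel_vars_def)
  qed
  then have V: "kernel_vars f n K = {j \<in> {..<n}. \<not> exchangeable f {..<n} i j}"
    by (auto simp: kernel_vars_def)
  then have "2 * card (kernel_vars f n K) \<le> K" using i(2) by (simp add: split_count_def)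
  moreover have "exchangeable f {..<n} j k"
    if "j \<in> {..<n} - kernel_vars f n K" "k \<in> {..<n} - kernel_vars f n K" for j k
    using that exchangeable_trans[of f "{..<n}" j i k] exchangeable_sym[of f "{..<n}"] i(1) unfolding V by auto
  ultimately show ?thesis by blast
qed

lemma csp_answer_correct:
  assumes d: "d \<ge> 1" and n: "even n" and Cs: "csp_instance d n Cs"
  shows "correct_answer d n Cs t (csp_answer d n Cs t)"
proof -
  define f where "f = mleval (csp_poly d Cs)"
  define K where "K = kernel_const d * t ^ 2"
  define V where "V = kernel_vars f n K"
  define F where "F = (\<lambda>U. int (csp_val Cs (signs n (fill n V U))))"
  have f: "polylt (Suc d) f" unfolding f_def by (rule polylt_csp_poly)
  have val: "f x = real (csp_val Cs x)" if "x \<in> assignments n" for x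
    unfolding f_def using mleval_csp_poly[OF Cs that] .
  have Vn: "V \<subseteq> {..<n}" by (auto simp: V_def kernel_vars_def)
  have ans: "csp_answer d n Cs t =
      (if card V \<le> K then Kernel (sorted_list_of_set V) (kernel_terms n d V F) else Certified)"
    by (simp add: csp_answer_def V_def F_def K_def f_def Let_def)
  show ?thesis
  proof (cases "card V \<le> K")
    case True
    have cases: "V = {..<n} \<or> 2 * card V \<le> n \<and>
        (\<forall>i\<in>{..<n} - V. \<forall>j\<in>{..<n} - V. exchangeable f {..<n} i j)"
    proof (cases "n \<le> K")
      case True
      then show ?thesis by (auto simp: V_def kernel_vars_def)
    next
      case False
      then show ?thesis using kernel_vars_cases[of K n f] by (auto simp: V_def)
    qed
    have finV: "finite V" using Vn finite_subset by blast
    have "mleval (poly_of_terms (kernel_terms n d V F)) \<alpha> = mleval (csp_poly d Cs) \<alpha>"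
      if "\<alpha> \<in> bisections n" for \<alpha>
    proof -
      have "real_of_int (F U) = f (signs n (fill n V U))" for U
        by (simp add: F_def val signs_in_assignments)
      then show ?thesis
        using kernel_eval[OF f n Vn _ cases, of \<alpha>] that
        by (simp add: mleval_kernel_terms[OF Vn] bisections_eq_slice f_def)
    qed
    moreover have keys: "finite X \<and> card X \<le> d \<and> X \<subseteq> V"
      if X: "X \<in> Poly_Mapping.keys (poly_of_terms (kernel_terms n d V F))" for X
    proof -
      obtain S a b where "X = set S" "(S, a, b) \<in> set (kernel_terms n d V F)"
        using subsetD[OF keys_poly_of_terms X] by auto
      then show ?thesis using kernel_terms_wf[of S a b n d V F] by (simp add: distinct_card)
    qed
    then have "degree_at_most d (poly_of_terms (kernel_terms n d V F))"
      "depends_only_on V (poly_of_terms (kernel_terms n d V F))"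
      by (simp_all add: degree_at_most_def depends_only_on_def)
    ultimately show ?thesis
      using True finV Vn kernel_terms_wf[of _ _ _ n d V F]
      by (auto simp: ans is_kernel_def K_def)
  next
    case False
    have "card V \<le> n" using card_mono[OF _ Vn] by simp
    then have nK: "n > K" using False by linarith
    then have cnt: "K < 2 * split_count f n i" if "i < n" for i
      using kernel_vars_cases[OF nK, of f] False that by (auto simp: V_def)
    define v where "v = Min (split_count f n ` {..<n})"
    obtain N where N: "n = 2 * N" using n by blast
    have N0: "N > 0" using nK N by auto
    have "v \<in> split_count f n ` {..<n}" unfolding v_def using nK by (intro Min_in) auto
    then obtain i0 where i0: "i0 < n" "split_count f n i0 = v" by auto
    have v_le: "v \<le> split_count f n i" if "i < n" for i unfolding v_def using that by (intro Min_le) auto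
    have vK: "K < 2 * v" using cnt[OF i0(1)] i0(2) by simp
    obtain d' where d': "d = Suc d'" using d by (cases d) auto
    define m where "m = card (slice {..<n})"
    have ne: "slice {..<n} \<noteq> {}" using signs_odd_in_slice[OF n] by blast
    have "\<exists>x\<in>slice {..<2 * N}. (\<Sum>x\<in>slice {..<2 * N}. f x) / card (slice {..<2 * N}) +
        sqrt v / (2 * sqrt (Suc d') * 12 ^ Suc d') \<le> f x"
    proof (rule exists_above_mean[OF N0])
      show "v > 0" using vK by simp
      show "polylt (Suc (Suc d')) f" using f d' by simp
      show "f x \<in> \<int>" if "x \<in> slice {..<2 * N}" for x
        using val[of x] that N by (simp add: slice_def assignments_def)
      show "v \<le> card {j \<in> {..<2 * N}. \<not> exchangeable f {..<2 * N} i j}" if "i < 2 * N" for i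
        using v_le[of i] that by (simp add: split_count_def N)
      show "i0 < 2 * N" "card {j \<in> {..<2 * N}. \<not> exchangeable f {..<2 * N} i0 j} = v"
        using i0 by (simp_all add: split_count_def N)
    qed
    then obtain x where x: "x \<in> slice {..<n}"
      "(\<Sum>x\<in>slice {..<n}. f x) / m + sqrt v / (2 * sqrt d * 12 ^ d) \<le> f x"
      unfolding N[symmetric] d'[symmetric] m_def by blast
    have "AVG n Cs = (\<Sum>x\<in>slice {..<n}. real (csp_val Cs x)) / m"
      unfolding AVG_def bisections_eq_slice m_def using ne
      by (subst integral_pmf_of_set) auto
    also have "\<dots> = (\<Sum>x\<in>slice {..<n}. f x) / m"
      by (intro arg_cong[where f = "\<lambda>s. s / _"] sum.cong refl) (auto simp: val slice_def assignments_def)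
    finally have avg: "AVG n Cs = (\<Sum>x\<in>slice {..<n}. f x) / m" .
    \<comment> \<open>From \<open>v > K / 2\<close> and \<open>K >= 8 d 144^d t^2\<close> follows
      \<open>v >= (2 sqrt d 12^d t)^2\<close>. The constant suffices since
      \<open>7 * 9 * 4 = 252\<close> is at least \<open>144 = 12^2\<close>, and
      \<open>24 d^2\<close> is at least \<open>8 d\<close>.\<close>
    have "real t \<le> sqrt v / (2 * sqrt d * 12 ^ d)"
    proof -
      have h1: "(1::nat) \<le> (\<Prod>i = 2..d. fact i) ^ 2"
        by (intro one_le_power prod_ge_1) (rule fact_ge_1)
      have h2: "(144::nat) ^ d \<le> 7 ^ d * 9 ^ d * 2 ^ (2 * d)"
      proof -
        have "7 ^ d * 9 ^ d * 2 ^ (2 * d) = (252::nat) ^ d"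
          by (simp add: power_mult flip: power_mult_distrib)
        then show ?thesis by (simp add: power_mono)
      qed
      have h3: "8 * d \<le> 24 * d ^ 2" by (simp add: power2_eq_square)
      have h4: "8 * d * 144 ^ d * 1 \<le> 24 * d ^ 2 * (7 ^ d * 9 ^ d * 2 ^ (2 * d)) * (\<Prod>i = 2..d. fact i) ^ 2"
        by (rule mult_le_mono[OF mult_le_mono[OF h3 h2] h1])
      have "8 * d * 144 ^ d * t ^ 2 \<le> K"
        using mult_le_mono1[OF h4, of "t ^ 2"] by (simp only: K_def kernel_const_def mult.assoc mult_1_left mult_1_right)
      then have "4 * d * 144 ^ d * t ^ 2 \<le> v" using vK by linarith
      then have "real (4 * d * 144 ^ d * t ^ 2) \<le> real v" by (rule of_nat_mono)
      moreover have "real (4 * d * 144 ^ d * t ^ 2) = (2 * sqrt d * 12 ^ d * t)\<^sup>2"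
      proof -
        have "(144::real) ^ d = 12 ^ d * 12 ^ d" by (simp flip: power_mult_distrib)
        moreover have "real d = sqrt d * sqrt d" by simp
        ultimately show ?thesis by (simp add: power2_eq_square del: real_sqrt_mult_self)
      qed
      ultimately have "2 * sqrt d * 12 ^ d * t \<le> sqrt v" by (simp add: real_le_rsqrt)
      then show ?thesis using d by (simp add: field_simps)
    qed
    then have "AVG n Cs + t \<le> f x" using x(2) avg by linarith
    also have "f x = real (csp_val Cs x)" using x(1) by (intro val) (auto simp: slice_def assignments_def)
    also have "csp_val Cs x \<le> OPT n Cs"
      unfolding OPT_def bisections_eq_slice using x(1) by (intro Max_ge) auto
    finally have "AVG n Cs + real t \<le> real (OPT n Cs)" by simp
    then show ?thesis using False by (simp add: ans)
  qed
qed

section \<open>Reasoning about programs\<close>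

text \<open>Total correctness with a step bound. An upper bound, unlike an exact count, lets
  branches of different length share one estimate. As execution is deterministic, the run whose
  existence is claimed is the only one.\<close>

definition runs :: "int \<Rightarrow> com \<Rightarrow> state \<Rightarrow> nat \<Rightarrow> (state \<Rightarrow> bool) \<Rightarrow> bool" where
  "runs W c s T Q \<longleftrightarrow> (\<exists>t s'. exec W c s t s' \<and> t \<le> T \<and> Q s')"

lemma runs_weaken:
  "runs W c s T Q \<Longrightarrow> (\<And>s'. Q s' \<Longrightarrow> Q' s') \<Longrightarrow> T \<le> T' \<Longrightarrow> runs W c s T' Q'"
  unfolding runs_def by (meson le_trans)

lemma runs_Skip: "Q s \<Longrightarrow> runs W Skip s 1 Q"
  unfolding runs_def by (meson exec.Skip order_refl)

lemma runs_Assign: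
  "\<bar>aval a s\<bar> \<le> W \<Longrightarrow> Q (s\<lparr>regs := (regs s)(r := aval a s)\<rparr>) \<Longrightarrow> runs W (Assign r a) s 1 Q"
  unfolding runs_def using exec.Assign by blast

lemma runs_Store:
  "\<bar>aval a s\<bar> \<le> W \<Longrightarrow> Q (s\<lparr>arrs := (arrs s)(A := (arrs s A)(aval i s := aval a s))\<rparr>) \<Longrightarrow>
    runs W (Store A i a) s 1 Q"
  unfolding runs_def using exec.Store by blast

lemma runs_Seq:
  assumes "runs W c s T1 Q1" "\<And>s'. Q1 s' \<Longrightarrow> runs W c' s' T2 Q"
  shows "runs W (Seq c c') s (T1 + T2) Q"
proof -
  obtain t s' where 1: "exec W c s t s'" "t \<le> T1" "Q1 s'" using assms(1) by (auto simp: runs_def)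
  obtain t' s'' where 2: "exec W c' s' t' s''" "t' \<le> T2" "Q s''"
    using assms(2)[OF 1(3)] by (auto simp: runs_def)
  show ?thesis
    unfolding runs_def using exec.Seq[OF 1(1) 2(1)] 1(2) 2(2,3) add_le_mono by blast
qed

lemma runs_Cond:
  assumes "bval b s \<Longrightarrow> runs W c s T Q" "\<not> bval b s \<Longrightarrow> runs W c' s T Q"
  shows "runs W (Cond b c c') s (Suc T) Q"
proof (cases "bval b s")
  case True
  then show ?thesis using assms(1) unfolding runs_def by (meson exec.CondTrue Suc_le_mono)
next
  case False
  then show ?thesis using assms(2) unfolding runs_def by (meson exec.CondFalse Suc_le_mono)
qed

definition For :: "nat \<Rightarrow> aexp \<Rightarrow> com \<Rightarrow> com" where
  "For r e c = Seq (Assign r (Lit 0)) (While (Less (Reg r) e) (Seq c (Assign r (Plus (Reg r) (Lit 1)))))"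

text \<open>The limit \<open>e\<close> is evaluated anew in every round, so the invariant has to fix
  its value. Each round pays 2 for the test and the increment; the final 2 are the initial
  assignment and the last, failing test.\<close>

lemma runs_For:
  assumes init: "I 0 (s\<lparr>regs := (regs s)(r := 0)\<rparr>)"
    and bound: "\<And>i s. I i s \<Longrightarrow> i \<le> N \<Longrightarrow> regs s r = int i \<and> aval e s = int N"
    and step: "\<And>i s. i < N \<Longrightarrow> I i s \<Longrightarrow>
      runs W c s T (\<lambda>s'. regs s' r = int i \<and> I (Suc i) (s'\<lparr>regs := (regs s')(r := int (Suc i))\<rparr>))"
    and W: "int N \<le> W"
  shows "runs W (For r e c) s (N * (T + 2) + 2) (I N)"
proof -
  let ?b = "Seq c (Assign r (Plus (Reg r) (Lit 1)))"
  let ?w = "While (Less (Reg r) e) ?b"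
  have loop: "runs W ?w s (k * (T + 2) + 1) (I N)" if "k \<le> N" "I (N - k) s" for k s
    using that
  proof (induction k arbitrary: s)
    case 0
    have "\<not> bval (Less (Reg r) e) s" using bound[OF 0(2)] by simp
    then show ?case unfolding runs_def using 0 exec.WhileFalse by force
  next
    case (Suc k)
    let ?i = "N - Suc k"
    have i: "?i < N" "Suc ?i = N - k" using Suc.prems(1) by auto
    have b: "bval (Less (Reg r) e) s" using bound[OF Suc.prems(2)] i by simp
    have "runs W ?b s (T + 1) (I (N - k))"
    proof (rule runs_Seq[OF step[OF i(1) Suc.prems(2)]])
      fix s' assume s': "regs s' r = int ?i \<and> I (Suc ?i) (s'\<lparr>regs := (regs s')(r := int (Suc ?i))\<rparr>)"
      have "int ?i + 1 = int (Suc ?i)" by simp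
      then show "runs W (Assign r (Plus (Reg r) (Lit 1))) s' 1 (I (N - k))"
        using s' i W by (intro runs_Assign) auto
    qed
    then obtain t s' where 1: "exec W ?b s t s'" "t \<le> T + 1" "I (N - k) s'" by (auto simp: runs_def)
    obtain t' s'' where 2: "exec W ?w s' t' s''" "t' \<le> k * (T + 2) + 1" "I N s''"
      using Suc.IH[OF _ 1(3)] Suc.prems(1) by (auto simp: runs_def)
    have "exec W ?w s (Suc (t + t')) s''" by (rule exec.WhileTrue[OF b 1(1) 2(1)])
    then show ?case unfolding runs_def using 1(2) 2(2,3) by fastforce
  qed
  have "runs W (For r e c) s (1 + (N * (T + 2) + 1)) (I N)"
    unfolding For_def
  proof (rule runs_Seq)
    show "runs W (Assign r (Lit 0)) s 1 (I 0)" using init W by (intro runs_Assign) auto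
    show "runs W ?w s' (N * (T + 2) + 1) (I N)" if "I 0 s'" for s'
      using loop[of N s'] that by simp
  qed
  then show ?thesis by (simp add: add.commute)
qed

fun Seqs :: "com list \<Rightarrow> com" where
  "Seqs [] = Skip"
| "Seqs (c # cs) = Seq c (Seqs cs)"

lemma runs_Seqs:
  assumes "I 0 s"
    and "\<And>i s. i < length cs \<Longrightarrow> I i s \<Longrightarrow> runs W (cs ! i) s T (I (Suc i))"
  shows "runs W (Seqs cs) s (length cs * T + 1) (I (length cs))"
  using assms
proof (induction cs arbitrary: I s)
  case Nil
  then show ?case using runs_Skip[of "I 0" s W] by simp
next
  case (Cons c cs)
  have "runs W (Seq c (Seqs cs)) s (T + (length cs * T + 1)) (I (Suc (length cs)))"
  proof (rule runs_Seq)
    show "runs W c s T (I 1)" using Cons.prems(2)[of 0] Cons.prems(1) by simp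
    show "runs W (Seqs cs) s' (length cs * T + 1) (I (Suc (length cs)))" if "I 1 s'" for s'
      using Cons.IH[of "\<lambda>i. I (Suc i)" s'] that Cons.prems(2)[of "Suc _"] by simp
  qed
  then show ?case by (simp add: add.assoc)
qed

text \<open>A frame condition: \<open>R\<close> and \<open>A\<close> list the registers and arrays
  that may have changed.\<close>

definition same :: "nat set \<Rightarrow> nat set \<Rightarrow> state \<Rightarrow> state \<Rightarrow> bool" where
  "same R A s s' \<longleftrightarrow> (\<forall>r. r \<notin> R \<longrightarrow> regs s' r = regs s r) \<and> (\<forall>a. a \<notin> A \<longrightarrow> arrs s' a = arrs s a)"

lemma same_refl [simp]: "same R A s s"
  by (simp add: same_def)

lemma same_trans: "same R A s s' \<Longrightarrow> same R' A' s' s'' \<Longrightarrow> R \<subseteq> R'' \<Longrightarrow> R' \<subseteq> R'' \<Longrightarrow> A \<subseteq> A'' \<Longrightarrow> A' \<subseteq> A'' \<Longrightarrow> same R'' A'' s s''"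
  unfolding same_def by (metis subsetD)

lemma same_upd_arr [simp]: "a \<in> A \<Longrightarrow> same R A s (s'\<lparr>arrs := (arrs s')(a := x)\<rparr>) \<longleftrightarrow> same R A s s'"
  by (auto simp: same_def)

section \<open>Expressions of constant size\<close>

fun sum_aexp :: "aexp list \<Rightarrow> aexp" where
  "sum_aexp [] = Lit 0"
| "sum_aexp (e # es) = Plus e (sum_aexp es)"

lemma aval_sum_aexp [simp]: "aval (sum_aexp es) s = (\<Sum>e\<leftarrow>es. aval e s)"
  by (induction es) auto

abbreviation n_exp :: aexp where "n_exp \<equiv> Arr 0 (Lit 0)"

text \<open>Unrolled for fixed \<open>k\<close>. The power is part of a larger expression, so it
  needs no loop and no separate step.\<close>

fun n_power :: "nat \<Rightarrow> aexp" where
  "n_power 0 = Lit 1"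
| "n_power (Suc k) = Times n_exp (n_power k)"

lemma aval_n_power: "arrs s 0 0 = int n \<Longrightarrow> aval (n_power k) s = int (n ^ k)"
  by (induction k) auto

definition digit :: "nat \<Rightarrow> nat \<Rightarrow> aexp" where
  "digit r k = Mod (Div (Reg r) (n_power k)) n_exp"

lemma aval_digit:
  "arrs s 0 0 = int n \<Longrightarrow> regs s r = int c \<Longrightarrow> aval (digit r k) s = int (c div n ^ k mod n)"
  by (simp add: digit_def aval_n_power zdiv_int zmod_int)

section \<open>Evaluating the instance\<close>

text \<open>
  Array 0 is the input and array 1 the output, array 2 holds the current assignment as bits, and
  array 3 the kernel variables.  Register 0 receives the value of the assignment, registers 1 to 5
  are loop counters, 6 counts, 7 to 9 are temporary, 10 is the next output position, 11 the
  number of terms written and 12 the position where that number belongs.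
\<close>

definition record_length :: "nat \<Rightarrow> nat" where
  "record_length d = 1 + d + 2 ^ d"

definition input_array :: "nat \<Rightarrow> nat \<Rightarrow> constraint list \<Rightarrow> nat \<Rightarrow> (int \<Rightarrow> int) \<Rightarrow> bool" where
  "input_array d n Cs t A \<longleftrightarrow> A 0 = int n \<and> A 1 = int t \<and> A 2 = int (length (remdups Cs)) \<and>
     (\<forall>k<length (remdups Cs). \<forall>r<record_length d. A (int (3 + k * record_length d + r)) =
        (int (count_list Cs (remdups Cs ! k)) # encode_constraint d (remdups Cs ! k)) ! r)"

lemma length_encode_constraint:
  "csp_instance d n Cs \<Longrightarrow> C \<in> set Cs \<Longrightarrow> length (encode_constraint d C) = d + 2 ^ d"
  by (auto simp: encode_constraint_def csp_instance_def)

lemma nth_concat_equal_length: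
  assumes "\<forall>ys\<in>set yss. length ys = R" "k < length yss" "r < R"
  shows "concat yss ! (k * R + r) = yss ! k ! r"
    and "k * R + r < length (concat yss)"
  using assms
proof (induction yss arbitrary: k)
  case (Cons ys yss)
  { case 1
    then show ?case using Cons.IH(1)[of "k - 1"] by (cases k) (auto simp: nth_append add.assoc)
  next
    case 2
    then show ?case using Cons.IH(2)[of "k - 1"] by (cases k) auto
  }
qed auto

lemma input_array_input_state:
  assumes "csp_instance d n Cs"
  shows "input_array d n Cs t (arrs (input_state (encode_input d n Cs t)) 0)"
proof -
  let ?D = "remdups Cs"
  let ?yss = "map (\<lambda>C. int (count_list Cs C) # encode_constraint d C) ?D"
  let ?A = "arrs (input_state (encode_input d n Cs t)) 0"
  have len: "\<forall>ys\<in>set ?yss. length ys = record_length d"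
    using length_encode_constraint[OF assms] by (auto simp: record_length_def)
  have A: "?A (int i) = encode_input d n Cs t ! i" if "i < length (encode_input d n Cs t)" for i
    using that by (simp add: input_state_def)
  have "?A (int (3 + k * record_length d + r)) = ?yss ! k ! r"
    if "k < length ?D" "r < record_length d" for k r
  proof -
    have "3 + k * record_length d + r < length (encode_input d n Cs t)"
      using nth_concat_equal_length(2)[OF len] that by (simp add: encode_input_def)
    moreover have "encode_input d n Cs t ! (3 + k * record_length d + r) = concat ?yss ! (k * record_length d + r)"
      by (simp add: encode_input_def nth_append)
    moreover have "concat ?yss ! (k * record_length d + r) = ?yss ! k ! r"
      by (rule nth_concat_equal_length(1)[OF len]) (use that in simp_all)
    ultimately show ?thesis by (simp only: A)
  qed
  moreover have "?A 0 = int n" "?A 1 = int t" "?A 2 = int (length ?D)"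
    using A[of 0] A[of 1] A[of 2] by (simp_all add: encode_input_def)
  ultimately show ?thesis by (auto simp: input_array_def)
qed

definition holds_bits :: "nat \<Rightarrow> (nat \<Rightarrow> bool) \<Rightarrow> (int \<Rightarrow> int) \<Rightarrow> bool" where
  "holds_bits n b A \<longleftrightarrow> (\<forall>v<n. A (int v) = of_bool (b v))"

text \<open>The values of the variables of the constraint are the binary digits of an address into
  its truth table, whose entry is weighted by the multiplicity. As a single expression it costs one
  step per distinct constraint.\<close>

definition eval_contrib :: "nat \<Rightarrow> aexp" where
  "eval_contrib d = (let base = Plus (Lit 3) (Times (Reg 1) (Lit (int (record_length d)))) in
     Times (Arr 0 base) (Arr 0 (Plus base (Plus (Lit (int (1 + d)))
       (sum_aexp (map (\<lambda>j. Times (Lit (2 ^ j)) (Arr 2 (Arr 0 (Plus base (Lit (int (1 + j))))))) [0..<d]))))))"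

definition eval_com :: "nat \<Rightarrow> com" where
  "eval_com d = Seq (Assign 0 (Lit 0))
     (For 1 (Arr 0 (Lit 2)) (Assign 0 (Plus (Reg 0) (eval_contrib d))))"

lemma sum_bits:
  fixes \<beta> :: "nat \<Rightarrow> bool" and d :: nat
  defines "z \<equiv> \<Sum>j<d. of_bool (\<beta> j) * 2 ^ j :: nat"
  shows "z < 2 ^ d" and "j < d \<Longrightarrow> odd (z div 2 ^ j) \<longleftrightarrow> \<beta> j"
proof -
  have z: "z = horner_sum of_bool 2 (map \<beta> [0..<d])"
    by (simp add: z_def horner_sum_eq_sum atLeast0LessThan)
  show "j < d \<Longrightarrow> odd (z div 2 ^ j) \<longleftrightarrow> \<beta> j"
    by (simp add: z bit_horner_sum_bit_iff flip: bit_iff_odd)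
  show "z < 2 ^ d"
    unfolding z_def
  proof (induction d)
    case (Suc d)
    then show ?case by (cases "\<beta> d") simp_all
  qed simp
qed

lemma csp_val_remdups:
  "csp_val Cs \<alpha> = (\<Sum>k<length (remdups Cs). count_list Cs (remdups Cs ! k) * of_bool (satisfies \<alpha> (remdups Cs ! k)))"
proof -
  have "csp_val Cs \<alpha> = (\<Sum>C\<in>set Cs. count_list (filter (satisfies \<alpha>) Cs) C)"
    unfolding csp_val_def
    by (subst sum_count_set[symmetric, of _ "set Cs"]) auto
  also have "\<dots> = (\<Sum>C\<in>set Cs. count_list Cs C * of_bool (satisfies \<alpha> C))"
  proof (rule sum.cong)
    fix C
    show "count_list (filter (satisfies \<alpha>) Cs) C = count_list Cs C * of_bool (satisfies \<alpha> C)"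
      by (induction Cs) auto
  qed simp
  also have "\<dots> = (\<Sum>C\<leftarrow>remdups Cs. count_list Cs C * of_bool (satisfies \<alpha> C))"
    by (subst sum_list_distinct_conv_sum_set) auto
  finally show ?thesis by (simp add: sum_list_sum_nth atLeast0LessThan)
qed

lemma aval_eval_contrib:
  assumes inp: "input_array d n Cs t (arrs s 0)" and Cs: "csp_instance d n Cs"
    and b: "holds_bits n b (arrs s 2)" and k: "regs s 1 = int k" "k < length (remdups Cs)"
  shows "aval (eval_contrib d) s = int (count_list Cs (remdups Cs ! k) * of_bool (satisfies (signs n b) (remdups Cs ! k)))"
proof -
  obtain xs P where C: "remdups Cs ! k = (xs, P)" by (cases "remdups Cs ! k")
  have "(xs, P) \<in> set Cs" using nth_mem[OF k(2)] by (simp add: C)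
  then have xs: "length xs = d" "set xs \<subseteq> {..<n}" using Cs by (auto simp: csp_instance_def)
  let ?base = "3 + k * record_length d"
  have A: "arrs s 0 (int (?base + r)) = (int (count_list Cs (xs, P)) # encode_constraint d (xs, P)) ! r"
    if "r < record_length d" for r
    using inp k(2) that by (simp add: input_array_def C)
  define z where "z = (\<Sum>j<d. of_bool (b (xs ! j)) * 2 ^ j :: nat)"
  have z: "z < 2 ^ d" "\<And>j. j < d \<Longrightarrow> odd (z div 2 ^ j) \<longleftrightarrow> b (xs ! j)"
    unfolding z_def using sum_bits[where \<beta> = "\<lambda>j. b (xs ! j)" and d = d] by auto
  have x: "arrs s 0 (int (?base + (1 + j))) = int (xs ! j)" if "j < d" for j
    using that xs A[of "1 + j"] by (simp add: record_length_def encode_constraint_def nth_append)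
  have xsn: "xs ! j < n" if "j < d" for j
  proof -
    have "xs ! j \<in> {..<n}" using xs that nth_mem[of j xs] by blast
    then show ?thesis by simp
  qed
  then have bit: "arrs s 2 (int (xs ! j)) = of_bool (b (xs ! j))" if "j < d" for j
    using b that by (simp add: holds_bits_def)
  have base: "3 + int k * int (record_length d) = int ?base" by simp
  have "(\<Sum>j\<leftarrow>[0..<d]. 2 ^ j * arrs s 2 (arrs s 0 (int ?base + int (1 + j)))) = int z"
  proof -
    have "(\<Sum>j\<leftarrow>[0..<d]. 2 ^ j * arrs s 2 (arrs s 0 (int ?base + int (1 + j)))) =
        (\<Sum>j\<leftarrow>[0..<d]. int (of_bool (b (xs ! j)) * 2 ^ j))"
    proof (intro arg_cong[where f = sum_list] map_cong refl)
      fix j assume "j \<in> set [0..<d]"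
      then show "2 ^ j * arrs s 2 (arrs s 0 (int ?base + int (1 + j))) = int (of_bool (b (xs ! j)) * 2 ^ j)"
        using x[of j] bit[of j] by simp
    qed
    then show ?thesis by (simp add: z_def interv_sum_list_conv_sum_set_nat atLeast0LessThan)
  qed
  then have "aval (eval_contrib d) s = arrs s 0 (int ?base) * arrs s 0 (int ?base + (int (1 + d) + int z))"
    by (simp only: eval_contrib_def Let_def aval.simps k(1) base aval_sum_aexp map_map o_def)
  also have "arrs s 0 (int ?base) = int (count_list Cs (xs, P))"
    using A[of 0] by (simp add: record_length_def)
  also have "int ?base + (int (1 + d) + int z) = int (?base + (1 + d + z))" by simp
  also have "arrs s 0 (int (?base + (1 + d + z))) = of_bool (sign_vector d z \<in> P)"
    using A[of "1 + d + z"] z(1) xs by (simp add: record_length_def encode_constraint_def nth_append)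
  also have "sign_vector d z = map (signs n b) xs"
    using xs z(2) xsn by (intro nth_equalityI) (auto simp: sign_vector_def signs_def)
  finally show ?thesis by (simp add: C satisfies_def)
qed

definition eval_time :: "nat \<Rightarrow> nat" where
  "eval_time D = D * 3 + 3"

lemma runs_eval:
  assumes inp: "input_array d n Cs t (arrs s 0)" and Cs: "csp_instance d n Cs"
    and b: "holds_bits n b (arrs s 2)" and W: "int (length Cs) \<le> W"
  shows "runs W (eval_com d) s (eval_time (length (remdups Cs)))
    (\<lambda>s'. same {0, 1} {} s s' \<and> regs s' 0 = int (csp_val Cs (signs n b)))"
proof -
  let ?D = "remdups Cs"
  define tm where "tm = (\<lambda>k. count_list Cs (?D ! k) * of_bool (satisfies (signs n b) (?D ! k)))"
  define I where "I = (\<lambda>k s'. same {0, 1} {} s s' \<and> regs s' 1 = int k \<and> regs s' 0 = int (\<Sum>j<k. tm j))"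
  have D: "length ?D \<le> length Cs" by simp
  \<comment> \<open>All contributions are nonnegative, so the partial sums stay below the final
    value, which is at most the number of constraints and hence fits into a word.\<close>
  have bound: "int (\<Sum>j<k. tm j) \<le> W" if "k \<le> length ?D" for k
  proof -
    have "(\<Sum>j<k. tm j) \<le> (\<Sum>j<length ?D. tm j)" using that by (intro sum_mono2) auto
    also have "\<dots> = csp_val Cs (signs n b)" by (simp only: tm_def csp_val_remdups)
    also have "\<dots> \<le> length Cs" by (simp add: csp_val_def)
    finally show ?thesis using W by linarith
  qed
  have "runs W (eval_com d) s (1 + (length ?D * (1 + 2) + 2)) (I (length ?D))"
    unfolding eval_com_def
  proof (rule runs_Seq[where ?Q1.0 = "\<lambda>s'. same {0, 1} {} s s' \<and> regs s' 0 = 0"])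
    show "runs W (Assign 0 (Lit 0)) s 1 (\<lambda>s'. same {0, 1} {} s s' \<and> regs s' 0 = 0)"
      using W by (intro runs_Assign) (auto simp: same_def)
    fix s1 assume s1: "same {0, 1} {} s s1 \<and> regs s1 0 = 0"
    show "runs W (For 1 (Arr 0 (Lit 2)) (Assign 0 (Plus (Reg 0) (eval_contrib d)))) s1
        (length ?D * (1 + 2) + 2) (I (length ?D))"
    proof (rule runs_For)
      show "I 0 (s1\<lparr>regs := (regs s1)(1 := 0)\<rparr>)" using s1 by (auto simp: I_def same_def)
      show "regs s' 1 = int i \<and> aval (Arr 0 (Lit 2)) s' = int (length ?D)" if "I i s'" for i s'
        using that inp by (auto simp: I_def same_def input_array_def)
      show "int (length ?D) \<le> W" using D W by linarith
      fix k s' assume k: "k < length ?D" and s': "I k s'"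
      have "aval (eval_contrib d) s' = int (tm k)"
        unfolding tm_def by (rule aval_eval_contrib[where t = t, OF _ Cs]) (use s' k inp b in \<open>auto simp: I_def same_def\<close>)
      then have v: "aval (Plus (Reg 0) (eval_contrib d)) s' = int (\<Sum>j<Suc k. tm j)"
        using s' by (simp add: I_def)
      show "runs W (Assign 0 (Plus (Reg 0) (eval_contrib d))) s' 1
          (\<lambda>s'. regs s' 1 = int k \<and> I (Suc k) (s'\<lparr>regs := (regs s')(1 := int (Suc k))\<rparr>))"
      proof (rule runs_Assign)
        show "\<bar>aval (Plus (Reg 0) (eval_contrib d)) s'\<bar> \<le> W"
          unfolding v abs_of_nat using bound[OF Suc_leI[OF k]] .
      qed (unfold v, use s' in \<open>auto simp: I_def same_def\<close>)
    qed
  qed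
  then show ?thesis
    by (rule runs_weaken) (auto simp: I_def tm_def csp_val_remdups eval_time_def)
qed

section \<open>Computing the exchange classes\<close>

definition swap_com :: "aexp \<Rightarrow> aexp \<Rightarrow> com" where
  "swap_com e e' = Seq (Assign 9 (Arr 2 e)) (Seq (Store 2 e (Arr 2 e')) (Store 2 e' (Reg 9)))"

text \<open>The index expressions are evaluated again after the temporary register and the bit array
  have changed, so they must not depend on either. Equal indices are allowed, which the padding with
  trivial swaps relies on.\<close>

lemma runs_swap:
  assumes b: "holds_bits n b (arrs s 2)" and pq: "p < n" "q < n"
    and e: "\<And>s'. same {9} {2} s s' \<Longrightarrow> aval e s' = int p \<and> aval e' s' = int q"
    and W: "1 \<le> W"
  shows "runs W (swap_com e e') s 3 (\<lambda>s'. same {9} {2} s s' \<and> holds_bits n (b \<circ> transposition p q) (arrs s' 2))"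
proof -
  have bit: "\<bar>of_bool x :: int\<bar> \<le> W" for x using W by simp
  have ev: "aval e s = int p" "aval e' s = int q" using e by simp_all
  have "runs W (swap_com e e') s (1 + (1 + 1))
    (\<lambda>s'. same {9} {2} s s' \<and> holds_bits n (b \<circ> transposition p q) (arrs s' 2))"
    unfolding swap_com_def
  proof (rule runs_Seq[where ?Q1.0 = "\<lambda>s'. same {9} {2} s s' \<and> arrs s' 2 = arrs s 2 \<and> regs s' 9 = of_bool (b p)"])
    show "runs W (Assign 9 (Arr 2 e)) s 1 (\<lambda>s'. same {9} {2} s s' \<and> arrs s' 2 = arrs s 2 \<and> regs s' 9 = of_bool (b p))"
      using ev b pq bit[of "b p"] by (intro runs_Assign) (auto simp: same_def holds_bits_def)
    fix s1 assume s1: "same {9} {2} s s1 \<and> arrs s1 2 = arrs s 2 \<and> regs s1 9 = of_bool (b p)"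
    show "runs W (Seq (Store 2 e (Arr 2 e')) (Store 2 e' (Reg 9))) s1 (1 + 1)
        (\<lambda>s'. same {9} {2} s s' \<and> holds_bits n (b \<circ> transposition p q) (arrs s' 2))"
    proof (rule runs_Seq[where ?Q1.0 = "\<lambda>s'. same {9} {2} s s' \<and>
        arrs s' 2 = (arrs s 2)(int p := of_bool (b q)) \<and> regs s' 9 = of_bool (b p)"])
      have "aval e s1 = int p" "aval e' s1 = int q" using e s1 by simp_all
      then show "runs W (Store 2 e (Arr 2 e')) s1 1 (\<lambda>s'. same {9} {2} s s' \<and>
          arrs s' 2 = (arrs s 2)(int p := of_bool (b q)) \<and> regs s' 9 = of_bool (b p))"
        using s1 b pq bit[of "b q"] by (intro runs_Store) (auto simp: same_def holds_bits_def)
      fix s2 assume s2: "same {9} {2} s s2 \<and>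
        arrs s2 2 = (arrs s 2)(int p := of_bool (b q)) \<and> regs s2 9 = of_bool (b p)"
      then have "aval e' s2 = int q" using e by simp
      then show "runs W (Store 2 e' (Reg 9)) s2 1
          (\<lambda>s'. same {9} {2} s s' \<and> holds_bits n (b \<circ> transposition p q) (arrs s' 2))"
        using s2 b pq bit[of "b p"]
        by (intro runs_Store) (auto simp: same_def holds_bits_def Transposition.transpose_def)
    qed
  qed
  then show ?thesis by (simp add: numeral_3_eq_3)
qed

section \<open>A single exchangeability test\<close>

definition parity_com :: com where
  "parity_com = For 2 n_exp (Store 2 (Reg 2) (Mod (Reg 2) (Lit 2)))"

lemma runs_parity:
  assumes n: "arrs s 0 0 = int n" and W: "1 \<le> W" "int n \<le> W"
  shows "runs W parity_com s (n * 3 + 2) (\<lambda>s'. same {2} {2} s s' \<and> holds_bits n odd (arrs s' 2))"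
proof -
  define I where "I = (\<lambda>v s'. same {2} {2} s s' \<and> regs s' 2 = int v \<and> holds_bits v odd (arrs s' 2))"
  have "runs W parity_com s (n * (1 + 2) + 2) (I n)"
    unfolding parity_com_def
  proof (rule runs_For)
    show "I 0 (s\<lparr>regs := (regs s)(2 := 0)\<rparr>)" by (auto simp: I_def same_def holds_bits_def)
    show "regs s' 2 = int v \<and> aval n_exp s' = int n" if "I v s'" for v s'
      using that n by (auto simp: I_def same_def)
    fix v s' assume s': "v < n" "I v s'"
    have m: "int v mod 2 = of_bool (odd v)" by (simp add: mod_2_eq_odd)
    show "runs W (Store 2 (Reg 2) (Mod (Reg 2) (Lit 2))) s' 1
        (\<lambda>s'. regs s' 2 = int v \<and> I (Suc v) (s'\<lparr>regs := (regs s')(2 := int (Suc v))\<rparr>))"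
      using s' W m by (intro runs_Store) (auto simp: I_def same_def holds_bits_def less_Suc_eq)
  qed (use W in simp)
  then show ?thesis by (rule runs_weaken) (auto simp: I_def)
qed

text \<open>Register 7 is only ever raised. After the loop over all tests it tells whether one of
  them separated \<open>i\<close> and \<open>j\<close>, and it can be added to the count as it
  stands.\<close>

definition test_com :: "nat \<Rightarrow> nat \<Rightarrow> com" where
  "test_com d k =
    Seq parity_com
   (Seq (Cond (Equal (Arr 2 (Reg 3)) (Arr 2 (Reg 4)))
          (swap_com (Reg 4) (Minus (Plus (Reg 4) (Lit 1)) (Times (Lit 2) (Mod (Reg 4) (Lit 2))))) Skip)
   (Seq (Seqs (map (\<lambda>l. swap_com (digit 5 (2 * l)) (digit 5 (2 * l + 1))) [0..<k]))
   (Seq (eval_com d)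
   (Seq (Assign 8 (Reg 0))
   (Seq (swap_com (Reg 3) (Reg 4))
   (Seq (eval_com d)
        (Cond (Equal (Reg 8) (Reg 0)) Skip (Assign 7 (Lit 1)))))))))"

definition test_time :: "nat \<Rightarrow> nat \<Rightarrow> nat \<Rightarrow> nat" where
  "test_time n k E = (n * 3 + 2) + (4 + ((k * 3 + 1) + (E + (1 + (3 + (E + 2))))))"

lemma runs_test:
  assumes inp: "input_array d n Cs t (arrs s 0)" and Cs: "csp_instance d n Cs" and n: "even n"
    and r: "regs s 3 = int i" "regs s 4 = int j" "regs s 5 = int c" and ij: "i < n" "j < n"
    and W: "1 \<le> W" "int n \<le> W" "int (length Cs) \<le> W"
  shows "runs W (test_com d k) s (test_time n k (eval_time (length (remdups Cs))))
    (\<lambda>s'. same {0, 1, 2, 7, 8, 9} {2} s s' \<and> regs s' 7 =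
      (if csp_val Cs (signs n (test_bits n k i j c \<circ> transposition i j)) = csp_val Cs (signs n (test_bits n k i j c))
       then regs s 7 else 1))"
proof -
  let ?R = "{0, 1, 2, 7, 8, 9} :: nat set"
  let ?S = "\<lambda>s'. same ?R {2} s s' \<and> regs s' 7 = regs s 7"
  let ?tb = "test_bits n k i j c"
  let ?E = "eval_time (length (remdups Cs))"
  let ?Q = "\<lambda>s'. same ?R {2} s s' \<and> regs s' 7 =
      (if csp_val Cs (signs n (?tb \<circ> transposition i j)) = csp_val Cs (signs n ?tb) then regs s 7 else 1)"
  have n0: "arrs s 0 0 = int n" using inp by (simp add: input_array_def)
  have keep: "regs s' 3 = int i" "regs s' 4 = int j" "regs s' 5 = int c" "arrs s' 0 = arrs s 0"
    if "?S s'" for s' using that r by (auto simp: same_def)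
  \<comment> \<open>All intermediate commands respect the same frame and leave the flag alone, so
    one transitivity fact serves the whole chain of intermediate assertions.\<close>
  have tr: "?S s2" if "?S s1" "same {9} {2} s1 s2 \<or> same {0, 1} {} s1 s2 \<or> same {2} {2} s1 s2" for s1 s2
  proof (intro conjI)
    show "same ?R {2} s s2" using that same_trans[of ?R "{2}" s s1 _ _ s2 ?R "{2}"] by fastforce
    have "regs s2 7 = regs s1 7" using that(2) by (elim disjE) (simp_all add: same_def)
    then show "regs s2 7 = regs s 7" using that(1) by simp
  qed
  let ?Q1 = "\<lambda>s'. ?S s' \<and> holds_bits n odd (arrs s' 2)"
  let ?Q2 = "\<lambda>s'. ?S s' \<and> holds_bits n (base_bits i j) (arrs s' 2)"
  let ?Q3 = "\<lambda>s'. ?S s' \<and> holds_bits n ?tb (arrs s' 2)"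
  let ?Q4 = "\<lambda>s'. ?Q3 s' \<and> regs s' 0 = int (csp_val Cs (signs n ?tb))"
  let ?Q5 = "\<lambda>s'. ?Q3 s' \<and> regs s' 8 = int (csp_val Cs (signs n ?tb))"
  let ?Q6 = "\<lambda>s'. ?S s' \<and> holds_bits n (?tb \<circ> transposition i j) (arrs s' 2) \<and> regs s' 8 = int (csp_val Cs (signs n ?tb))"
  let ?Q7 = "\<lambda>s'. ?S s' \<and> regs s' 0 = int (csp_val Cs (signs n (?tb \<circ> transposition i j))) \<and>
    regs s' 8 = int (csp_val Cs (signs n ?tb))"
  show ?thesis
    unfolding test_com_def test_time_def
  proof (rule runs_Seq[where ?Q1.0 = ?Q1], goal_cases)
    case 1
    show ?case
    proof (rule runs_weaken[OF runs_parity[OF n0 W(1,2)]])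
      fix s' assume "same {2} {2} s s' \<and> holds_bits n odd (arrs s' 2)"
      then show "?Q1 s'" using tr[of s s'] by simp
    qed simp
  next
    case (2 s1)
    show ?case
    proof (rule runs_Seq[where ?Q1.0 = ?Q2], goal_cases)
      case 1
      let ?p = "j + 1 - 2 * (j mod 2)"
      have p: "?p < n" by (rule partner_less[OF n ij(2)])
      have e: "aval (Reg 4) s' = int j \<and>
          aval (Minus (Plus (Reg 4) (Lit 1)) (Times (Lit 2) (Mod (Reg 4) (Lit 2)))) s' = int ?p"
        if "same {9} {2} s1 s'" for s'
      proof -
        have "regs s' 4 = int j" using that 2 keep(2)[of s1] by (simp add: same_def)
        moreover have "2 * (j mod 2) \<le> j + 1" by presburger
        ultimately show ?thesis by (simp add: of_nat_diff zmod_int)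
      qed
      have eq: "arrs s1 2 (int i) = arrs s1 2 (int j) \<longleftrightarrow> odd i = odd j"
        using 2 ij by (auto simp: holds_bits_def)
      have "runs W (Cond (Equal (Arr 2 (Reg 3)) (Arr 2 (Reg 4)))
          (swap_com (Reg 4) (Minus (Plus (Reg 4) (Lit 1)) (Times (Lit 2) (Mod (Reg 4) (Lit 2))))) Skip) s1 (Suc 3) ?Q2"
      proof (rule runs_Cond)
        assume "bval (Equal (Arr 2 (Reg 3)) (Arr 2 (Reg 4))) s1"
        then have "odd i = odd j" using eq keep[of s1] 2 by simp
        then have bb: "base_bits i j = odd \<circ> transposition j ?p" by (simp add: base_bits_def)
        have h: "holds_bits n odd (arrs s1 2)" using 2 by blast
        show "runs W (swap_com (Reg 4) (Minus (Plus (Reg 4) (Lit 1)) (Times (Lit 2) (Mod (Reg 4) (Lit 2))))) s1 3 ?Q2"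
          unfolding bb
        proof (rule runs_weaken[OF runs_swap[OF h ij(2) p e W(1)]])
          fix s' assume "same {9} {2} s1 s' \<and> holds_bits n (odd \<circ> transposition j ?p) (arrs s' 2)"
          then show "?S s' \<and> holds_bits n (odd \<circ> transposition j ?p) (arrs s' 2)"
            using 2 tr[of s1 s'] by blast
        qed simp_all
      next
        assume "\<not> bval (Equal (Arr 2 (Reg 3)) (Arr 2 (Reg 4))) s1"
        then have "\<not> odd i = odd j" using eq keep[of s1] 2 by simp
        then have "base_bits i j = odd" unfolding base_bits_def by (rule if_not_P)
        then have "?Q2 s1" using 2 by simp
        then show "runs W Skip s1 3 ?Q2" by (rule runs_weaken[OF runs_Skip[of ?Q2]]) auto
      qed
      then show ?case by (simp add: numeral_eq_Suc)
    next
      case (2 s2)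
      show ?case
      proof (rule runs_Seq[where ?Q1.0 = ?Q3], goal_cases)
        case 1
        let ?I = "\<lambda>l s'. ?S s' \<and> holds_bits n (base_bits i j \<circ> swaps (take l (test_swaps n k c))) (arrs s' 2)"
        let ?cs = "map (\<lambda>l. swap_com (digit 5 (2 * l)) (digit 5 (2 * l + 1))) [0..<k]"
        have "runs W (Seqs ?cs) s2 (length ?cs * 3 + 1) (?I (length ?cs))"
        proof (rule runs_Seqs)
          show "?I 0 s2" using 2 by simp
          fix l s3 assume l: "l < length ?cs" and s3: "?I l s3"
          let ?p = "c div n ^ (2 * l) mod n" and ?q = "c div n ^ (2 * l + 1) mod n"
          have pq: "?p < n" "?q < n" using ij by simp_all
          have e: "aval (digit 5 (2 * l)) s' = int ?p \<and> aval (digit 5 (2 * l + 1)) s' = int ?q"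
            if "same {9} {2} s3 s'" for s'
          proof -
            have "arrs s' 0 0 = int n" "regs s' 5 = int c"
              using that s3 keep[of s3] n0 by (auto simp: same_def)
            then show ?thesis using aval_digit by blast
          qed
          have "take (Suc l) (test_swaps n k c) = take l (test_swaps n k c) @ [(?p, ?q)]"
            using l by (simp add: take_Suc_conv_app_nth test_swaps_def)
          then have sw: "base_bits i j \<circ> swaps (take (Suc l) (test_swaps n k c)) =
              (base_bits i j \<circ> swaps (take l (test_swaps n k c))) \<circ> transposition ?p ?q"
            by (simp add: swaps_append comp_assoc)
          have h: "holds_bits n (base_bits i j \<circ> swaps (take l (test_swaps n k c))) (arrs s3 2)" using s3 by blast
          have "runs W (swap_com (digit 5 (2 * l)) (digit 5 (2 * l + 1))) s3 3 (?I (Suc l))"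
            unfolding sw
          proof (rule runs_weaken[OF runs_swap[OF h pq e W(1)]], assumption)
            fix s'
            let ?b = "(base_bits i j \<circ> swaps (take l (test_swaps n k c))) \<circ> transposition ?p ?q"
            assume "same {9} {2} s3 s' \<and> holds_bits n ?b (arrs s' 2)"
            then show "?S s' \<and> holds_bits n ?b (arrs s' 2)" using s3 tr[of s3 s'] by blast
          qed simp
          then show "runs W (?cs ! l) s3 3 (?I (Suc l))" using l by simp
        qed
        then show ?case by (simp add: test_bits_def test_swaps_def)
      next
        case (2 s3)
        show ?case
        proof (rule runs_Seq[where ?Q1.0 = ?Q4], goal_cases)
          case 1
          have i3: "input_array d n Cs t (arrs s3 0)" and h: "holds_bits n ?tb (arrs s3 2)"
            using 2 inp keep(4)[of s3] by auto
          show ?case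
          proof (rule runs_weaken[OF runs_eval[OF i3 Cs h W(3)]])
            fix s' assume s': "same {0, 1} {} s3 s' \<and> regs s' 0 = int (csp_val Cs (signs n ?tb))"
            then have "arrs s' 2 = arrs s3 2" by (simp add: same_def)
            then show "?Q4 s'" using s' 2 tr[of s3 s'] by simp
          qed simp
        next
          case (2 s4)
          show ?case
          proof (rule runs_Seq[where ?Q1.0 = ?Q5], goal_cases)
            case 1
            have "csp_val Cs (signs n ?tb) \<le> length Cs" by (simp add: csp_val_def)
            then show ?case using 2 W(3) by (intro runs_Assign) (auto simp: same_def)
          next
            case (2 s5)
            show ?case
            proof (rule runs_Seq[where ?Q1.0 = ?Q6], goal_cases)
              case 1
              have h: "holds_bits n ?tb (arrs s5 2)" using 2 by blast
              have e: "aval (Reg 3) s' = int i \<and> aval (Reg 4) s' = int j" if "same {9} {2} s5 s'" for s'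
                using that 2 keep[of s5] by (simp add: same_def)
              show ?case
              proof (rule runs_weaken[OF runs_swap[OF h ij e W(1)]], assumption)
                fix s' assume s': "same {9} {2} s5 s' \<and> holds_bits n (?tb \<circ> transposition i j) (arrs s' 2)"
                then have "regs s' 8 = regs s5 8" by (simp add: same_def)
                then show "?Q6 s'" using s' 2 tr[of s5 s'] by simp
              qed simp
            next
              case (2 s6)
              show ?case
              proof (rule runs_Seq[where ?Q1.0 = ?Q7], goal_cases)
                case 1
                have i6: "input_array d n Cs t (arrs s6 0)" and h: "holds_bits n (?tb \<circ> transposition i j) (arrs s6 2)"
                  using 2 inp keep(4)[of s6] by auto
                show ?case
                proof (rule runs_weaken[OF runs_eval[OF i6 Cs h W(3)]])
                  fix s' assume s': "same {0, 1} {} s6 s' \<and>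
                    regs s' 0 = int (csp_val Cs (signs n (?tb \<circ> transposition i j)))"
                  then have "regs s' 8 = regs s6 8" by (simp add: same_def)
                  then show "?Q7 s'" using s' 2 tr[of s6 s'] by simp
                qed simp
              next
                case (2 s7)
                have "runs W (Cond (Equal (Reg 8) (Reg 0)) Skip (Assign 7 (Lit 1))) s7 (Suc 1) ?Q"
                proof (rule runs_Cond)
                  assume "bval (Equal (Reg 8) (Reg 0)) s7"
                  then show "runs W Skip s7 1 ?Q" using 2 by (intro runs_Skip) auto
                next
                  assume "\<not> bval (Equal (Reg 8) (Reg 0)) s7"
                  then show "runs W (Assign 7 (Lit 1)) s7 1 ?Q"
                    using 2 W by (intro runs_Assign) (auto simp: same_def)
                qed
                then show ?case by (simp add: numeral_eq_Suc)
              qed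
            qed
          qed
        qed
      qed
    qed
  qed
qed

section \<open>Flags for the kernel variables\<close>

definition bound_exp :: "nat \<Rightarrow> aexp" where
  "bound_exp d = Times (Lit (int (kernel_const d))) (Times (Arr 0 (Lit 1)) (Arr 0 (Lit 1)))"

lemma aval_bound_exp: "arrs s 0 1 = int t \<Longrightarrow> aval (bound_exp d) s = int (kernel_const d * t ^ 2)"
  by (simp add: bound_exp_def power2_eq_square)

definition classes_com :: "nat \<Rightarrow> nat \<Rightarrow> com" where
  "classes_com d k = For 3 n_exp
    (Seq (Assign 6 (Lit 0))
    (Seq (For 4 n_exp
           (Seq (Assign 7 (Lit 0))
           (Seq (For 5 (n_power (2 * k)) (test_com d k))
                (Assign 6 (Plus (Reg 6) (Reg 7))))))
         (Cond (Conj (Less (bound_exp d) n_exp) (Neg (Less (bound_exp d) (Times (Lit 2) (Reg 6)))))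
           (Store 3 (Reg 3) (Lit 0)) (Store 3 (Reg 3) (Lit 1)))))"

definition classes_time :: "nat \<Rightarrow> nat \<Rightarrow> nat \<Rightarrow> nat" where
  "classes_time n k E =
    n * ((1 + ((n * ((1 + ((n ^ (2 * k) * (test_time n k E + 2) + 2) + 1)) + 2) + 2) + 2)) + 2) + 2"

lemma runs_classes:
  assumes inp: "input_array d n Cs t (arrs s 0)" and Cs: "csp_instance d n Cs" and n: "even n" and d: "d = Suc k"
    and W: "1 \<le> W" "int n \<le> W" "int (length Cs) \<le> W" "int (n ^ (2 * k)) \<le> W"
  shows "runs W (classes_com d k) s (classes_time n k (eval_time (length (remdups Cs))))
    (\<lambda>s'. same {0..<10} {2, 3} s s' \<and>
      holds_bits n (\<lambda>i. i \<in> kernel_vars (mleval (csp_poly d Cs)) n (kernel_const d * t ^ 2)) (arrs s' 3))"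
proof -
  define f where "f = mleval (csp_poly d Cs)"
  define K where "K = kernel_const d * t ^ 2"
  let ?E = "eval_time (length (remdups Cs))"
  let ?same = "\<lambda>c i j. csp_val Cs (signs n (test_bits n k i j c \<circ> transposition i j)) =
    csp_val Cs (signs n (test_bits n k i j c))"
  have ex: "exchangeable f {..<n} i j \<longleftrightarrow> (\<forall>c<n ^ (2 * k). ?same c i j)" if "i < n" "j < n" for i j
  proof -
    have "f (signs n b) = real (csp_val Cs (signs n b))" for b
      unfolding f_def by (rule mleval_csp_poly[OF Cs signs_in_assignments])
    moreover have "polylt (Suc (Suc k)) f" unfolding f_def d by (rule polylt_csp_poly)
    ultimately show ?thesis using exchangeable_iff_tests[OF _ n that, of k f] by simp
  qed
  let ?frame = "same {0..<10} {2, 3} s"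
  have n0: "arrs s' 0 0 = int n" and i0: "input_array d n Cs t (arrs s' 0)" if "?frame s'" for s'
    using that inp by (auto simp: same_def input_array_def)
  \<comment> \<open>\<open>A\<close>, \<open>B\<close> and \<open>C\<close> are the invariants of
    the loops over \<open>i\<close>, \<open>j\<close> and the test number \<open>c\<close>. Each
    contains the invariant of the enclosing loop.\<close>
  define A where "A = (\<lambda>i s'. ?frame s' \<and> regs s' 3 = int i \<and> holds_bits i (\<lambda>i. i \<in> kernel_vars f n K) (arrs s' 3))"
  define B where "B = (\<lambda>i j s'. A i s' \<and> regs s' 4 = int j \<and>
    regs s' 6 = int (card {j' \<in> {..<j}. \<not> exchangeable f {..<n} i j'}))"
  define C where "C = (\<lambda>i j c s'. B i j s' \<and> regs s' 5 = int c \<and> regs s' 7 = of_bool (\<exists>c'<c. \<not> ?same c' i j))"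
  have card_le: "int (card {j' \<in> {..<j}. \<not> exchangeable f {..<n} i j'}) \<le> W" if "j \<le> n" for i j
  proof -
    have "card {j' \<in> {..<j}. \<not> exchangeable f {..<n} i j'} \<le> card {..<j}" by (rule card_mono) auto
    then show ?thesis using that W(2) by simp
  qed
  have "runs W (classes_com d k) s (n * ((1 + ((n * ((1 + ((n ^ (2 * k) * (test_time n k ?E + 2) + 2) + 1)) + 2) + 2) + Suc 1)) + 2) + 2) (A n)"
    unfolding classes_com_def
  proof (rule runs_For)
    show "A 0 (s\<lparr>regs := (regs s)(3 := 0)\<rparr>)" by (auto simp: A_def same_def holds_bits_def)
    show "regs s' 3 = int i \<and> aval n_exp s' = int n" if "A i s'" for i s'
      using that n0 by (auto simp: A_def)
    show "int n \<le> W" by (rule W)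
    fix i s1 assume i: "i < n" and s1: "A i s1"
    show "runs W (Seq (Assign 6 (Lit 0))
      (Seq (For 4 n_exp (Seq (Assign 7 (Lit 0)) (Seq (For 5 (n_power (2 * k)) (test_com d k)) (Assign 6 (Plus (Reg 6) (Reg 7))))))
         (Cond (Conj (Less (bound_exp d) n_exp) (Neg (Less (bound_exp d) (Times (Lit 2) (Reg 6)))))
           (Store 3 (Reg 3) (Lit 0)) (Store 3 (Reg 3) (Lit 1))))) s1
      (1 + ((n * ((1 + ((n ^ (2 * k) * (test_time n k ?E + 2) + 2) + 1)) + 2) + 2) + Suc 1))
      (\<lambda>s'. regs s' 3 = int i \<and> A (Suc i) (s'\<lparr>regs := (regs s')(3 := int (Suc i))\<rparr>))"
    proof (rule runs_Seq[where ?Q1.0 = "\<lambda>s'. A i s' \<and> regs s' 6 = 0"], goal_cases)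
      case 1
      show ?case using s1 W by (intro runs_Assign) (auto simp: A_def same_def)
    next
      case (2 s2)
      show ?case
      proof (rule runs_Seq[where ?Q1.0 = "B i n"], goal_cases)
        case 1
        show ?case
        proof (rule runs_For)
          show "B i 0 (s2\<lparr>regs := (regs s2)(4 := 0)\<rparr>)" using 2 by (auto simp: B_def A_def same_def)
          show "regs s' 4 = int j \<and> aval n_exp s' = int n" if "B i j s'" for j s'
            using that n0 by (auto simp: A_def B_def)
          show "int n \<le> W" by (rule W)
          fix j s3 assume j: "j < n" and s3: "B i j s3"
          show "runs W (Seq (Assign 7 (Lit 0)) (Seq (For 5 (n_power (2 * k)) (test_com d k)) (Assign 6 (Plus (Reg 6) (Reg 7))))) s3
            (1 + ((n ^ (2 * k) * (test_time n k ?E + 2) + 2) + 1))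
            (\<lambda>s'. regs s' 4 = int j \<and> B i (Suc j) (s'\<lparr>regs := (regs s')(4 := int (Suc j))\<rparr>))"
          proof (rule runs_Seq[where ?Q1.0 = "\<lambda>s'. B i j s' \<and> regs s' 7 = 0"], goal_cases)
            case 1
            show ?case using s3 W by (intro runs_Assign) (auto simp: A_def B_def same_def)
          next
            case (2 s4)
            show ?case
            proof (rule runs_Seq[where ?Q1.0 = "C i j (n ^ (2 * k))"], goal_cases)
              case 1
              show ?case
              proof (rule runs_For)
                show "C i j 0 (s4\<lparr>regs := (regs s4)(5 := 0)\<rparr>)" using 2 by (auto simp: C_def B_def A_def same_def)
                show "regs s' 5 = int c \<and> aval (n_power (2 * k)) s' = int (n ^ (2 * k))" if "C i j c s'" for c s'
                  using that n0[of s'] aval_n_power[of s' n] by (auto simp: A_def B_def C_def)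
                show "int (n ^ (2 * k)) \<le> W" by (rule W)
                fix c s5 assume c: "c < n ^ (2 * k)" and s5: "C i j c s5"
                have fr: "?frame s5" and r: "regs s5 3 = int i" "regs s5 4 = int j" "regs s5 5 = int c"
                  using s5 by (auto simp: A_def B_def C_def)
                show "runs W (test_com d k) s5 (test_time n k ?E)
                    (\<lambda>s'. regs s' 5 = int c \<and> C i j (Suc c) (s'\<lparr>regs := (regs s')(5 := int (Suc c))\<rparr>))"
                  by (rule runs_weaken[OF runs_test[OF i0[OF fr] Cs n r i j W(1-3)]])
                    (use s5 in \<open>auto simp: A_def B_def C_def same_def less_Suc_eq\<close>)
              qed
            next
              case (2 s5)
              have e: "(\<exists>c'<n ^ (2 * k). \<not> ?same c' i j) \<longleftrightarrow> \<not> exchangeable f {..<n} i j"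
                using ex[OF i j] by blast
              have "{j' \<in> {..<Suc j}. \<not> exchangeable f {..<n} i j'} = (if exchangeable f {..<n} i j
                  then {j' \<in> {..<j}. \<not> exchangeable f {..<n} i j'}
                  else insert j {j' \<in> {..<j}. \<not> exchangeable f {..<n} i j'})"
                by (auto simp: less_Suc_eq)
              then have "int (card {j' \<in> {..<Suc j}. \<not> exchangeable f {..<n} i j'}) =
                  int (card {j' \<in> {..<j}. \<not> exchangeable f {..<n} i j'}) + of_bool (\<not> exchangeable f {..<n} i j)"
                by simp
              then have v: "aval (Plus (Reg 6) (Reg 7)) s5 = int (card {j' \<in> {..<Suc j}. \<not> exchangeable f {..<n} i j'})"
                using 2 unfolding C_def B_def e by simp
              show ?case
              proof (rule runs_Assign)
                show "\<bar>aval (Plus (Reg 6) (Reg 7)) s5\<bar> \<le> W" unfolding v using card_le[of "Suc j" i] j by simp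
              qed (unfold v, use 2 in \<open>auto simp: A_def B_def C_def same_def\<close>)
            qed
          qed
        qed
      next
        case (2 s3)
        have cnt: "regs s3 6 = int (split_count f n i)" using 2 by (simp add: B_def split_count_def)
        have fr: "?frame s3" "regs s3 3 = int i" using 2 by (auto simp: A_def B_def)
        have K: "aval (bound_exp d) s3 = int K"
          unfolding K_def using i0[OF fr(1)] by (intro aval_bound_exp) (simp add: input_array_def)
        let ?cond = "Conj (Less (bound_exp d) n_exp) (Neg (Less (bound_exp d) (Times (Lit 2) (Reg 6))))"
        have "int K < int n \<longleftrightarrow> K < n" "int K < 2 * int (split_count f n i) \<longleftrightarrow> K < 2 * split_count f n i"
          by linarith+
        then have cond: "bval ?cond s3 \<longleftrightarrow> i \<notin> kernel_vars f n K"
          using K cnt n0[OF fr(1)] i by (simp add: kernel_vars_def not_le)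
        show ?case
        proof (rule runs_Cond)
          assume "bval ?cond s3"
          then have "i \<notin> kernel_vars f n K" using cond by blast
          then show "runs W (Store 3 (Reg 3) (Lit 0)) s3 1
              (\<lambda>s'. regs s' 3 = int i \<and> A (Suc i) (s'\<lparr>regs := (regs s')(3 := int (Suc i))\<rparr>))"
            using 2 W by (intro runs_Store) (auto simp: A_def B_def same_def holds_bits_def less_Suc_eq)
        next
          assume "\<not> bval ?cond s3"
          then have "i \<in> kernel_vars f n K" using cond by blast
          then show "runs W (Store 3 (Reg 3) (Lit 1)) s3 1
              (\<lambda>s'. regs s' 3 = int i \<and> A (Suc i) (s'\<lparr>regs := (regs s')(3 := int (Suc i))\<rparr>))"
            using 2 W by (intro runs_Store) (auto simp: A_def B_def same_def holds_bits_def less_Suc_eq)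
        qed
      qed
    qed
  qed
  then show ?thesis
    by (rule runs_weaken) (auto simp: A_def f_def K_def classes_time_def)
qed

section \<open>Writing the answer\<close>

definition written :: "int list \<Rightarrow> (int \<Rightarrow> int) \<Rightarrow> bool" where
  "written xs A \<longleftrightarrow> (\<forall>k<length xs. A (int k) = xs ! k)"

lemma written_snoc: "written xs A \<Longrightarrow> written (xs @ [v]) (A(int (length xs) := v))"
  by (auto simp: written_def nth_append less_Suc_eq)

lemma written_update: "written xs A \<Longrightarrow> k < length xs \<Longrightarrow> written (xs[k := v]) (A(int k := v))"
  by (auto simp: written_def nth_list_update)

definition outputs :: "int list \<Rightarrow> state \<Rightarrow> bool" where
  "outputs xs s \<longleftrightarrow> written xs (arrs s 1) \<and> regs s 10 = int (length xs)"

definition emit :: "aexp \<Rightarrow> com" where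
  "emit e = Seq (Store 1 (Reg 10) e) (Assign 10 (Plus (Reg 10) (Lit 1)))"

lemma runs_emit:
  assumes "outputs xs s" "\<bar>aval e s\<bar> \<le> W" "int (Suc (length xs)) \<le> W"
  shows "runs W (emit e) s 2 (\<lambda>s'. same {10} {1} s s' \<and> outputs (xs @ [aval e s]) s')"
proof -
  have "runs W (emit e) s (1 + 1) (\<lambda>s'. same {10} {1} s s' \<and> outputs (xs @ [aval e s]) s')"
    unfolding emit_def
  proof (rule runs_Seq[where ?Q1.0 = "\<lambda>s'. same {10} {1} s s' \<and> regs s' 10 = int (length xs) \<and>
      written (xs @ [aval e s]) (arrs s' 1)"])
    show "runs W (Store 1 (Reg 10) e) s 1 (\<lambda>s'. same {10} {1} s s' \<and> regs s' 10 = int (length xs) \<and>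
        written (xs @ [aval e s]) (arrs s' 1))"
      using assms by (intro runs_Store) (auto simp: outputs_def written_snoc)
    fix s' assume s': "same {10} {1} s s' \<and> regs s' 10 = int (length xs) \<and> written (xs @ [aval e s]) (arrs s' 1)"
    then show "runs W (Assign 10 (Plus (Reg 10) (Lit 1))) s' 1
        (\<lambda>s'. same {10} {1} s s' \<and> outputs (xs @ [aval e s]) s')"
      using assms(3) by (intro runs_Assign) (auto simp: outputs_def same_def)
  qed
  then show ?thesis by (simp add: numeral_2_eq_2)
qed

lemma runs_emits:
  assumes "\<And>e s'. e \<in> set es \<Longrightarrow> same {10} {1} s s' \<Longrightarrow> aval e s' = v e" "\<And>e. e \<in> set es \<Longrightarrow> \<bar>v e\<bar> \<le> W"
    and "outputs xs s" "int (length xs + length es) \<le> W"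
  shows "runs W (Seqs (map emit es)) s (length es * 2 + 1)
    (\<lambda>s'. same {10} {1} s s' \<and> outputs (xs @ map v es) s')"
proof -
  let ?I = "\<lambda>i s'. same {10} {1} s s' \<and> outputs (xs @ map v (take i es)) s'"
  have "runs W (Seqs (map emit es)) s (length (map emit es) * 2 + 1) (?I (length (map emit es)))"
  proof (rule runs_Seqs)
    show "?I 0 s" using assms(3) by simp
    fix i s' assume i: "i < length (map emit es)" and s': "?I i s'"
    have v: "aval (es ! i) s' = v (es ! i)" using assms(1) i s' by simp
    have t: "map v (take (Suc i) es) = map v (take i es) @ [v (es ! i)]"
      using i by (simp add: take_Suc_conv_app_nth)
    have "runs W (emit (es ! i)) s' 2 (\<lambda>s''. same {10} {1} s' s'' \<and>
        outputs ((xs @ map v (take i es)) @ [aval (es ! i) s']) s'')"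
    proof (rule runs_emit)
      show "outputs (xs @ map v (take i es)) s'" using s' by blast
      show "\<bar>aval (es ! i) s'\<bar> \<le> W" using assms(2) v i by simp
      show "int (Suc (length (xs @ map v (take i es)))) \<le> W" using assms(4) i by simp
    qed
    then have "runs W (emit (es ! i)) s' 2 (?I (Suc i))"
    proof (rule runs_weaken)
      fix s'' assume s'': "same {10} {1} s' s'' \<and>
        outputs ((xs @ map v (take i es)) @ [aval (es ! i) s']) s''"
      have "same {10} {1} s s''" using s' s'' same_trans[of _ _ s s' _ _ s''] by blast
      then show "?I (Suc i) s''" using s'' by (simp add: t v)
    qed simp
    then show "runs W (map emit es ! i) s' 2 (?I (Suc i))" using i by simp
  qed
  then show ?thesis by simp
qed

section \<open>Output of the kernel terms\<close>

definition encode_terms :: "(nat list \<times> int \<times> int) list \<Rightarrow> int list" where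
  "encode_terms ts = concat (map (\<lambda>(S, a, b). encode_vars S @ [a, b]) ts)"

lemma encode_terms_append [simp]: "encode_terms (ts @ us) = encode_terms ts @ encode_terms us"
  by (simp add: encode_terms_def)

lemma encode_terms_Nil [simp]: "encode_terms [] = []"
  by (simp add: encode_terms_def)

text \<open>Every term takes at least one word, so the term counter fits into a word as soon as the
  output position does.\<close>

lemma length_le_encode_terms: "length ts \<le> length (encode_terms ts)"
  by (induction ts) (auto simp: encode_terms_def)

definition emitted :: "int list \<Rightarrow> (nat list \<times> int \<times> int) list \<Rightarrow> state \<Rightarrow> bool" where
  "emitted pre ts s \<longleftrightarrow> outputs (pre @ encode_terms ts) s \<and> regs s 11 = int (length ts)"

text \<open>Output positions are kept in a register, so the length of the output is itself subject
  to the word bound. The condition passes to prefixes of the list of terms, which lets it be assumed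
  once for the complete output.\<close>

definition fits :: "int \<Rightarrow> int list \<Rightarrow> (nat list \<times> int \<times> int) list \<Rightarrow> bool" where
  "fits W pre ts \<longleftrightarrow> int (length pre + length (encode_terms ts)) \<le> W"

lemma fits_append: "fits W pre (ts @ us) \<Longrightarrow> fits W pre ts"
  by (simp add: fits_def)

lemma runs_Seqs_emitted:
  assumes "\<And>x s ts. x \<in> set L \<Longrightarrow> P s \<Longrightarrow> emitted pre ts s \<Longrightarrow> fits W pre (ts @ g x) \<Longrightarrow>
      runs W (h x) s T (\<lambda>s'. P s' \<and> emitted pre (ts @ g x) s')"
    and "P s" "emitted pre ts s" "fits W pre (ts @ concat (map g L))"
  shows "runs W (Seqs (map h L)) s (length L * T + 1) (\<lambda>s'. P s' \<and> emitted pre (ts @ concat (map g L)) s')"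
  using assms
proof (induction L arbitrary: s ts)
  case Nil
  then show ?case using runs_Skip[of "\<lambda>s'. P s' \<and> emitted pre ts s'" s W] by simp
next
  case (Cons x L)
  have "runs W (Seqs (map h (x # L))) s (T + (length L * T + 1))
      (\<lambda>s'. P s' \<and> emitted pre ((ts @ g x) @ concat (map g L)) s')"
    unfolding list.map Seqs.simps
  proof (rule runs_Seq)
    have "fits W pre (ts @ g x)"
      using fits_append[of W pre "ts @ g x" "concat (map g L)"] Cons.prems(4) by simp
    then show "runs W (h x) s T (\<lambda>s'. P s' \<and> emitted pre (ts @ g x) s')"
      using Cons.prems by simp
    show "runs W (Seqs (map h L)) s' (length L * T + 1) (\<lambda>s'. P s' \<and> emitted pre ((ts @ g x) @ concat (map g L)) s')"
      if "P s' \<and> emitted pre (ts @ g x) s'" for s'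
      using Cons.prems that by (intro Cons.IH) auto
  qed
  then show ?case by (simp add: add.assoc)
qed

text \<open>\<open>U\<close> and \<open>S\<close> are lists of positions in the tuple, known when
  the program is written; only the tuple in register 5 varies at run time. So all loops over subsets
  are unrolled.\<close>

definition term_com :: "nat \<Rightarrow> nat list \<Rightarrow> nat list \<Rightarrow> com" where
  "term_com l U S = Seq
    (Seqs (map emit (Lit (int (length S)) # map (digit 5) S @
      [Times (Lit ((-1) ^ (l - length U))) (Reg 0), Lit (2 ^ l)])))
    (Assign 11 (Plus (Reg 11) (Lit 1)))"

lemma runs_term:
  assumes n: "arrs s 0 0 = int n" "n > 0 \<or> l = 0" and c: "regs s 5 = int c" and S: "S \<in> set (List.subseqs [0..<l])"
    and e: "emitted pre ts s" "fits W pre (ts @ [(map ((!) (digits n l c)) S, (-1) ^ (l - length U) * regs s 0, 2 ^ l)])"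
    and W: "\<bar>regs s 0\<bar> \<le> W" "int n \<le> W" "2 ^ l \<le> W"
  shows "runs W (term_com l U S) s (2 * l + 8) (\<lambda>s'. same {10, 11} {1} s s' \<and>
    emitted pre (ts @ [(map ((!) (digits n l c)) S, (-1) ^ (l - length U) * regs s 0, 2 ^ l)]) s')"
proof -
  let ?D = "map ((!) (digits n l c)) S"
  let ?t = "(?D, (-1) ^ (l - length U) * regs s 0, 2 ^ l)"
  let ?es = "Lit (int (length S)) # map (digit 5) S @ [Times (Lit ((-1) ^ (l - length U))) (Reg 0), Lit (2 ^ l)]"
  let ?xs = "pre @ encode_terms ts"
  have Sl: "j < l" if "j \<in> set S" for j
  proof -
    have "set S \<in> Pow (set [0..<l])" using S subseqs_powset[of "[0..<l]"] by blast
    then show ?thesis using that by auto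
  qed
  have lenS: "length S \<le> l"
  proof -
    have "distinct S" using subseqs_distinctD[OF S] by simp
    then have "length S = card (set S)" by (simp add: distinct_card)
    also have "\<dots> \<le> card {..<l}" using Sl by (intro card_mono) auto
    finally show ?thesis by simp
  qed
  have "int l < 2 ^ l" by (rule of_nat_less_two_power)
  then have lW: "int (length S) \<le> W" using lenS W(3) by linarith
  have vals: "map (\<lambda>e. aval e s) ?es = encode_vars ?D @ [(-1) ^ (l - length U) * regs s 0, 2 ^ l]"
    using aval_digit[OF n(1) c] Sl by (simp add: encode_vars_def nth_digits)
  have "runs W (term_com l U S) s ((length ?es * 2 + 1) + 1) (\<lambda>s'. same {10, 11} {1} s s' \<and> emitted pre (ts @ [?t]) s')"
    unfolding term_com_def
  proof (rule runs_Seq[where ?Q1.0 = "\<lambda>s'. same {10} {1} s s' \<and> outputs (?xs @ map (\<lambda>e. aval e s) ?es) s'"])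
    show "runs W (Seqs (map emit ?es)) s (length ?es * 2 + 1)
      (\<lambda>s'. same {10} {1} s s' \<and> outputs (?xs @ map (\<lambda>e. aval e s) ?es) s')"
    proof (rule runs_emits)
      fix e s' assume "e \<in> set ?es" and s': "same {10} {1} s s'"
      have "aval (digit 5 j) s' = aval (digit 5 j) s" for j
        using s' aval_digit[OF n(1) c] aval_digit[of s' n 5 c] n c by (simp add: same_def)
      then show "aval e s' = aval e s" using s' \<open>e \<in> set ?es\<close> by (auto simp: same_def)
    next
      fix e assume "e \<in> set ?es"
      moreover have "\<bar>aval (digit 5 j) s\<bar> \<le> W" if "j \<in> set S" for j
      proof -
        have "c div n ^ j mod n \<le> n" using n(2) Sl[OF that] by (simp add: less_imp_le)
        then show ?thesis using aval_digit[OF n(1) c, of j] W(2) by linarith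
      qed
      ultimately show "\<bar>aval e s\<bar> \<le> W" using W lW by (auto simp: abs_mult)
    next
      show "outputs ?xs s" using e by (simp add: emitted_def)
      show "int (length ?xs + length ?es) \<le> W" using e(2) by (simp add: fits_def encode_terms_def encode_vars_def)
    qed
    fix s' assume s': "same {10} {1} s s' \<and> outputs (?xs @ map (\<lambda>e. aval e s) ?es) s'"
    then have "outputs (pre @ encode_terms (ts @ [?t])) s'"
      unfolding vals by (simp add: encode_terms_def)
    moreover have "regs s' 11 = int (length ts)" using s' e by (simp add: same_def emitted_def)
    moreover have "int (Suc (length ts)) \<le> W"
      using length_le_encode_terms[of "ts @ [?t]"] e(2) by (simp add: fits_def)
    ultimately show "runs W (Assign 11 (Plus (Reg 11) (Lit 1))) s' 1
        (\<lambda>s'. same {10, 11} {1} s s' \<and> emitted pre (ts @ [?t]) s')"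
      using s' by (intro runs_Assign) (auto simp: emitted_def outputs_def same_def)
  qed
  then show ?thesis by (rule runs_weaken) (use lenS in auto)
qed

text \<open>Register 6 starts at the size of \<open>U\<close> and counts the positions outside
  \<open>V\<close> passed so far. Positions in \<open>V\<close> are cleared first, and those
  belonging to \<open>U\<close> are set afterwards.\<close>

definition fill_com :: "nat list \<Rightarrow> com" where
  "fill_com U = Seq (Assign 6 (Lit (int (length U))))
    (Seq (For 2 n_exp (Cond (Equal (Arr 3 (Reg 2)) (Lit 1)) (Store 2 (Reg 2) (Lit 0))
       (Seq (Cond (Less (Reg 6) (Div n_exp (Lit 2))) (Store 2 (Reg 2) (Lit 1)) (Store 2 (Reg 2) (Lit 0)))
            (Assign 6 (Plus (Reg 6) (Lit 1))))))
     (Seqs (map (\<lambda>j. Store 2 (digit 5 j) (Lit 1)) U)))"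

lemma runs_fill:
  assumes n: "arrs s 0 0 = int n" "n > 0 \<or> l = 0" and c: "regs s 5 = int c"
    and V: "holds_bits n (\<lambda>i. i \<in> V) (arrs s 3)"
    and T: "set (digits n l c) \<subseteq> V" "V \<subseteq> {..<n}" "distinct (digits n l c)"
    and U: "U \<in> set (List.subseqs [0..<l])"
    and W: "1 \<le> W" "int (n + l) \<le> W"
  shows "runs W (fill_com U) s (1 + ((n * (4 + 2) + 2) + (l + 1))) (\<lambda>s'. same {2, 6} {2} s s' \<and>
    holds_bits n (fill n V (set (map ((!) (digits n l c)) U))) (arrs s' 2))"
proof -
  let ?D = "digits n l c"
  have setU: "set U \<subseteq> {..<l}" using U subseqs_powset[of "[0..<l]"] by (auto simp: atLeast0LessThan)
  have dU: "distinct U" using subseqs_distinctD[OF U] by simp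
  have "length U = card (set U)" using dU by (simp add: distinct_card)
  also have "\<dots> \<le> card {..<l}" using setU by (intro card_mono) auto
  finally have lenU: "length U \<le> l" by simp
  have cardU: "card (set (map ((!) ?D) U)) = length U"
  proof -
    have "inj_on ((!) ?D) (set U)"
      using T(3) setU by (auto intro!: inj_on_nth)
    then have "distinct (map ((!) ?D) U)" using dU by (simp add: distinct_map)
    then show ?thesis using distinct_card by fastforce
  qed
  \<comment> \<open>The number that \<open>fill\<close> compares with \<open>n div 2\<close>. Since
    the tuple is distinct, the length of \<open>U\<close> is the size of the set it selects.\<close>
  define rk where "rk = (\<lambda>v. length U + card {w \<in> {..<v}. w \<notin> V})"
  define b where "b = (\<lambda>v. v \<notin> V \<and> rk v < n div 2)"
  have rk: "rk v \<le> l + v" for v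
  proof -
    have "card {w \<in> {..<v}. w \<notin> V} \<le> card {..<v}" by (rule card_mono) auto
    then show ?thesis using lenU by (simp add: rk_def)
  qed
  have rk_0: "rk 0 = length U" by (simp add: rk_def)
  have rk_Suc: "rk (Suc v) = rk v + of_bool (v \<notin> V)" for v
  proof -
    have "{w \<in> {..<Suc v}. w \<notin> V} = (if v \<in> V then {w \<in> {..<v}. w \<notin> V} else insert v {w \<in> {..<v}. w \<notin> V})"
      by (auto simp: less_Suc_eq)
    then show ?thesis by (simp add: rk_def)
  qed
  define I where "I = (\<lambda>v s'. same {2, 6} {2} s s' \<and> regs s' 2 = int v \<and> regs s' 6 = int (rk v) \<and>
    holds_bits v b (arrs s' 2))"
  let ?Q = "\<lambda>s'. same {2, 6} {2} s s' \<and> holds_bits n (fill n V (set (map ((!) ?D) U))) (arrs s' 2)"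
  have "runs W (fill_com U) s (1 + ((n * (4 + 2) + 2) + (length U * 1 + 1))) ?Q"
    unfolding fill_com_def
  proof (rule runs_Seq[where ?Q1.0 = "\<lambda>s'. same {2, 6} {2} s s' \<and> regs s' 6 = int (length U)"], goal_cases)
    case 1
    show ?case using W lenU by (intro runs_Assign) (auto simp: same_def)
  next
    case (2 s1)
    show ?case
    proof (rule runs_Seq[where ?Q1.0 = "I n"], goal_cases)
      case 1
      show ?case
      proof (rule runs_For)
        show "I 0 (s1\<lparr>regs := (regs s1)(2 := 0)\<rparr>)" using 2 by (auto simp: I_def same_def holds_bits_def rk_0)
        show "regs s' 2 = int v \<and> aval n_exp s' = int n" if "I v s'" for v s'
          using that n by (auto simp: I_def same_def)
        show "int n \<le> W" using W by simp
        fix v s2 assume v: "v < n" and s2: "I v s2"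
        let ?J = "\<lambda>s'. regs s' 2 = int v \<and> I (Suc v) (s'\<lparr>regs := (regs s')(2 := int (Suc v))\<rparr>)"
        have flag: "arrs s2 3 (int v) = of_bool (v \<in> V)" using s2 V v by (simp add: I_def same_def holds_bits_def)
        have "runs W (Cond (Equal (Arr 3 (Reg 2)) (Lit 1)) (Store 2 (Reg 2) (Lit 0))
           (Seq (Cond (Less (Reg 6) (Div n_exp (Lit 2))) (Store 2 (Reg 2) (Lit 1)) (Store 2 (Reg 2) (Lit 0)))
            (Assign 6 (Plus (Reg 6) (Lit 1))))) s2 (Suc (Suc 1 + 1)) ?J"
        proof (rule runs_Cond)
          assume "bval (Equal (Arr 3 (Reg 2)) (Lit 1)) s2"
          then have vV: "v \<in> V" using flag s2 by (auto simp: I_def)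
          have "runs W (Store 2 (Reg 2) (Lit 0)) s2 1 ?J"
            using s2 W vV by (intro runs_Store) (auto simp: I_def same_def holds_bits_def less_Suc_eq b_def rk_Suc)
          then show "runs W (Store 2 (Reg 2) (Lit 0)) s2 (Suc 1 + 1) ?J" by (rule runs_weaken) auto
        next
          assume "\<not> bval (Equal (Arr 3 (Reg 2)) (Lit 1)) s2"
          then have vV: "v \<notin> V" using flag s2 by (auto simp: I_def)
          let ?K = "\<lambda>s'. same {2, 6} {2} s s' \<and> regs s' 2 = int v \<and> regs s' 6 = int (rk v) \<and>
            holds_bits (Suc v) b (arrs s' 2)"
          show "runs W (Seq (Cond (Less (Reg 6) (Div n_exp (Lit 2))) (Store 2 (Reg 2) (Lit 1)) (Store 2 (Reg 2) (Lit 0)))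
            (Assign 6 (Plus (Reg 6) (Lit 1)))) s2 (Suc 1 + 1) ?J"
          proof (rule runs_Seq[where ?Q1.0 = ?K], goal_cases)
            case 1
            have "arrs s2 0 0 = int n" using s2 n by (simp add: I_def same_def)
            moreover have "int (rk v) < int n div 2 \<longleftrightarrow> rk v < n div 2" by presburger
            ultimately have cond: "bval (Less (Reg 6) (Div n_exp (Lit 2))) s2 \<longleftrightarrow> b v"
              using s2 vV by (simp add: I_def b_def)
            show ?case
            proof (rule runs_Cond)
              assume "bval (Less (Reg 6) (Div n_exp (Lit 2))) s2"
              then have "b v" using cond by blast
              then show "runs W (Store 2 (Reg 2) (Lit 1)) s2 1 ?K"
                using s2 W by (intro runs_Store) (auto simp: I_def same_def holds_bits_def less_Suc_eq)
            next
              assume "\<not> bval (Less (Reg 6) (Div n_exp (Lit 2))) s2"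
              then have "\<not> b v" using cond by blast
              then show "runs W (Store 2 (Reg 2) (Lit 0)) s2 1 ?K"
                using s2 W by (intro runs_Store) (auto simp: I_def same_def holds_bits_def less_Suc_eq)
            qed
          next
            case (2 s3)
            have "rk v + 1 \<le> n + l" using rk[of v] v by simp
            then have "int (rk v) + 1 \<le> W" using W(2) by linarith
            then show ?case using 2 vV
              by (intro runs_Assign) (auto simp: I_def same_def rk_Suc)
          qed
        qed
        then show "runs W (Cond (Equal (Arr 3 (Reg 2)) (Lit 1)) (Store 2 (Reg 2) (Lit 0))
           (Seq (Cond (Less (Reg 6) (Div n_exp (Lit 2))) (Store 2 (Reg 2) (Lit 1)) (Store 2 (Reg 2) (Lit 0)))
            (Assign 6 (Plus (Reg 6) (Lit 1))))) s2 4 ?J" by (simp add: numeral_eq_Suc)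
      qed
    next
      case (2 s2)
      let ?L = "\<lambda>i s'. same {2, 6} {2} s s' \<and>
        holds_bits n (\<lambda>v. b v \<or> v \<in> set (map ((!) ?D) (take i U))) (arrs s' 2)"
      let ?cs = "map (\<lambda>j. Store 2 (digit 5 j) (Lit 1)) U"
      have "runs W (Seqs ?cs) s2 (length ?cs * 1 + 1) (?L (length ?cs))"
      proof (rule runs_Seqs)
        show "?L 0 s2" using 2 by (auto simp: I_def)
        fix i s3 assume i: "i < length ?cs" and s3: "?L i s3"
        have "U ! i \<in> {..<l}" using i setU nth_mem[of i U] by (metis length_map subsetD)
        then have j: "U ! i < l" by simp
        then have n0: "n > 0" using n(2) by auto
        have "arrs s3 0 0 = int n" "regs s3 5 = int c" using s3 n c by (auto simp: same_def)
        then have v: "aval (digit 5 (U ! i)) s3 = int (?D ! (U ! i))" using aval_digit j by (simp add: nth_digits)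
        have t: "take (Suc i) U = take i U @ [U ! i]" using i by (simp add: take_Suc_conv_app_nth)
        have "runs W (Store 2 (digit 5 (U ! i)) (Lit 1)) s3 1 (?L (Suc i))"
          unfolding t by (rule runs_Store) (unfold v, use s3 W in \<open>auto simp: same_def holds_bits_def\<close>)
        then show "runs W (?cs ! i) s3 1 (?L (Suc i))" using i by simp
      qed
      then show ?case
      proof (rule runs_weaken)
        fix s' assume s': "?L (length ?cs) s'"
        have "b v \<or> v \<in> set (map ((!) ?D) U) \<longleftrightarrow> fill n V (set (map ((!) ?D) U)) v" for v
        proof -
          have "set (map ((!) ?D) U) \<subseteq> V"
          proof -
            have "?D ! j \<in> V" if "j \<in> set U" for j
            proof -
              have "j < length ?D" using that setU by auto
              then show ?thesis using T(1) nth_mem by blast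
            qed
            then show ?thesis by auto
          qed
          then show ?thesis unfolding fill_def cardU b_def rk_def by auto
        qed
        then show "?Q s'" using s' by (simp add: holds_bits_def)
      qed simp
    qed
  qed
  then show ?thesis by (rule runs_weaken) (use lenU in auto)
qed

text \<open>Subsequences of the tuple are images of subsequences of positions, so the shape of the
  output does not depend on the tuple and can be fixed in the program text.\<close>

lemma terms_at_digits:
  "terms_at F (digits n l c) = concat (map (\<lambda>U. map (\<lambda>S.
     (map ((!) (digits n l c)) S, (-1) ^ (l - length U) * F (set (map ((!) (digits n l c)) U)), 2 ^ l))
     (List.subseqs [0..<l])) (List.subseqs [0..<l]))"
proof -
  have "List.subseqs (digits n l c) = map (map ((!) (digits n l c))) (List.subseqs [0..<l])"
    using map_nth[of "digits n l c"] by (simp flip: subseqs_map)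
  then show ?thesis by (simp add: terms_at_def o_def)
qed

definition subset_com :: "nat \<Rightarrow> nat \<Rightarrow> nat list \<Rightarrow> com" where
  "subset_com d l U = Seq (fill_com U) (Seq (eval_com d) (Seqs (map (term_com l U) (List.subseqs [0..<l]))))"

definition subset_time :: "nat \<Rightarrow> nat \<Rightarrow> nat \<Rightarrow> nat" where
  "subset_time n l E = (1 + ((n * (4 + 2) + 2) + (l + 1))) + (E + (2 ^ l * (2 * l + 8) + 1))"

fun all_bexp :: "bexp list \<Rightarrow> bexp" where
  "all_bexp [] = Equal (Lit 0) (Lit 0)"
| "all_bexp (b # bs) = Conj b (all_bexp bs)"

lemma bval_all_bexp [simp]: "bval (all_bexp bs) s \<longleftrightarrow> (\<forall>b\<in>set bs. bval b s)"
  by (induction bs) auto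

text \<open>Comparing neighbouring digits suffices for strict increase. For \<open>l = 0\<close>
  both lists of conditions are empty, so the empty tuple passes.\<close>

definition tuple_com :: "nat \<Rightarrow> nat \<Rightarrow> com" where
  "tuple_com d l = Cond (all_bexp (map (\<lambda>j. Equal (Arr 3 (digit 5 j)) (Lit 1)) [0..<l] @
      map (\<lambda>j. Less (digit 5 j) (digit 5 (Suc j))) [0..<l - 1]))
    (Seqs (map (subset_com d l) (List.subseqs [0..<l]))) Skip"

definition tuple_time :: "nat \<Rightarrow> nat \<Rightarrow> nat \<Rightarrow> nat" where
  "tuple_time n l E = Suc (2 ^ l * subset_time n l E + 1)"

definition level_terms :: "nat \<Rightarrow> nat set \<Rightarrow> (nat set \<Rightarrow> int) \<Rightarrow> nat \<Rightarrow> nat \<Rightarrow> (nat list \<times> int \<times> int) list" where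
  "level_terms n V F l c =
     (if sorted_wrt (<) (digits n l c) \<and> set (digits n l c) \<subseteq> V then terms_at F (digits n l c) else [])"

lemma kernel_terms_eq_levels:
  "kernel_terms n d V F = concat (map (\<lambda>l. concat (map (level_terms n V F l) [0..<n ^ l])) [0..<Suc d])"
proof -
  have "level_terms n V F l = (\<lambda>c. if sorted_wrt (<) (digits n l c) \<and> set (digits n l c) \<subseteq> V
      then terms_at F (digits n l c) else [])" for l
    by (rule ext) (rule level_terms_def)
  then show ?thesis by (simp only: kernel_terms_def)
qed

definition level_com :: "nat \<Rightarrow> nat \<Rightarrow> com" where
  "level_com d l = For 5 (n_power l) (tuple_com d l)"

definition levels_com :: "nat \<Rightarrow> com" where
  "levels_com d = Seqs (map (level_com d) [0..<Suc d])"

definition levels_time :: "nat \<Rightarrow> nat \<Rightarrow> nat \<Rightarrow> nat" where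
  "levels_time n d E = Suc d * (Suc n ^ d * (tuple_time n d E + 2) + 2) + 1"

lemma tuple_time_mono: "l \<le> d \<Longrightarrow> tuple_time n l E \<le> tuple_time n d E"
  unfolding tuple_time_def subset_time_def
  by (intro Suc_le_mono[THEN iffD2] add_mono mult_mono order_refl power_increasing) auto

lemma length_encode_terms_concat_take:
  "fits W pre (ts @ concat (map g L)) \<Longrightarrow> fits W pre (ts @ concat (map g (take i L)))"
  by (metis append_assoc append_take_drop_id concat_append fits_append map_append)

context
  fixes W :: int and d n :: nat and Cs :: "constraint list" and t :: nat and V :: "nat set" and s0 :: state
  assumes inp: "input_array d n Cs t (arrs s0 0)" and Cs: "csp_instance d n Cs"
    and V: "V \<subseteq> {..<n}" "holds_bits n (\<lambda>i. i \<in> V) (arrs s0 3)"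
    and W: "1 \<le> W" "int (n + d) \<le> W" "int (length Cs) \<le> W" "2 ^ d \<le> W"
begin

abbreviation "subset_val U \<equiv> int (csp_val Cs (signs n (fill n V U)))"
abbreviation "step_time \<equiv> eval_time (length (remdups Cs))"

lemma frame_inputs:
  assumes "same R {1, 2} s0 s"
  shows "input_array d n Cs t (arrs s 0)" "arrs s 0 0 = int n" "holds_bits n (\<lambda>i. i \<in> V) (arrs s 3)"
  using assms inp V by (auto simp: same_def input_array_def)

lemma runs_subset:
  assumes s: "same R {1, 2} s0 s" "{0, 1, 2, 6, 10, 11} \<subseteq> R" and c: "regs s 5 = int c"
    and l: "l \<le> d" "n > 0 \<or> l = 0"
    and T: "set (digits n l c) \<subseteq> V" "distinct (digits n l c)"
    and U: "U \<in> set (List.subseqs [0..<l])"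
    and e: "emitted pre ts s"
    and fits: "fits W pre (ts @ map (\<lambda>S.
      (map ((!) (digits n l c)) S, (-1) ^ (l - length U) * subset_val (set (map ((!) (digits n l c)) U)), 2 ^ l))
      (List.subseqs [0..<l]))"
  shows "runs W (subset_com d l U) s (subset_time n l step_time)
    (\<lambda>s'. (same R {1, 2} s0 s' \<and> regs s' 5 = int c) \<and> emitted pre (ts @ map (\<lambda>S.
      (map ((!) (digits n l c)) S, (-1) ^ (l - length U) * subset_val (set (map ((!) (digits n l c)) U)), 2 ^ l))
      (List.subseqs [0..<l])) s')"
proof -
  let ?b = "fill n V (set (map ((!) (digits n l c)) U))"
  let ?v = "int (csp_val Cs (signs n ?b))"
  let ?g = "\<lambda>S. (map ((!) (digits n l c)) S, (-1) ^ (l - length U) * ?v, 2 ^ l :: int)"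
  let ?P = "\<lambda>s'. same R {1, 2} s0 s' \<and> regs s' 5 = int c"
  let ?G = "\<lambda>s'. ?P s' \<and> regs s' 0 = ?v"
  have v: "\<bar>?v\<bar> \<le> W" using W(3) by (simp add: csp_val_def) (meson le_trans length_filter_le of_nat_mono order_trans)
  show ?thesis
    unfolding subset_com_def subset_time_def
  proof (rule runs_Seq[where ?Q1.0 = "\<lambda>s'. ?P s' \<and> holds_bits n ?b (arrs s' 2) \<and> emitted pre ts s'"], goal_cases)
    case 1
    show ?case
    proof (rule runs_weaken[OF runs_fill[OF frame_inputs(2)[OF s(1)] l(2) c frame_inputs(3)[OF s(1)] T(1) V(1) T(2) U W(1)]])
      show "int (n + l) \<le> W" using W(2) l(1) by linarith
      fix s' assume s': "same {2, 6} {2} s s' \<and> holds_bits n ?b (arrs s' 2)"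
      then have "same R {1, 2} s0 s'" using same_trans[OF s(1), of "{2, 6}" "{2}" s' R "{1, 2}"] s(2) by blast
      moreover have "emitted pre ts s'" "regs s' 5 = int c"
        using s' e c by (auto simp: emitted_def outputs_def same_def)
      ultimately show "?P s' \<and> holds_bits n ?b (arrs s' 2) \<and> emitted pre ts s'" using s' by blast
    qed simp
  next
    case (2 s1)
    show ?case
    proof (rule runs_Seq[where ?Q1.0 = "\<lambda>s'. ?G s' \<and> emitted pre ts s'"], goal_cases)
      case 1
      have i1: "input_array d n Cs t (arrs s1 0)" and h: "holds_bits n ?b (arrs s1 2)"
        using frame_inputs 2 by blast+
      show ?case
      proof (rule runs_weaken[OF runs_eval[OF i1 Cs h W(3)]])
        fix s' assume s': "same {0, 1} {} s1 s' \<and> regs s' 0 = ?v"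
        then have "same R {1, 2} s0 s'" using same_trans[of R "{1, 2}" s0 s1 "{0, 1}" "{}" s' R "{1, 2}"] 2 s(2) by blast
        moreover have "emitted pre ts s'" "regs s' 5 = int c"
          using s' 2 by (auto simp: emitted_def outputs_def same_def)
        ultimately show "?G s' \<and> emitted pre ts s'" using s' by blast
      qed simp
    next
      case (2 s2)
      have "runs W (Seqs (map (term_com l U) (List.subseqs [0..<l]))) s2
          (length (List.subseqs [0..<l]) * (2 * l + 8) + 1)
          (\<lambda>s'. ?G s' \<and> emitted pre (ts @ concat (map (\<lambda>S. [?g S]) (List.subseqs [0..<l]))) s')"
      proof (rule runs_Seqs_emitted)
        show "?G s2" "emitted pre ts s2" using 2 by blast+
        show "fits W pre (ts @ concat (map (\<lambda>S. [?g S]) (List.subseqs [0..<l])))"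
          using fits by (simp add: concat_map_singleton)
        fix S s3 ts' assume S: "S \<in> set (List.subseqs [0..<l])" and s3: "?G s3" "emitted pre ts' s3"
          and f: "fits W pre (ts' @ [?g S])"
        show "runs W (term_com l U S) s3 (2 * l + 8) (\<lambda>s'. ?G s' \<and> emitted pre (ts' @ [?g S]) s')"
        proof -
          have v3: "regs s3 0 = ?v" using s3 by blast
          have "runs W (term_com l U S) s3 (2 * l + 8) (\<lambda>s'. same {10, 11} {1} s3 s' \<and>
            emitted pre (ts' @ [(map ((!) (digits n l c)) S, (-1) ^ (l - length U) * regs s3 0, 2 ^ l)]) s')"
          proof (rule runs_term[OF _ l(2) _ S s3(2)])
            show "arrs s3 0 0 = int n" using frame_inputs s3 by blast
            show "regs s3 5 = int c" using s3 by blast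
            show "fits W pre (ts' @ [(map ((!) (digits n l c)) S, (-1) ^ (l - length U) * regs s3 0, 2 ^ l)])"
              unfolding v3 by (rule f)
            show "\<bar>regs s3 0\<bar> \<le> W" unfolding v3 by (rule v)
            show "int n \<le> W" using W(2) by simp
            show "2 ^ l \<le> W" using power_increasing[OF l(1), of "2 :: int"] W(4) by linarith
          qed
          then show ?thesis
          proof (rule runs_weaken)
            fix s' assume s': "same {10, 11} {1} s3 s' \<and>
              emitted pre (ts' @ [(map ((!) (digits n l c)) S, (-1) ^ (l - length U) * regs s3 0, 2 ^ l)]) s'"
            have "same R {1, 2} s0 s'" using same_trans[of R "{1, 2}" s0 s3 "{10, 11}" "{1}" s' R "{1, 2}"] s3 s' s(2) by blast
            moreover have "regs s' 5 = int c" "regs s' 0 = ?v" using s' s3 by (auto simp: same_def)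
            ultimately show "?G s' \<and> emitted pre (ts' @ [?g S]) s'" using s' v3 by simp
          qed simp
        qed
      qed
      then show ?case by (rule runs_weaken) (auto simp: length_subseqs concat_map_singleton)
    qed
  qed
qed

lemma runs_tuple:
  assumes s: "same R {1, 2} s0 s" "{0, 1, 2, 6, 10, 11} \<subseteq> R" and c: "regs s 5 = int c"
    and l: "l \<le> d" "n > 0 \<or> l = 0" and e: "emitted pre ts s"
    and fits: "fits W pre (ts @ level_terms n V subset_val l c)"
  shows "runs W (tuple_com d l) s (tuple_time n l step_time)
    (\<lambda>s'. (same R {1, 2} s0 s' \<and> regs s' 5 = int c) \<and>
      emitted pre (ts @ level_terms n V subset_val l c) s')"
proof -
  let ?T = "digits n l c"
  let ?ok = "sorted_wrt (<) ?T \<and> set ?T \<subseteq> V"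
  let ?P = "\<lambda>s'. same R {1, 2} s0 s' \<and> regs s' 5 = int c"
  have dig: "aval (digit 5 j) s = int (?T ! j)" if "j < l" for j
    using aval_digit[OF frame_inputs(2)[OF s(1)] c] that by (simp add: nth_digits)
  have less: "?T ! j < n" if "j < l" for j using that l(2) by (simp add: nth_digits)
  have "arrs s 3 (int (?T ! j)) = of_bool (?T ! j \<in> V)" if "j < l" for j
    using frame_inputs(3)[OF s(1)] less[OF that] by (simp add: holds_bits_def)
  then have eq1: "(\<forall>j\<in>{0..<l}. arrs s 3 (aval (digit 5 j) s) = 1) \<longleftrightarrow> set ?T \<subseteq> V"
  proof -
    assume a: "\<And>j. j < l \<Longrightarrow> arrs s 3 (int (?T ! j)) = of_bool (?T ! j \<in> V)"
    have "(\<forall>j\<in>{0..<l}. arrs s 3 (aval (digit 5 j) s) = 1) \<longleftrightarrow> (\<forall>j\<in>{0..<l}. ?T ! j \<in> V)"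
      by (intro ball_cong refl) (simp add: dig a)
    also have "\<dots> \<longleftrightarrow> (\<forall>v\<in>set ?T. v \<in> V)"
      using all_set_conv_all_nth[of ?T "\<lambda>v. v \<in> V"] by auto
    finally show ?thesis by (simp only: subset_eq)
  qed
  have eq2: "(\<forall>j\<in>{0..<l - 1}. aval (digit 5 j) s < aval (digit 5 (Suc j)) s) \<longleftrightarrow> sorted_wrt (<) ?T"
    using dig by (auto simp: sorted_wrt_iff_nth_Suc_transp less_diff_conv)
  have cond: "bval (all_bexp (map (\<lambda>j. Equal (Arr 3 (digit 5 j)) (Lit 1)) [0..<l] @
      map (\<lambda>j. Less (digit 5 j) (digit 5 (Suc j))) [0..<l - 1])) s \<longleftrightarrow> ?ok"
    unfolding eq1[symmetric] eq2[symmetric] by (simp add: ball_Un conj_commute del: One_nat_def)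
  show ?thesis
    unfolding tuple_com_def tuple_time_def
  proof (rule runs_Cond, goal_cases)
    case 1
    then have ok: "sorted_wrt (<) ?T" "set ?T \<subseteq> V" using cond by blast+
    let ?g = "\<lambda>U. map (\<lambda>S. (map ((!) ?T) S, (-1) ^ (l - length U) * subset_val (set (map ((!) ?T) U)), 2 ^ l :: int))
      (List.subseqs [0..<l])"
    have tm: "terms_at subset_val ?T = concat (map ?g (List.subseqs [0..<l]))" by (rule terms_at_digits)
    have "runs W (Seqs (map (subset_com d l) (List.subseqs [0..<l]))) s
      (length (List.subseqs [0..<l]) * subset_time n l step_time + 1)
      (\<lambda>s'. ?P s' \<and> emitted pre (ts @ concat (map ?g (List.subseqs [0..<l]))) s')"
    proof (rule runs_Seqs_emitted)
      show "?P s" "emitted pre ts s" using s c e by blast+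
      show "fits W pre (ts @ concat (map ?g (List.subseqs [0..<l])))" using fits ok tm by (simp only: level_terms_def simp_thms if_True)
      fix U s1 ts' assume U: "U \<in> set (List.subseqs [0..<l])" and s1: "?P s1" "emitted pre ts' s1"
        and f: "fits W pre (ts' @ ?g U)"
      show "runs W (subset_com d l U) s1 (subset_time n l step_time) (\<lambda>s'. ?P s' \<and> emitted pre (ts' @ ?g U) s')"
        by (rule runs_subset[OF _ s(2) _ l ok(2) _ U s1(2) f]) (use s1 ok in \<open>auto simp: strict_sorted_iff\<close>)
    qed
    moreover have "level_terms n V subset_val l c = concat (map ?g (List.subseqs [0..<l]))"
      using ok tm by (simp only: level_terms_def simp_thms if_True)
    ultimately show ?case by (simp add: length_subseqs)
  next
    case 2
    then have "\<not> ?ok" using cond by blast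
    then have lt: "level_terms n V subset_val l c = []" unfolding level_terms_def by (rule if_not_P)
    have "?P s \<and> emitted pre (ts @ []) s" using s c e by simp
    then show ?case
      unfolding lt by (intro runs_weaken[OF runs_Skip[of "\<lambda>s. ?P s \<and> emitted pre (ts @ []) s"]]) auto
  qed
qed

lemma runs_level:
  assumes s: "same {0, 1, 2, 5, 6, 10, 11} {1, 2} s0 s" and l: "l \<le> d" and nW: "int (n ^ l) \<le> W"
    and e: "emitted pre ts s" and fits: "fits W pre (ts @ concat (map (level_terms n V subset_val l) [0..<n ^ l]))"
  shows "runs W (level_com d l) s (Suc n ^ d * (tuple_time n d step_time + 2) + 2)
    (\<lambda>s'. same {0, 1, 2, 5, 6, 10, 11} {1, 2} s0 s' \<and>
      emitted pre (ts @ concat (map (level_terms n V subset_val l) [0..<n ^ l])) s')"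
proof -
  let ?R = "{0, 1, 2, 5, 6, 10, 11} :: nat set"
  let ?t = "level_terms n V subset_val l"
  define I where "I = (\<lambda>c s'. (same ?R {1, 2} s0 s' \<and> regs s' 5 = int c) \<and>
    emitted pre (ts @ concat (map ?t [0..<c])) s')"
  have "runs W (level_com d l) s (n ^ l * (tuple_time n l step_time + 2) + 2) (I (n ^ l))"
    unfolding level_com_def
  proof (rule runs_For)
    show "I 0 (s\<lparr>regs := (regs s)(5 := 0)\<rparr>)" using s e by (auto simp: I_def same_def emitted_def outputs_def)
    show "regs s' 5 = int c \<and> aval (n_power l) s' = int (n ^ l)" if "I c s'" for c s'
      using that aval_n_power[OF frame_inputs(2)] by (auto simp: I_def)
    fix c s1 assume c: "c < n ^ l" and s1: "I c s1"
    \<comment> \<open>For \<open>n = 0\<close> the body is reached only at level 0, because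
      \<open>0^0 = 1\<close>; so the digits that are used are always proper variables.\<close>
    have "c < n ^ l \<Longrightarrow> n > 0 \<or> l = 0" by (cases "n = 0"; cases l) auto
    then have n0: "n > 0 \<or> l = 0" using c by blast
    have tk: "[0..<Suc c] = take (Suc c) [0..<n ^ l]" using c by (simp add: take_upt)
    have "fits W pre (ts @ concat (map ?t [0..<Suc c]))"
      unfolding tk by (rule length_encode_terms_concat_take[OF fits])
    then have "fits W pre ((ts @ concat (map ?t [0..<c])) @ ?t c)" by simp
    then have "runs W (tuple_com d l) s1 (tuple_time n l step_time)
      (\<lambda>s'. (same ?R {1, 2} s0 s' \<and> regs s' 5 = int c) \<and>
        emitted pre ((ts @ concat (map ?t [0..<c])) @ ?t c) s')"
      using s1 l n0 by (intro runs_tuple) (auto simp: I_def)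
    then show "runs W (tuple_com d l) s1 (tuple_time n l step_time)
      (\<lambda>s'. regs s' 5 = int c \<and> I (Suc c) (s'\<lparr>regs := (regs s')(5 := int (Suc c))\<rparr>))"
      by (rule runs_weaken) (auto simp: I_def same_def emitted_def outputs_def)
  qed (rule nW)
  then show ?thesis
  proof (rule runs_weaken)
    have "n ^ l \<le> Suc n ^ l" by (intro power_mono) auto
    also have "\<dots> \<le> Suc n ^ d" using l by (intro power_increasing) auto
    finally show "n ^ l * (tuple_time n l step_time + 2) + 2 \<le> Suc n ^ d * (tuple_time n d step_time + 2) + 2"
      using tuple_time_mono[OF l] by (intro add_mono mult_mono) auto
  qed (auto simp: I_def)
qed

lemma runs_levels:
  assumes s: "same {0, 1, 2, 5, 6, 10, 11} {1, 2} s0 s" and nW: "int (Suc n ^ d) \<le> W"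
    and e: "emitted pre [] s" and fits: "fits W pre (kernel_terms n d V subset_val)"
  shows "runs W (levels_com d) s (levels_time n d step_time)
    (\<lambda>s'. same {0, 1, 2, 5, 6, 10, 11} {1, 2} s0 s' \<and> emitted pre (kernel_terms n d V subset_val) s')"
proof -
  let ?g = "\<lambda>l. concat (map (level_terms n V subset_val l) [0..<n ^ l])"
  have k: "kernel_terms n d V subset_val = [] @ concat (map ?g [0..<Suc d])"
    by (simp only: kernel_terms_eq_levels append_Nil)
  have "runs W (levels_com d) s (length [0..<Suc d] * (Suc n ^ d * (tuple_time n d step_time + 2) + 2) + 1)
    (\<lambda>s'. same {0, 1, 2, 5, 6, 10, 11} {1, 2} s0 s' \<and> emitted pre ([] @ concat (map ?g [0..<Suc d])) s')"
    unfolding levels_com_def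
  proof (rule runs_Seqs_emitted)
    show "fits W pre ([] @ concat (map ?g [0..<Suc d]))" using fits unfolding k .
    fix l s1 ts assume l: "l \<in> set [0..<Suc d]" and s1: "same {0, 1, 2, 5, 6, 10, 11} {1, 2} s0 s1"
      "emitted pre ts s1" "fits W pre (ts @ ?g l)"
    have "l \<le> d" using l by auto
    have "n ^ l \<le> Suc n ^ l" by (intro power_mono) auto
    also have "\<dots> \<le> Suc n ^ d" using \<open>l \<le> d\<close> by (intro power_increasing) auto
    finally have "int (n ^ l) \<le> W" using nW by linarith
    then show "runs W (level_com d l) s1 (Suc n ^ d * (tuple_time n d step_time + 2) + 2)
      (\<lambda>s'. same {0, 1, 2, 5, 6, 10, 11} {1, 2} s0 s' \<and> emitted pre (ts @ ?g l) s')"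
      by (intro runs_level s1 \<open>l \<le> d\<close>)
  qed (use s e in simp_all)
  then show ?thesis unfolding k levels_time_def by simp
qed

end

section \<open>The main program\<close>

definition vars_com :: com where
  "vars_com = Seq (Assign 10 (Lit 2))
    (For 3 n_exp (Cond (Equal (Arr 3 (Reg 3)) (Lit 1)) (emit (Reg 3)) Skip))"

text \<open>Positions 0 and 1 are reserved for the tag of the answer and the number of variables,
  which are known only afterwards. Their current contents are counted as already written, so the
  prefix invariant needs no gap.\<close>

lemma runs_vars:
  assumes n: "arrs s 0 0 = int n" and V: "holds_bits n (\<lambda>i. i \<in> V) (arrs s 3)" and W: "int (n + 2) \<le> W"
  shows "runs W vars_com s (1 + (n * (3 + 2) + 2)) (\<lambda>s'. same {3, 10} {1} s s' \<and>
    outputs ([arrs s 1 0, arrs s 1 1] @ map int (filter (\<lambda>i. i \<in> V) [0..<n])) s')"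
proof -
  let ?xs = "\<lambda>i. [arrs s 1 0, arrs s 1 1] @ map int (filter (\<lambda>i. i \<in> V) [0..<i])"
  define I where "I = (\<lambda>i s'. same {3, 10} {1} s s' \<and> regs s' 3 = int i \<and> outputs (?xs i) s')"
  have "runs W vars_com s (1 + (n * (Suc 2 + 2) + 2)) (I n)"
    unfolding vars_com_def
  proof (rule runs_Seq[where ?Q1.0 = "\<lambda>s'. same {3, 10} {1} s s' \<and> outputs (?xs 0) s'"], goal_cases)
    case 1
    show ?case using W by (intro runs_Assign) (auto simp: same_def outputs_def written_def less_Suc_eq)
  next
    case (2 s1)
    show ?case
    proof (rule runs_For)
      show "I 0 (s1\<lparr>regs := (regs s1)(3 := 0)\<rparr>)" using 2 by (auto simp: I_def same_def outputs_def)
      show "regs s' 3 = int i \<and> aval n_exp s' = int n" if "I i s'" for i s'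
        using that n by (auto simp: I_def same_def)
      show "int n \<le> W" using W by simp
      fix i s2 assume i: "i < n" and s2: "I i s2"
      let ?Q = "\<lambda>s'. regs s' 3 = int i \<and> I (Suc i) (s'\<lparr>regs := (regs s')(3 := int (Suc i))\<rparr>)"
      have flag: "arrs s2 3 (int i) = of_bool (i \<in> V)" using s2 V i by (simp add: I_def same_def holds_bits_def)
      have r: "regs s2 3 = int i" using s2 by (simp add: I_def)
      show "runs W (Cond (Equal (Arr 3 (Reg 3)) (Lit 1)) (emit (Reg 3)) Skip) s2 (Suc 2) ?Q"
      proof (rule runs_Cond)
        assume "bval (Equal (Arr 3 (Reg 3)) (Lit 1)) s2"
        then have iV: "i \<in> V" using flag r by auto
        have "length (filter (\<lambda>i. i \<in> V) [0..<i]) \<le> i" using length_filter_le[of _ "[0..<i]"] by simp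
        then have "int (Suc (length (?xs i))) \<le> W" using i W by simp
        moreover have "outputs (?xs i) s2" using s2 by (simp add: I_def)
        moreover have "\<bar>aval (Reg 3) s2\<bar> \<le> W" using r i W by simp
        ultimately have "runs W (emit (Reg 3)) s2 2 (\<lambda>s'. same {10} {1} s2 s' \<and> outputs (?xs i @ [aval (Reg 3) s2]) s')"
          by (intro runs_emit)
        then show "runs W (emit (Reg 3)) s2 2 ?Q"
        proof (rule runs_weaken)
          fix s' assume s': "same {10} {1} s2 s' \<and> outputs (?xs i @ [aval (Reg 3) s2]) s'"
          then show "?Q s'" using s2 iV r by (auto simp: I_def same_def outputs_def)
        qed simp
      next
        assume "\<not> bval (Equal (Arr 3 (Reg 3)) (Lit 1)) s2"
        then have iV: "i \<notin> V" using flag r by auto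
        then have "?Q s2" using s2 by (auto simp: I_def same_def outputs_def)
        then show "runs W Skip s2 2 ?Q" by (intro runs_weaken[OF runs_Skip[of ?Q]]) auto
      qed
    qed
  qed
  then show ?thesis by (rule runs_weaken) (auto simp: I_def)
qed

text \<open>The number of terms precedes the terms but is known last. Register 12 remembers its
  position, and the slot is skipped and filled in at the end.\<close>

definition main_com :: "nat \<Rightarrow> com" where
  "main_com d =
    Seq (classes_com d (d - 1))
   (Seq vars_com
     (Cond (Less (bound_exp d) (Minus (Reg 10) (Lit 2)))
       (Store 1 (Lit 0) (Lit 0))
       (Seq (Store 1 (Lit 0) (Lit 1))
       (Seq (Store 1 (Lit 1) (Minus (Reg 10) (Lit 2)))
       (Seq (Assign 12 (Reg 10))
       (Seq (Assign 10 (Plus (Reg 10) (Lit 1)))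
       (Seq (Assign 11 (Lit 0))
       (Seq (levels_com d)
            (Store 1 (Reg 12) (Reg 11))))))))))"

definition main_time :: "nat \<Rightarrow> nat \<Rightarrow> nat \<Rightarrow> nat" where
  "main_time d n E = classes_time n (d - 1) E + ((1 + (n * (3 + 2) + 2)) +
     Suc (1 + (1 + (1 + (1 + (1 + (levels_time n d E + 1)))))))"

lemma has_output_iff_written: "has_output s xs \<longleftrightarrow> written xs (arrs s 1)"
  by (simp add: has_output_def written_def)

lemma written_extend: "written xs A \<Longrightarrow> written (xs @ [A (int (length xs))]) A"
  by (auto simp: written_def nth_append less_Suc_eq)

lemma encode_answer_Kernel:
  "encode_answer (Kernel V ts) = (1 # int (length V) # map int V) @ int (length ts) # encode_terms ts"
  by (simp add: encode_vars_def encode_terms_def)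

lemma runs_main:
  fixes d n :: nat and Cs :: "constraint list" and t :: nat
  defines "V \<equiv> kernel_vars (mleval (csp_poly d Cs)) n (kernel_const d * t ^ 2)"
  defines "F \<equiv> \<lambda>U. int (csp_val Cs (signs n (fill n V U)))"
  assumes d: "d \<ge> 1" and n: "even n" and Cs: "csp_instance d n Cs"
    and W: "1 \<le> W" "int (n + d) \<le> W" "int (n + 3) \<le> W" "int (length Cs) \<le> W" "2 ^ d \<le> W"
      "int (n ^ (2 * (d - 1))) \<le> W" "int (Suc n ^ d) \<le> W"
      "int (n + 3 + length (encode_terms (kernel_terms n d V F))) \<le> W"
  shows "runs W (main_com d) (input_state (encode_input d n Cs t))
    (main_time d n (eval_time (length (remdups Cs))))
    (\<lambda>s. has_output s (encode_answer (csp_answer d n Cs t)))"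
proof -
  let ?s = "input_state (encode_input d n Cs t)"
  let ?E = "eval_time (length (remdups Cs))"
  let ?K = "kernel_const d * t ^ 2"
  define vs where "vs = filter (\<lambda>i. i \<in> V) [0..<n]"
  have Vn: "V \<subseteq> {..<n}" by (auto simp: V_def kernel_vars_def)
  have setvs: "set vs = V" using Vn by (auto simp: vs_def)
  have vs: "sorted_list_of_set V = vs"
    using sorted_list_of_set.idem_if_sorted_distinct[of vs] setvs by (simp add: vs_def sorted_wrt_filter)
  have card: "card V = length vs" using distinct_card[of vs] setvs by (simp add: vs_def)
  have lenvs: "length vs \<le> n" using length_filter_le[of _ "[0..<n]"] by (simp add: vs_def)
  have ans: "csp_answer d n Cs t = (if length vs \<le> ?K then Kernel vs (kernel_terms n d V F) else Certified)"
    unfolding csp_answer_def Let_def V_def[symmetric] vs card F_def ..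
  let ?out = "encode_answer (csp_answer d n Cs t)"
  have inp: "input_array d n Cs t (arrs ?s 0)" by (rule input_array_input_state[OF Cs])
  have dk: "d = Suc (d - 1)" using d by simp
  have nW: "int n \<le> W" using W(2) by simp
  let ?Q1 = "\<lambda>s'. same {0..<10} {2, 3} ?s s' \<and> holds_bits n (\<lambda>i. i \<in> V) (arrs s' 3)"
  let ?I = "\<lambda>s'. input_array d n Cs t (arrs s' 0) \<and> holds_bits n (\<lambda>i. i \<in> V) (arrs s' 3)"
  show ?thesis
    unfolding main_com_def main_time_def
  proof (rule runs_Seq[where ?Q1.0 = ?I], goal_cases)
    case 1
    show ?case
      by (rule runs_weaken[OF runs_classes[OF inp Cs n dk W(1) nW W(4,6)]])
        (use inp in \<open>auto simp: same_def V_def\<close>)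
  next
    case (2 s1)
    have n1: "arrs s1 0 0 = int n" using 2 by (simp add: input_array_def)
    let ?xs = "[arrs s1 1 0, arrs s1 1 1] @ map int vs"
    show ?case
    proof (rule runs_Seq[where ?Q1.0 = "\<lambda>s'. ?I s' \<and> outputs ?xs s'"], goal_cases)
      case 1
      show ?case
      proof (rule runs_weaken[OF runs_vars[OF n1]])
        show "holds_bits n (\<lambda>i. i \<in> V) (arrs s1 3)" using 2 by blast
        show "int (n + 2) \<le> W" using W(3) by simp
        fix s' assume "same {3, 10} {1} s1 s' \<and>
          outputs ([arrs s1 1 0, arrs s1 1 1] @ map int (filter (\<lambda>i. i \<in> V) [0..<n])) s'"
        then show "?I s' \<and> outputs ?xs s'" using 2 by (simp add: same_def vs_def)
      qed simp
    next
      case (2 s2)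
      then have i2: "?I s2" and o2: "outputs ?xs s2" by auto
      have r10: "regs s2 10 = int (length vs + 2)" using o2 by (simp add: outputs_def)
      have K: "aval (bound_exp d) s2 = int ?K" using i2 by (intro aval_bound_exp) (simp add: input_array_def)
      have cond: "bval (Less (bound_exp d) (Minus (Reg 10) (Lit 2))) s2 \<longleftrightarrow> ?K < length vs"
        by (simp add: K r10 del: of_nat_mult of_nat_power)
      let ?T = "1 + (1 + (1 + (1 + (1 + (levels_time n d ?E + 1)))))"
      show ?case
      proof (rule runs_Cond)
        assume "bval (Less (bound_exp d) (Minus (Reg 10) (Lit 2))) s2"
        then have "?out = [0]" using cond by (simp add: ans)
        \<comment> \<open>The output is compared only up to its length, so the variables already
          written behind position 0 do no harm.\<close>
        then have "runs W (Store 1 (Lit 0) (Lit 0)) s2 1 (\<lambda>s. has_output s ?out)"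
          using W(1) by (intro runs_Store) (auto simp: has_output_def)
        then show "runs W (Store 1 (Lit 0) (Lit 0)) s2 ?T (\<lambda>s. has_output s ?out)"
          by (rule runs_weaken) auto
      next
        assume "\<not> bval (Less (bound_exp d) (Minus (Reg 10) (Lit 2))) s2"
        then have le: "length vs \<le> ?K" using cond by simp
        let ?pre = "1 # int (length vs) # map int vs"
        let ?ts = "kernel_terms n d V F"
        have out: "?out = ?pre @ int (length ?ts) # encode_terms ?ts"
          using le unfolding ans by (simp only: if_True encode_answer_Kernel)
        have pW: "int (length ?pre) < W" using lenvs W(3) by simp
        have two: "arrs s2 1 = A \<Longrightarrow> written ?xs A" for A using o2 by (simp add: outputs_def)
        show "runs W (Seq (Store 1 (Lit 0) (Lit 1))
         (Seq (Store 1 (Lit 1) (Minus (Reg 10) (Lit 2)))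
         (Seq (Assign 12 (Reg 10))
         (Seq (Assign 10 (Plus (Reg 10) (Lit 1)))
         (Seq (Assign 11 (Lit 0))
         (Seq (levels_com d)
              (Store 1 (Reg 12) (Reg 11)))))))) s2 ?T (\<lambda>s. has_output s ?out)"
        proof (rule runs_Seq[where ?Q1.0 = "\<lambda>s'. ?I s' \<and> regs s' 10 = int (length ?pre) \<and>
            written (1 # arrs s1 1 1 # map int vs) (arrs s' 1)"], goal_cases)
          case 1
          have "written (?xs[0 := 1]) ((arrs s2 1)(int 0 := 1))"
            by (rule written_update[OF two[OF refl]]) simp
          then show ?case using i2 r10 W(1) by (intro runs_Store) auto
        next
          case (2 s3)
          show ?case
          proof (rule runs_Seq[where ?Q1.0 = "\<lambda>s'. ?I s' \<and> regs s' 10 = int (length ?pre) \<and>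
              written ?pre (arrs s' 1)"], goal_cases)
            case 1
            have "written ((1 # arrs s1 1 1 # map int vs)[1 := int (length vs)]) ((arrs s3 1)(int 1 := int (length vs)))"
              by (rule written_update) (use 2 in auto)
            then show ?case using 2 pW by (intro runs_Store) auto
          next
            case (2 s4)
            show ?case
            proof (rule runs_Seq[where ?Q1.0 = "\<lambda>s'. ?I s' \<and> regs s' 10 = int (length ?pre) \<and>
                written ?pre (arrs s' 1) \<and> regs s' 12 = int (length ?pre)"], goal_cases)
              case 1
              show ?case using 2 pW by (intro runs_Assign) auto
            next
              case (2 s5)
              \<comment> \<open>The current content of the skipped slot serves as a placeholder for
                the number of terms.\<close>
              let ?pre' = "?pre @ [arrs s5 1 (int (length ?pre))]"
              show ?case
              proof (rule runs_Seq[where ?Q1.0 = "\<lambda>s'. ?I s' \<and> outputs ?pre' s' \<and>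
                  regs s' 12 = int (length ?pre)"], goal_cases)
                case 1
                have "written ?pre' (arrs s5 1)" using 2 by (intro written_extend) blast
                then show ?case using 2 pW by (intro runs_Assign) (auto simp: outputs_def)
              next
                case (2 s6)
                show ?case
                proof (rule runs_Seq[where ?Q1.0 = "\<lambda>s'. ?I s' \<and> emitted ?pre' [] s' \<and>
                    regs s' 12 = int (length ?pre)"], goal_cases)
                  case 1
                  show ?case using 2 W(1) by (intro runs_Assign) (auto simp: emitted_def outputs_def)
                next
                  case (2 s7)
                  show ?case
                  proof (rule runs_Seq[where ?Q1.0 = "\<lambda>s'. emitted ?pre' ?ts s' \<and>
                      regs s' 12 = int (length ?pre)"], goal_cases)
                    case 1
                    have i7: "input_array d n Cs t (arrs s7 0)" "holds_bits n (\<lambda>i. i \<in> V) (arrs s7 3)"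
                      and e7: "emitted ?pre' [] s7" using 2 by auto
                    have "fits W ?pre' ?ts" using W(8) lenvs by (simp add: fits_def)
                    from runs_levels[OF i7(1) Cs Vn i7(2) W(1,2,4,5) same_refl W(7) e7 this[unfolded F_def]]
                    show ?case
                      unfolding F_def by (rule runs_weaken) (use 2 in \<open>auto simp: same_def\<close>)
                  next
                    case (2 s8)
                    have w8: "written (?pre' @ encode_terms ?ts) (arrs s8 1)" and r8: "regs s8 11 = int (length ?ts)"
                      using 2 by (auto simp: emitted_def outputs_def)
                    have "written ((?pre' @ encode_terms ?ts)[length ?pre := int (length ?ts)])
                        ((arrs s8 1)(int (length ?pre) := int (length ?ts)))"
                      by (rule written_update[OF w8]) simp
                    moreover have "(?pre' @ encode_terms ?ts)[length ?pre := int (length ?ts)] = ?out"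
                      unfolding out append_assoc by (subst list_update_append) simp
                    ultimately have "written ?out ((arrs s8 1)(int (length ?pre) := int (length ?ts)))" by simp
                    moreover have "int (length ?ts) \<le> W"
                      using length_le_encode_terms[of ?ts] W(8) by linarith
                    ultimately show ?case using 2 r8
                      by (intro runs_Store) (auto simp: has_output_iff_written)
                  qed
                qed
              qed
            qed
          qed
        qed
      qed
    qed
  qed
qed

section \<open>Running time and word size\<close>

text \<open>The base \<open>Suc n\<close> makes the bound valid for every \<open>n\<close>,
  including 0, so sums and products of bounds need no side conditions.\<close>

definition poly_time :: "nat \<Rightarrow> (nat \<Rightarrow> nat) \<Rightarrow> bool" where
  "poly_time p T \<longleftrightarrow> (\<exists>C. \<forall>n. T n \<le> C * Suc n ^ p)"

lemma poly_time_mono: "poly_time p T \<Longrightarrow> p \<le> q \<Longrightarrow> poly_time q T"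
  unfolding poly_time_def
proof (elim exE)
  fix C assume C: "\<forall>n. T n \<le> C * Suc n ^ p" and pq: "p \<le> q"
  have "T n \<le> C * Suc n ^ q" for n
  proof -
    have "Suc n ^ p \<le> Suc n ^ q" using pq by (intro power_increasing) auto
    then show ?thesis using C[rule_format, of n] mult_le_mono2 le_trans by blast
  qed
  then show "\<exists>C. \<forall>n. T n \<le> C * Suc n ^ q" by blast
qed

lemma poly_time_const: "poly_time p (\<lambda>n. c)"
  unfolding poly_time_def by (intro exI[of _ c]) simp

lemma poly_time_id: "poly_time (Suc p) (\<lambda>n. n)"
  using poly_time_mono[of 1 "\<lambda>n. n" "Suc p"] unfolding poly_time_def by (simp add: exI[of _ 1])

lemma poly_time_add: "poly_time p S \<Longrightarrow> poly_time p T \<Longrightarrow> poly_time p (\<lambda>n. S n + T n)"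
  unfolding poly_time_def
proof (elim exE)
  fix C D assume "\<forall>n. S n \<le> C * Suc n ^ p" "\<forall>n. T n \<le> D * Suc n ^ p"
  then show "\<exists>C. \<forall>n. S n + T n \<le> C * Suc n ^ p"
    by (intro exI[of _ "C + D"]) (simp only: add_mult_distrib add_mono simp_thms)
qed

lemma poly_time_mult: "poly_time p S \<Longrightarrow> poly_time q T \<Longrightarrow> poly_time (p + q) (\<lambda>n. S n * T n)"
  unfolding poly_time_def
proof (elim exE)
  fix C D assume CD: "\<forall>n. S n \<le> C * Suc n ^ p" "\<forall>n. T n \<le> D * Suc n ^ q"
  have "S n * T n \<le> (C * D) * Suc n ^ (p + q)" for n
    using mult_le_mono[OF CD(1)[rule_format, of n] CD(2)[rule_format, of n]]
    by (simp only: power_add mult_ac)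
  then show "\<exists>C. \<forall>n. S n * T n \<le> C * Suc n ^ (p + q)" by blast
qed

lemma poly_time_cmult: "poly_time p T \<Longrightarrow> poly_time p (\<lambda>n. c * T n)"
  using poly_time_mult[OF poly_time_const[of 0 c], of p T] by simp

lemma poly_time_Suc: "poly_time p T \<Longrightarrow> poly_time p (\<lambda>n. Suc (T n))"
  using poly_time_add[OF poly_time_const[of p 1], of T] by simp

lemma poly_time_mult_n: "poly_time p T \<Longrightarrow> poly_time (Suc p) (\<lambda>n. n * T n)"
  using poly_time_mult[OF poly_time_id[of 0], of p T] by simp

lemma poly_time_power: "poly_time p (\<lambda>n. n ^ p)" and poly_time_Suc_power: "poly_time p (\<lambda>n. Suc n ^ p)"
  unfolding poly_time_def by (rule exI[of _ 1], simp add: power_mono)+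

text \<open>Two loops over variables, \<open>n^(2 d - 2)\<close> tests and evaluations of order
  \<open>n^d\<close> give the exponent \<open>3 d\<close>. Writing the kernel takes at most order
  \<open>n^d\<close> tuples, each with a constant number of evaluations, which is only
  \<open>2 d\<close>.\<close>

lemma poly_time_main:
  assumes d: "d \<ge> 1" and E: "poly_time d E"
  shows "poly_time (3 * d) (\<lambda>n. main_time d n (E n))"
proof -
  obtain k where k: "d = Suc k" using d by (cases d) auto
  note rules = poly_time_add poly_time_Suc poly_time_const
  have lin: "poly_time d (\<lambda>n. n * c)" for c
    using poly_time_mono[OF poly_time_mult_n[OF poly_time_const[of 0 c]], of d] d by simp
  have test: "poly_time d (\<lambda>n. test_time n k (E n))"
    unfolding test_time_def by (intro rules lin E)
  have "poly_time (2 * k + d) (\<lambda>n. n ^ (2 * k) * (test_time n k (E n) + 2))"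
    by (intro poly_time_mult poly_time_power rules test)
  then have "poly_time (Suc (Suc (2 * k + d))) (\<lambda>n. classes_time n k (E n))"
    unfolding classes_time_def by (intro poly_time_mult_n poly_time_add poly_time_const; assumption?)
  then have classes: "poly_time (3 * d) (\<lambda>n. classes_time n (d - 1) (E n))"
    using poly_time_mono[of "Suc (Suc (2 * k + d))" "\<lambda>n. classes_time n k (E n)" "3 * d"] by (simp add: k)
  have "poly_time d (\<lambda>n. tuple_time n d (E n) + 2)"
    unfolding tuple_time_def subset_time_def by (intro rules poly_time_cmult lin E)
  then have "poly_time (d + d) (\<lambda>n. Suc n ^ d * (tuple_time n d (E n) + 2))"
    by (intro poly_time_mult poly_time_Suc_power)
  then have "poly_time (d + d) (\<lambda>n. levels_time n d (E n))"
    unfolding levels_time_def by (intro poly_time_add poly_time_cmult poly_time_const; assumption?)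
  then have levels: "poly_time (3 * d) (\<lambda>n. levels_time n d (E n))" by (rule poly_time_mono) simp
  have "poly_time (3 * d) (\<lambda>n. n * c)" for c by (rule poly_time_mono[OF lin]) simp
  then show ?thesis unfolding main_time_def by (intro rules classes levels)
qed

lemma main_time_mono: "E \<le> E' \<Longrightarrow> main_time d n E \<le> main_time d n E'"
  unfolding main_time_def classes_time_def test_time_def levels_time_def tuple_time_def subset_time_def
  by (intro add_mono mult_le_mono order_refl Suc_le_mono[THEN iffD2]) auto

lemma poly_time_bigo: "poly_time p T \<Longrightarrow> (\<lambda>n. real (T n)) \<in> O(\<lambda>n. real n ^ p)"
  unfolding poly_time_def
proof (elim exE)
  fix C assume C: "\<forall>n. T n \<le> C * Suc n ^ p"
  show ?thesis
  proof (rule bigoI[of _ "real C * 2 ^ p"], rule eventually_at_top_linorderI[of 1])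
    fix n :: nat assume "n \<ge> 1"
    then have "Suc n ^ p \<le> (2 * n) ^ p" by (intro power_mono) auto
    then have "C * Suc n ^ p \<le> C * (2 * n) ^ p" by (rule mult_le_mono2)
    with C[rule_format, of n] have "T n \<le> C * (2 * n) ^ p" by (rule le_trans)
    then have "real (T n) \<le> real (C * (2 * n) ^ p)" by (rule of_nat_mono)
    then show "norm (real (T n)) \<le> real C * 2 ^ p * norm (real n ^ p)" by (simp add: power_mult_distrib)
  qed
qed

text \<open>There are \<open>n^d\<close> tuples of variables and \<open>2^(2^d)\<close> predicates.
  This makes the running time depend on \<open>n\<close> alone, however many constraints there
  are.\<close>

lemma length_remdups_instance:
  assumes "csp_instance d n Cs"
  shows "length (remdups Cs) \<le> n ^ d * 2 ^ (2 ^ d)"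
proof -
  let ?X = "{xs. set xs \<subseteq> {..<n} \<and> length xs = d}" and ?S = "{\<sigma> :: int list. set \<sigma> \<subseteq> {-1, 1} \<and> length \<sigma> = d}"
  have fin: "finite ?X" "finite ?S" by (simp_all add: finite_lists_length_eq)
  have "set Cs \<subseteq> ?X \<times> Pow ?S" using assms by (fastforce simp: csp_instance_def)
  then have "card (set Cs) \<le> card (?X \<times> Pow ?S)" using fin by (intro card_mono) auto
  also have "\<dots> = n ^ d * 2 ^ (2 ^ d)"
    using fin by (simp add: card_cartesian_product card_Pow card_lists_length_eq numeral_2_eq_2)
  finally show ?thesis by (simp add: length_remdups_card_conv)
qed

text \<open>There are \<open>d + 1\<close> levels with at most \<open>(n + 1)^d\<close> tuples each,
  and \<open>4^d\<close> choices of \<open>U\<close> and \<open>S\<close> per tuple. A term takes up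
  to \<open>d\<close> words for its variables and 3 for their number, the numerator and the
  denominator.\<close>

lemma length_encode_kernel_terms:
  "length (encode_terms (kernel_terms n d V F)) \<le> (d + 3) * (Suc d * (Suc n ^ d * (2 ^ d * 2 ^ d)))"
proof -
  have enc: "length (encode_terms ts) \<le> (d + 3) * length ts" if "\<forall>(S, a, b)\<in>set ts. length S \<le> d" for ts
    using that by (induction ts) (auto simp: encode_terms_def encode_vars_def)
  have "length (kernel_terms n d V F) \<le> Suc d * (Suc n ^ d * (2 ^ d * 2 ^ d))"
  proof -
    have len: "length (concat (map g L)) \<le> length L * b" if "\<And>x. x \<in> set L \<Longrightarrow> length (g x) \<le> b"
      for g :: "nat \<Rightarrow> (nat list \<times> int \<times> int) list" and L b
      using that by (induction L) (auto intro: add_mono)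
    have "length (level_terms n V F l c) \<le> 2 ^ d * 2 ^ d" if "l \<le> d" for l c
    proof -
      have "length (terms_at F (digits n l c)) = 2 ^ l * 2 ^ l"
        by (simp add: terms_at_def length_concat o_def length_subseqs sum_list_triv)
      also have "\<dots> \<le> 2 ^ d * 2 ^ d" using that by (intro mult_le_mono power_increasing) auto
      finally show ?thesis by (simp add: level_terms_def)
    qed
    then have "length (concat (map (level_terms n V F l) [0..<n ^ l])) \<le> Suc n ^ d * (2 ^ d * 2 ^ d)" if l: "l \<le> d" for l
    proof -
      assume a: "\<And>l c. l \<le> d \<Longrightarrow> length (level_terms n V F l c) \<le> 2 ^ d * 2 ^ d"
      have "length (concat (map (level_terms n V F l) [0..<n ^ l])) \<le> n ^ l * (2 ^ d * 2 ^ d)"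
        using len[of "[0..<n ^ l]" "level_terms n V F l", OF a[OF l]] by simp
      also have "n ^ l \<le> Suc n ^ l" by (intro power_mono) auto
      also have "Suc n ^ l \<le> Suc n ^ d" using l by (intro power_increasing) auto
      finally show ?thesis by simp
    qed
    then show ?thesis
      unfolding kernel_terms_eq_levels using len[of "[0..<Suc d]" "\<lambda>l. concat (map (level_terms n V F l) [0..<n ^ l])"]
      by (simp del: upt_Suc)
  qed
  moreover have "length (encode_terms (kernel_terms n d V F)) \<le> (d + 3) * length (kernel_terms n d V F)"
    using kernel_terms_wf[of _ _ _ n d V F] by (intro enc) blast
  ultimately show ?thesis by (meson le_trans mult_le_mono2)
qed

text \<open>The base \<open>B\<close> is at least 2, so constant factors are absorbed into powers:
  \<open>p < 2^p\<close>, hence \<open>p\<close> is below \<open>B^p\<close>. The exponent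
  \<open>2 d\<close> covers the test counter and \<open>(n + 1)^d\<close>, and one extra factor
  \<open>B\<close> pays for a sum of two terms.\<close>

lemma word_bound_large:
  fixes d n :: nat and Cs :: "constraint list" and t :: nat
  defines "p \<equiv> (d + 3) * Suc d * (2 ^ d * 2 ^ d)"
  defines "W \<equiv> word_bound (p + 2 * d + 4) n Cs t"
  shows "1 \<le> W" "int (n + d) \<le> W" "int (n + 3) \<le> W" "int (length Cs) \<le> W" "2 ^ d \<le> W"
      "int (n ^ (2 * (d - 1))) \<le> W" "int (Suc n ^ d) \<le> W"
      "int (n + 3 + length (encode_terms (kernel_terms n d V F))) \<le> W"
proof -
  define B where "B = n + length Cs + t + 2"
  have B: "2 \<le> B" "n + 2 \<le> B" "length Cs \<le> B" by (auto simp: B_def)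
  have W: "W = int (B ^ (p + 2 * d + 4))" by (simp add: W_def word_bound_def B_def)
  have pw: "B ^ a \<le> B ^ b" if "a \<le> b" for a b using B that by (intro power_increasing) auto
  have two: "2 ^ a \<le> B ^ a" for a using B by (intro power_mono) auto
  have n3: "n + 3 \<le> B ^ 2"
  proof -
    have "n + 3 \<le> 2 * (n + 2)" by simp
    also have "\<dots> \<le> B * B" using B by (intro mult_le_mono)
    finally show ?thesis by (simp add: power2_eq_square)
  qed
  have half: "x + y \<le> B ^ (p + 2 * d + 4)" if "x \<le> B ^ (p + 2 * d + 3)" "y \<le> B ^ (p + 2 * d + 3)" for x y
  proof -
    have "x + y \<le> 2 * B ^ (p + 2 * d + 3)" using that by simp
    also have "\<dots> \<le> B * B ^ (p + 2 * d + 3)" using B by (intro mult_le_mono1)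
    finally show ?thesis by (simp add: eval_nat_numeral)
  qed
  show "1 \<le> W" unfolding W using B by simp
  have n3': "n + 3 \<le> B ^ (p + 2 * d + 3)" using n3 pw[of 2 "p + 2 * d + 3"] by linarith
  then show "int (n + 3) \<le> W" unfolding W using half[of "n + 3" 0] by (simp only: of_nat_le_iff add_0_right zero_le)
  have d3: "d \<le> B ^ (p + 2 * d + 3)"
    using two[of d] pw[of d "p + 2 * d + 3"] less_exp[of d] by linarith
  show "int (n + d) \<le> W" unfolding W using half[of n d] n3' d3 by (simp only: of_nat_le_iff)
  show "int (length Cs) \<le> W" unfolding W using B(3) pw[of 1 "p + 2 * d + 4"] by (simp only: of_nat_le_iff) simp
  have "2 ^ d \<le> B ^ (p + 2 * d + 4)" using two[of d] pw[of d "p + 2 * d + 4"] by linarith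
  then show "2 ^ d \<le> W" unfolding W by (metis of_nat_le_iff of_nat_numeral of_nat_power)
  have "n ^ (2 * (d - 1)) \<le> B ^ (2 * (d - 1))" using B by (intro power_mono) auto
  also have "\<dots> \<le> B ^ (p + 2 * d + 4)" by (rule pw) simp
  finally show "int (n ^ (2 * (d - 1))) \<le> W" unfolding W by (simp only: of_nat_le_iff)
  have Sn: "Suc n ^ d \<le> B ^ d" using B by (intro power_mono) auto
  also have "\<dots> \<le> B ^ (p + 2 * d + 4)" by (rule pw) simp
  finally show "int (Suc n ^ d) \<le> W" unfolding W by (simp only: of_nat_le_iff)
  have "length (encode_terms (kernel_terms n d V F)) \<le> p * Suc n ^ d"
    using length_encode_kernel_terms[of n d V F] by (simp only: p_def mult_ac)
  also have "\<dots> \<le> B ^ p * B ^ d" using less_exp[of p] two[of p] Sn by (intro mult_le_mono) linarith+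
  also have "\<dots> \<le> B ^ (p + 2 * d + 3)" unfolding power_add[symmetric] by (rule pw) simp
  finally show "int (n + 3 + length (encode_terms (kernel_terms n d V F))) \<le> W"
    unfolding W using half[OF n3'] by (simp only: of_nat_le_iff)
qed

theorem theorem4p1:
  fixes d :: nat
  assumes "d \<ge> 1"
  shows "\<exists>(prog :: com) (k :: nat) (time :: nat \<Rightarrow> nat).
    (\<lambda>n. real (time n)) \<in> O(\<lambda>n. real n ^ (3 * d)) \<and>
    (\<forall>(n :: nat) (Cs :: constraint list) (t :: nat). even n \<and> csp_instance d n Cs \<longrightarrow>
      (\<exists>T s ans.
        exec (word_bound k n Cs t) prog (input_state (encode_input d n Cs t)) T s \<and>
        T \<le> time n \<and>
        has_output s (encode_answer ans) \<and>
        correct_answer d n Cs t ans))"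
proof -
  define k where "k = (d + 3) * Suc d * (2 ^ d * 2 ^ d) + 2 * d + 4"
  \<comment> \<open>The time bound may depend on \<open>n\<close> only, so it is taken at the
    largest possible number of distinct constraints.\<close>
  define time where "time = (\<lambda>n. main_time d n (eval_time (n ^ d * 2 ^ (2 ^ d))))"
  have "poly_time d (\<lambda>n. eval_time (n ^ d * 2 ^ (2 ^ d)))"
    unfolding eval_time_def using poly_time_mult[OF poly_time_power[of d] poly_time_const[of 0 "2 ^ 2 ^ d * 3"]]
    by (intro poly_time_add poly_time_const) (simp add: mult.assoc)
  then have "(\<lambda>n. real (time n)) \<in> O(\<lambda>n. real n ^ (3 * d))"
    unfolding time_def by (intro poly_time_bigo poly_time_main assms)
  moreover have "\<exists>T s ans. exec (word_bound k n Cs t) (main_com d) (input_state (encode_input d n Cs t)) T s \<and>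
      T \<le> time n \<and> has_output s (encode_answer ans) \<and> correct_answer d n Cs t ans"
    if n: "even n" and Cs: "csp_instance d n Cs" for n Cs t
  proof -
    have "runs (word_bound k n Cs t) (main_com d) (input_state (encode_input d n Cs t))
        (main_time d n (eval_time (length (remdups Cs))))
        (\<lambda>s. has_output s (encode_answer (csp_answer d n Cs t)))"
      unfolding k_def by (rule runs_main[OF assms n Cs]) (rule word_bound_large)+
    then obtain T s where "exec (word_bound k n Cs t) (main_com d) (input_state (encode_input d n Cs t)) T s"
      "T \<le> main_time d n (eval_time (length (remdups Cs)))" "has_output s (encode_answer (csp_answer d n Cs t))"
      by (auto simp: runs_def)
    moreover have "main_time d n (eval_time (length (remdups Cs))) \<le> time n"
      unfolding time_def eval_time_def using length_remdups_instance[OF Cs] by (intro main_time_mono) simp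
    ultimately show ?thesis using csp_answer_correct[OF assms n Cs, of t] le_trans by blast
  qed
  ultimately show ?thesis by blast
qed

end
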